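(* Let $n\geq 2$, let $1\leq p_1,p_2\leq\infty$ and let $p$ be defined by $\frac1p=\frac1{p_1}+\frac1{p_2}$. (1) (Region I) If $1\leq p_1\leq 2\leq p_2\leq\infty$, $p<1$ and $\alpha>n\big(\frac1{p_1}-\frac12\big)$, then $S^\alpha$ is bounded from $L^{p_1}(\mathbb{R}^n)\times L^{p_2}(\mathbb{R}^n)$ to $L^p(\mathbb{R}^n)$. If $1\leq p_2\leq 2\leq p_1\leq\infty$, $p<1$ and $\alpha>n\big(\frac1{p_2}-\frac12\big)$, then $S^\alpha$ is bounded from $L^{p_1}(\mathbb{R}^n)\times L^{p_2}(\mathbb{R}^n)$ to $L^p(\mathbb{R}^n)$. (2) (Region II) If $1\leq p_1\leq p_2\leq 2$ and $\alpha>n\big(\frac1p-1\big)-\big(\frac1{p_2}-\frac12\big)$, then $S^\alpha$ is bounded from $L^{p_1}(\mathbb{R}^n)\times L^{p_2}(\mathbb{R}^n)$ to $L^p(\mathbb{R}^n)$. If $1\leq p_2\leq p_1\leq 2$ and $\alpha>n\big(\frac1p-1\big)-\big(\frac1{p_1}-\frac12\big)$, then $S^\alpha$ is bounded from $L^{p_1}(\mathbb{R}^n)\times L^{p_2}(\mathbb{R}^n)$ to $L^p(\mathbb{R}^n)$.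
   Context: The Fourier transform is $\widehat f(\xi)=\int_{\mathbb{R}^n}f(x)e^{-2\pi i x\cdot\xi}\,dx$. For real $\alpha$, the bilinear Bochner-Riesz means of order $\alpha$ is the bilinear operator defined, for Schwartz functions $f,g$ on $\mathbb{R}^n$, by $$S^\alpha(f,g)(x)=\int\int_{|\xi|^2+|\eta|^2\leq 1}(1-|\xi|^2-|\eta|^2)^\alpha\,\widehat f(\xi)\,\widehat g(\eta)\,e^{2\pi i x\cdot(\xi+\eta)}\,d\xi\,d\eta,\qquad x\in\mathbb{R}^n.$$ For $0<p<1$, $\|h\|_p=\big(\int_{\mathbb{R}^n}|h|^p\,dx\big)^{1/p}$ denotes the usual $L^p$ quasi-norm. "$S^\alpha$ is bounded from $L^{p_1}\times L^{p_2}$ to $L^p$" means that there is a constant $C$ (independent of $f,g$) such that $\|S^\alpha(f,g)\|_p\leq C\|f\|_{p_1}\|g\|_{p_2}$ for all Schwartz functions $f,g$ (so that $S^\alpha$ extends by density; in all cases considered $p_1,p_2<\infty$ automatically). *)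

theory Defs
  imports "HOL-Analysis.Analysis" "HOL-Probability.Essential_Supremum"
begin

definition partial_deriv :: "'n \<Rightarrow> (real ^ 'n \<Rightarrow> complex) \<Rightarrow> real ^ 'n \<Rightarrow> complex"
  where "partial_deriv i f x = frechet_derivative f (at x) (axis i 1)"

primrec iter_partial_deriv ::
    "'n list \<Rightarrow> (real ^ 'n \<Rightarrow> complex) \<Rightarrow> real ^ 'n \<Rightarrow> complex"
  where
    "iter_partial_deriv [] f = f"
  | "iter_partial_deriv (i # is) f = partial_deriv i (iter_partial_deriv is f)"

text \<open>Differentiability of all iterated partial derivatives (in any order) amounts to
  \<open>f\<close> being infinitely differentiable; lists of indices play the role of multi-indices.\<close>

definition schwartz :: "(real ^ 'n \<Rightarrow> complex) \<Rightarrow> bool"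
  where "schwartz f \<longleftrightarrow>
    (\<forall>is. (\<forall>x. iter_partial_deriv is f differentiable (at x)) \<and>
          (\<forall>k::nat. bounded (range (\<lambda>x. norm x ^ k *\<^sub>R iter_partial_deriv is f x))))"

definition fourier :: "(real ^ 'n \<Rightarrow> complex) \<Rightarrow> real ^ 'n \<Rightarrow> complex"
  where "fourier f \<xi> =
    (LINT x|lborel. f x * exp (- (2 * of_real pi * \<i> * of_real (x \<bullet> \<xi>))))"

text \<open>The integrand is absolutely integrable for Schwartz \<open>f\<close>, \<open>g\<close> whenever
  \<open>\<alpha> > -1\<close>; otherwise the Bochner integral may take its default value \<open>0\<close>.
  On the sphere \<open>powr\<close> gives \<open>0\<close> for every \<open>\<alpha>\<close>, which only matters on a null set.\<close>

definition bochner_riesz ::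
    "real \<Rightarrow> (real ^ 'n \<Rightarrow> complex) \<Rightarrow> (real ^ 'n \<Rightarrow> complex) \<Rightarrow> real ^ 'n \<Rightarrow> complex"
  where "bochner_riesz \<alpha> f g x =
    (LINT (\<xi>, \<eta>) : {(\<xi>, \<eta>). (norm \<xi>)\<^sup>2 + (norm \<eta>)\<^sup>2 \<le> 1} | lborel \<Otimes>\<^sub>M lborel.
       of_real ((1 - (norm \<xi>)\<^sup>2 - (norm \<eta>)\<^sup>2) powr \<alpha>) * fourier f \<xi> * fourier g \<eta>
       * exp (2 * of_real pi * \<i> * of_real (x \<bullet> (\<xi> + \<eta>))))"

text \<open>The \<open>L\<^sup>p\<close> (quasi-)norm for exponents \<open>0 < p \<le> \<infinity>\<close>, with value \<open>\<infinity>\<close> outside \<open>L\<^sup>p\<close>.\<close>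

definition Lp_norm :: "ereal \<Rightarrow> (real ^ 'n \<Rightarrow> complex) \<Rightarrow> ennreal"
  where "Lp_norm p h =
    (if h \<notin> borel_measurable lborel then \<infinity>
     else if p = \<infinity> then esssup lborel (\<lambda>x. ennreal (norm (h x)))
     else let I = (\<integral>\<^sup>+x. ennreal (norm (h x) powr real_of_ereal p) \<partial>lborel)
          in if I = \<infinity> then \<infinity> else ennreal (enn2real I powr (1 / real_of_ereal p)))"

definition Lp_bounded ::
    "((real ^ 'n \<Rightarrow> complex) \<Rightarrow> (real ^ 'n \<Rightarrow> complex) \<Rightarrow> real ^ 'n \<Rightarrow> complex)
      \<Rightarrow> ereal \<Rightarrow> ereal \<Rightarrow> ereal \<Rightarrow> bool"
  where "Lp_bounded T p\<^sub>1 p\<^sub>2 p \<longleftrightarrow>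
    (\<exists>C::real. \<forall>f g. schwartz f \<longrightarrow> schwartz g \<longrightarrow>
       Lp_norm p (T f g) \<le> ennreal C * Lp_norm p\<^sub>1 f * Lp_norm p\<^sub>2 g)"

end

theory Submission
  imports Defs "HOL-Complex_Analysis.Complex_Analysis" "HOL-Probability.Probability"
begin

text \<open>
  The function \<open>u\<^sub>+ powr \<alpha> / Gamma (\<alpha> + 1)\<close> is the inverse Laplace transform of \<open>z powr - (\<alpha> + 1)\<close>.
  Taking \<open>u = 1 - |\<xi>|\<^sup>2 - |\<eta>|\<^sup>2\<close> writes the bilinear operator as an integral over the line
  \<open>z = 1 + \<i>t\<close> of \<open>exp z * z powr - (\<alpha> + 1)\<close> times the product of two complex heat flows at time
  \<open>z\<close>, whose kernels are explicit Gaussians. Cut the line into the shells \<open>|t| \<approx> R = 2^j\<close>; the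
  heat kernel on a shell decays like a Gaussian at scale \<open>R\<close>, so up to a rapidly decreasing
  error each piece is local at scale \<open>R powr (1 + \<epsilon>)\<close>.

  Two estimates hold for a piece: van der Corput's lemma in \<open>t\<close> bounds its kernel pointwise by
  \<open>R powr (- \<alpha> - n - 1 / 2)\<close>, and Cauchy-Schwarz bounds it from \<open>L\<^sup>2 \<times> L\<^sup>2\<close> to \<open>L\<^sup>1\<close> by
  \<open>R powr - \<alpha>\<close>, because the autocorrelation of the heat kernel on the line does not depend on
  \<open>t\<close>. The same autocorrelation gives a Bernstein inequality from \<open>L\<^sup>p\<close>, \<open>p \<le> 2\<close>, to \<open>L\<^sup>2\<close>. In
  Region I, Bernstein on one function and Hoelder on the other, localized one give the local
  bound; in Region II the two estimates are interpolated on pairs of dyadic level sets, which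
  costs only a power of \<open>log R\<close>. Averaging the local bounds over all balls of radius
  \<open>R powr (1 + \<epsilon>)\<close> makes them global, and for \<open>p \<le> 1\<close> the \<open>p\<close>-th powers of the quasi-norms of the
  pieces add up.
\<close>

section \<open>Complex Gaussians and Laplace inversion\<close>

text \<open>The variable t is dual to 1 - |\<xi>|^2 - |\<eta>|^2, so the shell |t| about R plays the
  part of the usual cut-off at distance 1/R from the unit sphere. Its advantage is that exp (z u)
  factors into a function of \<xi> and a function of \<eta>: each piece is a superposition of
  products of two linear flows. The line Re z = 1 confines frequencies to one fixed Gaussian, so
  estimates into L^2 carry no power of R, while |z| about R spreads the kernels to distance R.

  Since L^p with p < 1 has neither duality nor a triangle inequality, pieces are estimated in L^1 on
  balls of radius about R, and passing from L^1 to L^p there costs R^(n(1/p - 1)). The kernel bound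
  times the volume of the ball gives norm R^(-\<alpha> - 1/2) on L^1 x L^1, against R^(-\<alpha>) on
  L^2 x L^2. That half power, due to oscillation in t, is the whole gain in Region II: interpolation
  gives it the weight 2/\<open>p\<^sub>2\<close> - 1, hence the term 1/\<open>p\<^sub>2\<close> -
  1/2. The conditions on \<alpha> are strict, which leaves room for the factors R^\<epsilon> of the
  enlarged balls and for powers of log R.\<close>

abbreviation Lp_mass :: "real \<Rightarrow> ('a::euclidean_space \<Rightarrow> complex) \<Rightarrow> ennreal"
  where "Lp_mass p f \<equiv> \<integral>\<^sup>+x. ennreal (norm (f x) powr p) \<partial>lborel"

text \<open>Young's inequality, integrated after division by \<open>U\<close> and \<open>V\<close>.
  Working with masses instead of norms lets one form serve as Cauchy-Schwarz, as Hoelder's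
  inequality for any exponents and, when \<open>v\<close> is an indicator, as the comparison of L^r
  norms on a set of finite measure. At \<theta> = 1 both sides agree with
  \<open>0 powr 0 = 0\<close>.\<close>

lemma nn_integral_Holder_powr:
  fixes u v :: "'a \<Rightarrow> real"
  assumes [measurable]: "u \<in> borel_measurable M" "v \<in> borel_measurable M"
    and nonneg: "\<And>x. 0 \<le> u x" "\<And>x. 0 \<le> v x"
    and \<theta>: "0 < \<theta>" "\<theta> \<le> 1"
    and U: "0 \<le> U" "(\<integral>\<^sup>+x. ennreal (u x) \<partial>M) \<le> ennreal U"
    and V: "0 \<le> V" "(\<integral>\<^sup>+x. ennreal (v x) \<partial>M) \<le> ennreal V"
  shows "(\<integral>\<^sup>+x. ennreal (u x powr \<theta> * v x powr (1 - \<theta>)) \<partial>M)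
           \<le> ennreal (U powr \<theta> * V powr (1 - \<theta>))"
proof (cases "U = 0 \<or> V = 0")
  case True
  have "AE x in M. u x = 0 \<or> v x = 0"
  proof (cases "U = 0")
    case True
    then have "(\<integral>\<^sup>+x. ennreal (u x) \<partial>M) = 0" using U by simp
    then have "AE x in M. ennreal (u x) = 0" by (subst (asm) nn_integral_0_iff_AE) auto
    then show ?thesis using nonneg by (auto simp: ennreal_eq_0_iff intro: order_antisym)
  next
    case False
    then have "(\<integral>\<^sup>+x. ennreal (v x) \<partial>M) = 0" using V True by simp
    then have "AE x in M. ennreal (v x) = 0" by (subst (asm) nn_integral_0_iff_AE) auto
    then show ?thesis using nonneg by (auto simp: ennreal_eq_0_iff intro: order_antisym)
  qed
  then have "AE x in M. ennreal (u x powr \<theta> * v x powr (1 - \<theta>)) = 0" by eventually_elim auto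
  then have "(\<integral>\<^sup>+x. ennreal (u x powr \<theta> * v x powr (1 - \<theta>)) \<partial>M) = 0"
    by (subst nn_integral_0_iff_AE) auto
  then show ?thesis by simp
next
  case False
  then have pos: "U > 0" "V > 0" using U V by auto
  define c where "c = U powr \<theta> * V powr (1 - \<theta>)"
  have c: "c > 0" using pos by (simp add: c_def)
  have *: "u x powr \<theta> * v x powr (1 - \<theta>) \<le> c * (\<theta> / U) * u x + c * ((1 - \<theta>) / V) * v x" for x
  proof (cases "u x = 0 \<or> v x = 0")
    case True
    then show ?thesis using nonneg[of x] c pos \<theta> by auto
  next
    case False
    then have p: "u x > 0" "v x > 0" using nonneg[of x] by auto
    have "(u x / U) powr \<theta> * (v x / V) powr (1 - \<theta>) \<le> \<theta> * (u x / U) + (1 - \<theta>) * (v x / V)"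
      using p pos \<theta> by (intro Youngs_inequality_0) auto
    then have "c * ((u x / U) powr \<theta> * (v x / V) powr (1 - \<theta>)) \<le> c * (\<theta> * (u x / U) + (1 - \<theta>) * (v x / V))"
      using c by (intro mult_left_mono) auto
    moreover have "c * ((u x / U) powr \<theta> * (v x / V) powr (1 - \<theta>)) = u x powr \<theta> * v x powr (1 - \<theta>)"
      using p pos by (simp add: c_def powr_divide)
    ultimately show ?thesis by (simp add: algebra_simps)
  qed
  have "(\<integral>\<^sup>+x. ennreal (u x powr \<theta> * v x powr (1 - \<theta>)) \<partial>M)
      \<le> (\<integral>\<^sup>+x. ennreal (c * (\<theta> / U)) * ennreal (u x) + ennreal (c * ((1 - \<theta>) / V)) * ennreal (v x) \<partial>M)"
  proof (intro nn_integral_mono)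
    fix x
    show "ennreal (u x powr \<theta> * v x powr (1 - \<theta>)) \<le> ennreal (c * (\<theta> / U)) * ennreal (u x) + ennreal (c * ((1 - \<theta>) / V)) * ennreal (v x)"
      using * [of x] c pos \<theta> nonneg[of x]
      by (simp add: ennreal_mult[symmetric] ennreal_plus[symmetric] del: ennreal_plus)
  qed
  also have "\<dots> = ennreal (c * (\<theta> / U)) * (\<integral>\<^sup>+x. ennreal (u x) \<partial>M) + ennreal (c * ((1 - \<theta>) / V)) * (\<integral>\<^sup>+x. ennreal (v x) \<partial>M)"
    by (simp add: nn_integral_add nn_integral_cmult)
  also have "\<dots> \<le> ennreal (c * (\<theta> / U)) * ennreal U + ennreal (c * ((1 - \<theta>) / V)) * ennreal V"
    by (intro add_mono mult_left_mono U V) auto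
  also have "\<dots> = ennreal (c * (\<theta> / U) * U + c * ((1 - \<theta>) / V) * V)"
    using c pos \<theta> by (simp add: ennreal_mult[symmetric] ennreal_plus[symmetric] del: ennreal_plus)
  also have "c * (\<theta> / U) * U + c * ((1 - \<theta>) / V) * V = c"
    using pos by (simp add: field_simps)
  finally show ?thesis by (simp add: c_def)
qed

section \<open>Analytic continuation of Laplace-type integrals\<close>

lemma norm_exp_minus_one_le: "norm (exp w - 1) \<le> norm w * exp (norm w)" for w :: complex
proof -
  have "norm (exp w - exp 0) \<le> exp (norm w) * norm (w - 0)"
  proof (rule field_differentiable_bound[where S = "cball 0 (norm w)" and f' = exp])
    show "norm (exp z) \<le> exp (norm w)" if "z \<in> cball 0 (norm w)" for z :: complex
      using that complex_Re_le_cmod[of z] by (simp add: norm_exp_eq_Re) 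
  qed (auto intro!: derivative_eq_intros)
  then show ?thesis by (simp add: mult.commute)
qed

text \<open>Dominated convergence of difference quotients along sequences. Together with the
  identity theorem below it carries Gaussian and Gamma integrals from real parameters to the right
  half-plane.\<close>

lemma holomorphic_laplace_integral:
  fixes g :: "'a \<Rightarrow> complex" and \<phi> :: "'a \<Rightarrow> real"
  assumes [measurable]: "g \<in> borel_measurable M" "\<phi> \<in> borel_measurable M"
    and \<phi>: "\<And>x. 0 \<le> \<phi> x"
    and int: "\<And>a. 0 < a \<Longrightarrow> integrable M (\<lambda>x. exp (- (a * \<phi> x)) * norm (g x))"
  shows "(\<lambda>w. \<integral>x. g x * exp (- (w * of_real (\<phi> x))) \<partial>M) holomorphic_on {w. 0 < Re w}"
    (is "?F holomorphic_on _")
proof -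
  have I: "integrable M (\<lambda>x. g x * exp (- (w * of_real (\<phi> x))))" if "0 < Re w" for w
    by (rule Bochner_Integration.integrable_bound[OF int[OF that]]) (auto simp: norm_mult norm_exp_eq_Re)
  have "(?F has_field_derivative (\<integral>x. g x * (- of_real (\<phi> x) * exp (- (w * of_real (\<phi> x)))) \<partial>M)) (at w)"
    if w: "0 < Re w" for w
    unfolding has_field_derivative_iff tendsto_at_iff_sequentially
  proof (intro allI impI)
    fix X :: "nat \<Rightarrow> complex" assume X: "\<forall>i. X i \<in> UNIV - {w}" "X \<longlonglongrightarrow> w"
    \<comment> \<open>The available decay is exp (-2 a \<phi>): one \<open>a\<close> pays for the
      increment, \<open>norm h < a\<close>, and \<open>a / 2\<close> pays for the factor \<phi>
      produced by differentiation. The majorant keeps the remaining \<open>a / 2\<close>.\<close>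
    define a where "a = Re w / 2"
    have a: "a > 0" using w by (simp add: a_def)
    from X(2) a obtain N where N: "\<And>i. i \<ge> N \<Longrightarrow> norm (X i - w) < a"
      unfolding LIMSEQ_iff by metis
    define q where "q = (\<lambda>y x. g x * ((exp (- (y * of_real (\<phi> x))) - exp (- (w * of_real (\<phi> x)))) / (y - w)))"
    have "(\<lambda>i. \<integral>x. q (X (i + N)) x \<partial>M) \<longlonglongrightarrow> (\<integral>x. g x * (- of_real (\<phi> x) * exp (- (w * of_real (\<phi> x)))) \<partial>M)"
    proof (rule integral_dominated_convergence)
      show "integrable M (\<lambda>x. 2 / a * (exp (- (a / 2 * \<phi> x)) * norm (g x)))"
        using int[of "a / 2"] a by (intro integrable_mult_right) auto
      show "AE x in M. (\<lambda>i. q (X (i + N)) x) \<longlonglongrightarrow> g x * (- of_real (\<phi> x) * exp (- (w * of_real (\<phi> x))))"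
      proof (rule AE_I2)
        fix x
        have "((\<lambda>y. exp (- (y * of_real (\<phi> x)))) has_field_derivative (- of_real (\<phi> x) * exp (- (w * of_real (\<phi> x))))) (at w)"
          by (auto intro!: derivative_eq_intros)
        then have "(\<lambda>i. (exp (- (X i * of_real (\<phi> x))) - exp (- (w * of_real (\<phi> x)))) / (X i - w)) \<longlonglongrightarrow> - of_real (\<phi> x) * exp (- (w * of_real (\<phi> x)))"
          using X unfolding has_field_derivative_iff tendsto_at_iff_sequentially by (auto simp: o_def)
        then show "(\<lambda>i. q (X (i + N)) x) \<longlonglongrightarrow> g x * (- of_real (\<phi> x) * exp (- (w * of_real (\<phi> x))))"
          unfolding q_def by (intro tendsto_mult tendsto_const LIMSEQ_ignore_initial_segment)
      qed
      fix i
      define h where "h = X (i + N) - w"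
      have h: "norm h < a" "h \<noteq> 0" using N[of "i + N"] X(1) by (auto simp: h_def)
      show "AE x in M. norm (q (X (i + N)) x) \<le> 2 / a * (exp (- (a / 2 * \<phi> x)) * norm (g x))"
      proof (rule AE_I2)
        fix x
        have "exp (- (X (i + N) * of_real (\<phi> x))) - exp (- (w * of_real (\<phi> x))) = exp (- (w * of_real (\<phi> x))) * (exp (- (h * of_real (\<phi> x))) - 1)"
          by (simp add: h_def algebra_simps exp_diff exp_add[symmetric] exp_minus inverse_eq_divide)
        then have "norm (q (X (i + N)) x) = norm (g x) * (exp (- (2 * a * \<phi> x)) * norm (exp (- (h * of_real (\<phi> x))) - 1) / norm h)"
          by (simp add: q_def h_def[symmetric] norm_mult norm_divide norm_exp_eq_Re a_def)
        also have "\<dots> \<le> norm (g x) * (exp (- (2 * a * \<phi> x)) * (norm h * \<phi> x * exp (norm h * \<phi> x)) / norm h)"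
          using norm_exp_minus_one_le[of "- (h * of_real (\<phi> x))"] \<phi>[of x]
          by (intro mult_left_mono divide_right_mono) (auto simp: norm_mult)
        also have "\<dots> = norm (g x) * (exp (- (2 * a * \<phi> x)) * (\<phi> x * exp (norm h * \<phi> x)))"
          using h by simp
        also have "\<dots> \<le> norm (g x) * (exp (- (2 * a * \<phi> x)) * ((2 / a * exp (a / 2 * \<phi> x)) * exp (a * \<phi> x)))"
        proof (intro mult_left_mono mult_mono)
          have "a / 2 * \<phi> x \<le> exp (a / 2 * \<phi> x)" using exp_ge_add_one_self[of "a / 2 * \<phi> x"] by linarith
          then show "\<phi> x \<le> 2 / a * exp (a / 2 * \<phi> x)" using a by (simp add: field_simps)
        qed (use a h \<phi>[of x] in \<open>auto intro: mult_right_mono\<close>)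
        also have "exp (- (2 * a * \<phi> x)) * ((2 / a * exp (a / 2 * \<phi> x)) * exp (a * \<phi> x)) = 2 / a * exp (- (a / 2 * \<phi> x))"
          by (simp add: exp_add[symmetric] field_simps)
        finally show "norm (q (X (i + N)) x) \<le> 2 / a * (exp (- (a / 2 * \<phi> x)) * norm (g x))" by (simp add: mult_ac)
      qed
    qed (auto simp: q_def)
    moreover have "(\<integral>x. q (X (i + N)) x \<partial>M) = (?F (X (i + N)) - ?F w) / (X (i + N) - w)" for i
    proof -
      have "\<bar>Re (X (i + N) - w)\<bar> < a" using abs_Re_le_cmod[of "X (i + N) - w"] N[of "i + N"] by auto
      then have "Re (X (i + N)) > 0" using w unfolding a_def minus_complex.simps by linarith
      then have "?F (X (i + N)) - ?F w = (\<integral>x. g x * exp (- (X (i + N) * of_real (\<phi> x))) - g x * exp (- (w * of_real (\<phi> x))) \<partial>M)"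
        using I w by (subst Bochner_Integration.integral_diff) auto
      then show ?thesis by (simp add: q_def right_diff_distrib)
    qed
    ultimately have "(\<lambda>i. (?F (X (i + N)) - ?F w) / (X (i + N) - w)) \<longlonglongrightarrow> (\<integral>x. g x * (- of_real (\<phi> x) * exp (- (w * of_real (\<phi> x)))) \<partial>M)" by simp
    then show "((\<lambda>y. (?F y - ?F w) / (y - w)) \<circ> X) \<longlonglongrightarrow> (\<integral>x. g x * (- of_real (\<phi> x) * exp (- (w * of_real (\<phi> x)))) \<partial>M)"
      unfolding o_def by (rule LIMSEQ_offset)
  qed
  then show ?thesis
    by (intro derivative_intros holomorphic_onI) (auto simp: field_differentiable_def intro: has_field_derivative_at_within)
qed

text \<open>This is the characteristic function of the standard normal law after the substitution t
  = s / sqrt (2 a). The value is written with \<open>csqrt\<close> so that the same expression is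
  holomorphic in the parameter and can be continued.\<close>

lemma gaussian_fourier_1d_real:
  fixes a x :: real assumes a: "a > 0"
  shows "integrable lborel (\<lambda>t. exp (- (a * t\<^sup>2)))"
    and "(\<integral>t. exp (2 * pi * \<i> * (x * t)) * exp (- (of_real a * of_real (t\<^sup>2))) \<partial>lborel)
           = csqrt (of_real pi / of_real a) * exp (- (of_real pi ^ 2 * of_real x ^ 2 / of_real a))"
proof -
  define c where "c = 1 / sqrt (2 * a)"
  have c: "c > 0" and c2: "a * c\<^sup>2 = 1 / 2" using a by (auto simp: c_def power_divide)
  have e: "exp (- (a * (0 + c * s)\<^sup>2)) = sqrt (2 * pi) * std_normal_density s" for s
    using c2 by (simp add: std_normal_density_def power_mult_distrib mult.assoc[symmetric])
  have "integrable lborel (\<lambda>s. exp (- (a * (0 + c * s)\<^sup>2)))"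
    unfolding e by (intro integrable_mult_right) auto
  then show "integrable lborel (\<lambda>t. exp (- (a * t\<^sup>2)))"
    using lborel_integrable_real_affine_iff[of c "\<lambda>t. exp (- (a * t\<^sup>2))" 0] c by simp
  define \<tau> where "\<tau> = 2 * pi * x * c"
  have "(\<integral>t. exp (2 * pi * \<i> * (x * t)) * exp (- (of_real a * of_real (t\<^sup>2))) \<partial>lborel)
     = c *\<^sub>R (\<integral>s. exp (2 * pi * \<i> * (x * (0 + c * s))) * exp (- (of_real a * of_real ((0 + c * s)\<^sup>2))) \<partial>lborel)"
    using c by (subst lborel_integral_real_affine[where c = c and t = 0]) auto
  also have "(\<lambda>s. exp (2 * pi * \<i> * (x * (0 + c * s))) * exp (- (of_real a * of_real ((0 + c * s)\<^sup>2))))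
      = (\<lambda>s. sqrt (2 * pi) * (std_normal_density s *\<^sub>R iexp (\<tau> * s)))"
  proof
    fix s
    have "exp (- (complex_of_real a * of_real ((0 + c * s)\<^sup>2))) = of_real (exp (- (a * (0 + c * s)\<^sup>2)))"
      by (simp only: of_real_mult[symmetric] of_real_minus[symmetric] exp_of_real)
    then show "exp (2 * pi * \<i> * (x * (0 + c * s))) * exp (- (of_real a * of_real ((0 + c * s)\<^sup>2)))
      = sqrt (2 * pi) * (std_normal_density s *\<^sub>R iexp (\<tau> * s))"
      unfolding e by (simp add: \<tau>_def scaleR_conv_of_real mult_ac)
  qed
  also have "(\<integral>s. sqrt (2 * pi) * (std_normal_density s *\<^sub>R iexp (\<tau> * s)) \<partial>lborel)
      = sqrt (2 * pi) * char std_normal_distribution \<tau>"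
    unfolding char_def integral_mult_right_zero by (subst integral_density) auto
  also have "\<dots> = sqrt (2 * pi) * exp (- (\<tau>\<^sup>2) / 2)"
    unfolding char_std_normal_distribution by simp
  also have "c *\<^sub>R complex_of_real (sqrt (2 * pi) * exp (- (\<tau>\<^sup>2) / 2)) = complex_of_real (sqrt (pi / a) * exp (- (\<tau>\<^sup>2 / 2)))"
    using a by (simp add: c_def scaleR_conv_of_real real_sqrt_divide real_sqrt_mult)
  also have "\<tau>\<^sup>2 / 2 = pi\<^sup>2 * x\<^sup>2 / a"
    using a by (simp add: \<tau>_def c_def power_mult_distrib power_divide real_sqrt_pow2)
  finally show "(\<integral>t. exp (2 * pi * \<i> * (x * t)) * exp (- (of_real a * of_real (t\<^sup>2))) \<partial>lborel)
           = csqrt (of_real pi / of_real a) * exp (- (of_real pi ^ 2 * of_real x ^ 2 / of_real a))"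
    using a by (simp add: exp_of_real[symmetric] csqrt_of_real_nonneg)
qed

lemma pi_divide_not_nonpos_Reals:
  assumes "0 < Re z" shows "of_real pi / z \<notin> \<real>\<^sub>\<le>\<^sub>0"
proof
  assume "of_real pi / z \<in> \<real>\<^sub>\<le>\<^sub>0"
  then have "Re (of_real pi / z) \<le> 0" by (auto simp: complex_nonpos_Reals_iff)
  moreover have "Re (of_real pi / z) > 0" using assms by (auto simp: Re_divide intro!: divide_pos_pos add_pos_nonneg)
  ultimately show False by simp
qed

text \<open>Identity theorem: the positive reals accumulate at 1, inside the connected
  half-plane.\<close>

lemma holomorphic_eq_on_half_plane:
  assumes hol: "F holomorphic_on {w. 0 < Re w}" "G holomorphic_on {w. 0 < Re w}"
    and eq: "\<And>a. 0 < a \<Longrightarrow> F (of_real a) = G (of_real a)" and z: "0 < Re z"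
  shows "F z = G z"
proof -
  have "F z - G z = 0"
  proof (rule analytic_continuation[where f = "\<lambda>z. F z - G z" and U = "complex_of_real ` {0<..}" and S = "{w. 0 < Re w}" and \<xi> = 1])
    show "(\<lambda>z. F z - G z) holomorphic_on {w. 0 < Re w}" by (intro holomorphic_on_diff hol)
    show "open {w. 0 < Re w}" "connected {w. 0 < Re w}"
      by (auto simp: open_halfspace_Re_gt intro!: convex_connected convex_halfspace_Re_gt)
    show "1 islimpt complex_of_real ` {0<..}"
      unfolding islimpt_approachable
    proof (intro allI impI)
      fix e :: real assume "e > 0"
      then show "\<exists>x'\<in>complex_of_real ` {0<..}. x' \<noteq> 1 \<and> dist x' 1 < e"
        by (intro bexI[OF _ imageI[of "1 + e / 2"]]) (auto simp: dist_norm norm_divide)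
    qed
  qed (use eq z in auto)
  then show ?thesis by simp
qed

lemma gaussian_fourier_1d:
  fixes z :: complex and x :: real assumes z: "0 < Re z"
  shows "integrable lborel (\<lambda>t. exp (2 * pi * \<i> * (x * t)) * exp (- (z * of_real (t\<^sup>2))))" (is ?int)
    and "(\<integral>t. exp (2 * pi * \<i> * (x * t)) * exp (- (z * of_real (t\<^sup>2))) \<partial>lborel)
           = csqrt (of_real pi / z) * exp (- (of_real pi ^ 2 * of_real x ^ 2 / z))" (is "?F z = ?G z")
proof -
  show ?int
    by (rule Bochner_Integration.integrable_bound[OF gaussian_fourier_1d_real(1)[OF z]]) (auto simp: norm_mult norm_exp_eq_Re)
  show "?F z = ?G z"
  proof (rule holomorphic_eq_on_half_plane[where F = ?F and G = ?G])
    show "?F holomorphic_on {w. 0 < Re w}"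
    proof (rule holomorphic_laplace_integral)
      show "integrable lborel (\<lambda>t. exp (- (a * t\<^sup>2)) * norm (exp (2 * pi * \<i> * (x * t))))" if "0 < a" for a
        using gaussian_fourier_1d_real(1)[OF that] by (simp add: norm_exp_eq_Re)
    qed auto
    show "?G holomorphic_on {w. 0 < Re w}"
      by (intro holomorphic_intros holomorphic_on_csqrt') (use pi_divide_not_nonpos_Reals in auto)
  qed (use gaussian_fourier_1d_real(2)[of _ x] z in auto)
qed

lemma lborel_integral_prod_Basis:
  fixes f :: "'a::euclidean_space \<Rightarrow> real \<Rightarrow> 'b::{real_normed_field,banach,second_countable_topology}"
  assumes f: "\<And>b. b \<in> Basis \<Longrightarrow> integrable lborel (f b)"
  shows "integrable lborel (\<lambda>x. \<Prod>b\<in>Basis. f b (x \<bullet> b))"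
    and "(\<integral>x. (\<Prod>b\<in>Basis. f b (x \<bullet> b)) \<partial>lborel) = (\<Prod>b\<in>Basis. \<integral>t. f b t \<partial>lborel)"
proof -
  interpret product_sigma_finite "\<lambda>_::'a. lborel :: real measure" ..
  have [measurable]: "f b \<in> borel_measurable borel" if "b \<in> Basis" for b
    using borel_measurable_integrable[OF f[OF that]] by simp
  have eq: "(\<Prod>b\<in>Basis. f b ((\<Sum>c\<in>Basis. g c *\<^sub>R c) \<bullet> b)) = (\<Prod>b\<in>Basis. f b (g b))" for g :: "'a \<Rightarrow> real"
    by (rule prod.cong) simp_all
  have m: "(\<lambda>g. \<Sum>b\<in>Basis. g b *\<^sub>R b) \<in> (\<Pi>\<^sub>M b\<in>Basis. lborel) \<rightarrow>\<^sub>M (borel :: 'a measure)"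
  proof (intro borel_measurable_sum borel_measurable_scaleR borel_measurable_const)
    show "(\<lambda>g. g b) \<in> borel_measurable (\<Pi>\<^sub>M b\<in>Basis. (lborel :: real measure))" if "b \<in> Basis" for b :: 'a
      using measurable_component_singleton[OF that, of "\<lambda>_. lborel :: real measure"] by simp
  qed
  have m2: "(\<lambda>x. \<Prod>b\<in>Basis. f b (x \<bullet> b)) \<in> borel_measurable borel"
  proof (intro borel_measurable_prod)
    show "(\<lambda>x. f b (x \<bullet> b)) \<in> borel_measurable borel" if "b \<in> Basis" for b :: 'a
      by (rule measurable_compose[of "\<lambda>x. x \<bullet> b" borel borel "f b"]) (simp_all add: that)
  qed
  note ints = product_integrable_prod[OF finite_Basis f] product_integral_prod[OF finite_Basis f]
  show "integrable lborel (\<lambda>x. \<Prod>b\<in>Basis. f b (x \<bullet> b))"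
    by (subst lborel_eq[where 'a = 'a], subst integrable_distr_eq[OF m m2], subst eq) (rule ints(1))
  show "(\<integral>x. (\<Prod>b\<in>Basis. f b (x \<bullet> b)) \<partial>lborel) = (\<Prod>b\<in>Basis. \<integral>t. f b t \<partial>lborel)"
    by (subst lborel_eq[where 'a = 'a], subst integral_distr[OF m m2], subst eq) (rule ints(2))
qed

lemma exp_inner_gaussian_eq_prod:
  fixes x \<xi> :: "'a::euclidean_space" and z :: complex
  shows "exp (2 * pi * \<i> * of_real (x \<bullet> \<xi>)) * exp (- (z * of_real ((norm \<xi>)\<^sup>2)))
    = (\<Prod>b\<in>Basis. exp (2 * pi * \<i> * ((x \<bullet> b) * (\<xi> \<bullet> b))) * exp (- (z * of_real ((\<xi> \<bullet> b)\<^sup>2))))"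
proof -
  have 1: "of_real (x \<bullet> \<xi>) = (\<Sum>b\<in>Basis. complex_of_real (x \<bullet> b) * of_real (\<xi> \<bullet> b))"
    by (subst euclidean_inner) simp
  have 2: "complex_of_real ((norm \<xi>)\<^sup>2) = (\<Sum>b\<in>Basis. of_real ((\<xi> \<bullet> b)\<^sup>2))"
    unfolding power2_norm_eq_inner by (subst euclidean_inner) (simp add: power2_eq_square)
  show ?thesis
    unfolding 1 2 exp_add[symmetric]
    by (subst exp_sum[symmetric]) (auto simp: sum.distrib sum_distrib_left sum_negf sum_subtractf)
qed

text \<open>The inverse Fourier transform of exp (- z |\<xi>|^2) in the normalization with 2 pi in
  the exponent. The power of a square root is what the product over coordinates yields; its branch
  is the one obtained by continuation from z > 0.\<close>

definition heat_kernel :: "complex \<Rightarrow> 'a::euclidean_space \<Rightarrow> complex"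
  where "heat_kernel z x = csqrt (of_real pi / z) ^ DIM('a) * exp (- (of_real (pi\<^sup>2 * (norm x)\<^sup>2) / z))"

lemma gaussian_fourier:
  fixes x :: "'a::euclidean_space" and z :: complex assumes z: "0 < Re z"
  shows "integrable lborel (\<lambda>\<xi>::'a. exp (2 * pi * \<i> * of_real (x \<bullet> \<xi>)) * exp (- (z * of_real ((norm \<xi>)\<^sup>2))))"
    and "(\<integral>\<xi>. exp (2 * pi * \<i> * of_real (x \<bullet> \<xi>)) * exp (- (z * of_real ((norm \<xi>)\<^sup>2))) \<partial>lborel) = heat_kernel z x"
proof -
  show "integrable lborel (\<lambda>\<xi>::'a. exp (2 * pi * \<i> * of_real (x \<bullet> \<xi>)) * exp (- (z * of_real ((norm \<xi>)\<^sup>2))))"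
    unfolding exp_inner_gaussian_eq_prod
    by (rule lborel_integral_prod_Basis(1)[of "\<lambda>b t. exp (2 * pi * \<i> * ((x \<bullet> b) * t)) * exp (- (z * of_real (t\<^sup>2)))"])
      (rule gaussian_fourier_1d(1)[OF z])
  have norm_sq: "(norm x)\<^sup>2 = (\<Sum>b\<in>Basis. (x \<bullet> b)\<^sup>2)"
    unfolding power2_norm_eq_inner by (subst euclidean_inner) (simp add: power2_eq_square)
  have "(\<integral>\<xi>. exp (2 * pi * \<i> * of_real (x \<bullet> \<xi>)) * exp (- (z * of_real ((norm \<xi>)\<^sup>2))) \<partial>lborel)
      = (\<integral>\<xi>. (\<Prod>b\<in>(Basis::'a set). exp (2 * pi * \<i> * ((x \<bullet> b) * (\<xi> \<bullet> b))) * exp (- (z * of_real ((\<xi> \<bullet> b)\<^sup>2)))) \<partial>lborel)"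
    by (simp only: exp_inner_gaussian_eq_prod)
  also have "\<dots> = (\<Prod>b\<in>(Basis::'a set). \<integral>t. exp (2 * pi * \<i> * ((x \<bullet> b) * t)) * exp (- (z * of_real (t\<^sup>2))) \<partial>lborel)"
    by (rule lborel_integral_prod_Basis(2)) (rule gaussian_fourier_1d(1)[OF z])
  also have "\<dots> = (\<Prod>b\<in>(Basis::'a set). csqrt (of_real pi / z) * exp (- (of_real pi ^ 2 * of_real (x \<bullet> b) ^ 2 / z)))"
    by (rule prod.cong[OF refl], rule gaussian_fourier_1d(2)[OF z])
  also have "\<dots> = csqrt (of_real pi / z) ^ DIM('a) * exp (\<Sum>b\<in>(Basis::'a set). - (of_real pi ^ 2 * of_real (x \<bullet> b) ^ 2 / z))"
    by (simp add: prod.distrib exp_sum)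
  also have "(\<Sum>b\<in>(Basis::'a set). - (of_real pi ^ 2 * of_real (x \<bullet> b) ^ 2 / z)) = - (of_real (pi\<^sup>2 * (norm x)\<^sup>2) / z)"
    unfolding norm_sq by (simp add: sum_negf sum_divide_distrib sum_distrib_left)
  finally show "(\<integral>\<xi>. exp (2 * pi * \<i> * of_real (x \<bullet> \<xi>)) * exp (- (z * of_real ((norm \<xi>)\<^sup>2))) \<partial>lborel) = heat_kernel z x"
    unfolding heat_kernel_def .
qed

section \<open>Changes of variables and product majorants for Fubini\<close>

lemma nn_integral_lborel_affine:
  fixes t :: "'a::euclidean_space"
  assumes [measurable]: "f \<in> borel_measurable borel" and c: "c \<noteq> 0"
  shows "(\<integral>\<^sup>+x. f x \<partial>lborel) = ennreal (\<bar>c\<bar> ^ DIM('a)) * (\<integral>\<^sup>+x. f (t + c *\<^sub>R x) \<partial>lborel)"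
  by (subst lborel_affine[OF c, of t]) (simp add: nn_integral_density nn_integral_distr nn_integral_cmult)

lemma nn_integral_lborel_translate:
  fixes t :: "'a::euclidean_space"
  assumes "f \<in> borel_measurable borel"
  shows "(\<integral>\<^sup>+x. f (x - t) \<partial>lborel) = (\<integral>\<^sup>+x. f x \<partial>lborel)"
    and "(\<integral>\<^sup>+x. f (t - x) \<partial>lborel) = (\<integral>\<^sup>+x. f x \<partial>lborel)"
  using nn_integral_lborel_affine[OF assms, of 1 "-t"] nn_integral_lborel_affine[OF assms, of "-1" t]
  by (simp_all add: algebra_simps)

lemma integrable_lborel_affine:
  fixes t :: "'a::euclidean_space" and f :: "'a \<Rightarrow> 'b::{banach, second_countable_topology}"
  assumes f: "integrable lborel f" and c: "c \<noteq> 0"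
  shows "integrable lborel (\<lambda>x. f (t + c *\<^sub>R x))"
    and "(\<integral>x. f x \<partial>lborel) = \<bar>c\<bar> ^ DIM('a) *\<^sub>R (\<integral>x. f (t + c *\<^sub>R x) \<partial>lborel)"
proof -
  have [measurable]: "f \<in> borel_measurable borel" using borel_measurable_integrable[OF f] by simp
  have "ennreal (\<bar>c\<bar> ^ DIM('a)) * (\<integral>\<^sup>+x. ennreal (norm (f (t + c *\<^sub>R x))) \<partial>lborel) < \<infinity>"
    using f nn_integral_lborel_affine[of "\<lambda>x. ennreal (norm (f x))" c t] c
    by (simp add: integrable_iff_bounded)
  then show 1: "integrable lborel (\<lambda>x. f (t + c *\<^sub>R x))"
    using c by (auto simp: integrable_iff_bounded ennreal_mult_less_top)
  show "(\<integral>x. f x \<partial>lborel) = \<bar>c\<bar> ^ DIM('a) *\<^sub>R (\<integral>x. f (t + c *\<^sub>R x) \<partial>lborel)"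
    using c 1 by (subst lborel_affine[OF c, of t]) (simp add: integral_density integral_distr)
qed

lemma (in pair_sigma_finite) integrable_pair_bound:
  fixes f :: "'a \<times> 'b \<Rightarrow> 'c::{banach, second_countable_topology}"
  assumes [measurable]: "f \<in> borel_measurable (M1 \<Otimes>\<^sub>M M2)"
    and a: "integrable M1 a" and b: "integrable M2 b"
    and bound: "\<And>x y. norm (f (x, y)) \<le> a x * b y"
  shows "integrable (M1 \<Otimes>\<^sub>M M2) f"
proof (rule integrableI_bounded)
  have [measurable]: "a \<in> borel_measurable M1" "b \<in> borel_measurable M2"
    using a b by auto
  have "(\<integral>\<^sup>+p. ennreal (norm (f p)) \<partial>(M1 \<Otimes>\<^sub>M M2)) \<le> (\<integral>\<^sup>+p. ennreal (norm (a (fst p))) * ennreal (norm (b (snd p))) \<partial>(M1 \<Otimes>\<^sub>M M2))"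
  proof (intro nn_integral_mono)
    fix p
    have "norm (f p) \<le> norm (a (fst p)) * norm (b (snd p))"
      using bound[of "fst p" "snd p"] by (simp add: abs_mult[symmetric])
    then show "ennreal (norm (f p)) \<le> ennreal (norm (a (fst p))) * ennreal (norm (b (snd p)))"
      by (simp add: ennreal_mult[symmetric])
  qed
  also have "\<dots> = (\<integral>\<^sup>+x. (\<integral>\<^sup>+y. ennreal (norm (a x)) * ennreal (norm (b y)) \<partial>M2) \<partial>M1)"
    by (subst M2.nn_integral_fst[symmetric]) auto
  also have "\<dots> = (\<integral>\<^sup>+x. ennreal (norm (a x)) \<partial>M1) * (\<integral>\<^sup>+y. ennreal (norm (b y)) \<partial>M2)"
    by (simp add: nn_integral_cmult nn_integral_multc)
  also have "\<dots> < \<infinity>"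
    using a b by (simp add: integrable_iff_bounded ennreal_mult_less_top)
  finally show "(\<integral>\<^sup>+p. ennreal (norm (f p)) \<partial>(M1 \<Otimes>\<^sub>M M2)) < \<infinity>" .
qed simp

section \<open>The Gamma integral and its inversion on the line Re z = 1\<close>

lemma has_bochner_integral_lborel_nonneg:
  fixes f :: "real \<Rightarrow> real"
  assumes [measurable]: "f \<in> borel_measurable borel" and "\<And>x. 0 \<le> f x" and "(f has_integral I) UNIV"
  shows "integrable lborel f" "integral\<^sup>L lborel f = I"
proof -
  have "0 \<le> I" using assms has_integral_nonneg by blast
  then have "has_bochner_integral lborel f I"
    using nn_integral_has_integral_lborel[OF assms] assms by (intro has_bochner_integral_nn_integral) auto
  then show "integrable lborel f" "integral\<^sup>L lborel f = I" by (auto simp: has_bochner_integral_iff)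
qed

lemma gamma_laplace_real:
  fixes \<alpha> a :: real
  assumes \<alpha>: "0 < \<alpha>" and a: "0 < a"
  shows "integrable lborel (\<lambda>u. max u 0 powr \<alpha> * exp (- (a * u)))"
    and "(\<integral>u. max u 0 powr \<alpha> * exp (- (a * u)) \<partial>lborel) = Gamma (\<alpha> + 1) * a powr (- (\<alpha> + 1))"
proof -
  let ?f = "\<lambda>u::real. max u 0 powr \<alpha> * exp (- u)"
  have "((\<lambda>u. if u \<in> {0..} then u powr (\<alpha> + 1 - 1) / exp u else 0) has_integral Gamma (\<alpha> + 1)) UNIV"
    using Gamma_integral_real[of "\<alpha> + 1"] \<alpha> by (subst has_integral_restrict_UNIV) auto
  also have "(\<lambda>u. if u \<in> {0..} then u powr (\<alpha> + 1 - 1) / exp u else 0) = ?f"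
    by (auto simp: fun_eq_iff max_def exp_minus field_simps)
  finally have f: "(?f has_integral Gamma (\<alpha> + 1)) UNIV" .
  have i: "integrable lborel ?f" "integral\<^sup>L lborel ?f = Gamma (\<alpha> + 1)"
    by (rule has_bochner_integral_lborel_nonneg[OF _ _ f]; simp)+
  have e: "?f (0 + a * u) = a powr \<alpha> * (max u 0 powr \<alpha> * exp (- (a * u)))" for u
  proof -
    have "max (a * u) 0 = a * max u 0" using a by (auto simp: max_def mult_le_0_iff zero_le_mult_iff)
    then show ?thesis using a by (simp add: powr_mult)
  qed
  have "integrable lborel (\<lambda>u. ?f (0 + a * u))"
    using i(1) a lborel_integrable_real_affine[of ?f a 0] by auto
  then have "integrable lborel (\<lambda>u. a powr (-\<alpha>) * (a powr \<alpha> * (max u 0 powr \<alpha> * exp (- (a * u)))))"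
    unfolding e by (rule integrable_mult_right)
  then show "integrable lborel (\<lambda>u. max u 0 powr \<alpha> * exp (- (a * u)))"
    using a by (simp add: mult.assoc[symmetric] powr_add[symmetric])
  have "Gamma (\<alpha> + 1) = \<bar>a\<bar> *\<^sub>R (\<integral>u. ?f (0 + a * u) \<partial>lborel)"
    unfolding i(2)[symmetric] using a by (subst lborel_integral_real_affine[where c = a and t = 0]) auto
  also have "\<dots> = a * a powr \<alpha> * (\<integral>u. max u 0 powr \<alpha> * exp (- (a * u)) \<partial>lborel)"
    unfolding e using a by simp
  also have "a * a powr \<alpha> = a powr (\<alpha> + 1)" using a by (simp add: powr_add)
  finally have E: "Gamma (\<alpha> + 1) = a powr (\<alpha> + 1) * (\<integral>u. max u 0 powr \<alpha> * exp (- (a * u)) \<partial>lborel)" .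
  have one: "a powr (\<alpha> + 1) * a powr (- (\<alpha> + 1)) = 1"
    using a unfolding powr_add[symmetric] by simp
  have "Gamma (\<alpha> + 1) * a powr (- (\<alpha> + 1)) = (a powr (\<alpha> + 1) * a powr (- (\<alpha> + 1))) * (\<integral>u. max u 0 powr \<alpha> * exp (- (a * u)) \<partial>lborel)"
    unfolding E by (simp only: mult_ac)
  then show "(\<integral>u. max u 0 powr \<alpha> * exp (- (a * u)) \<partial>lborel) = Gamma (\<alpha> + 1) * a powr (- (\<alpha> + 1))"
    unfolding one by simp
qed

lemma gamma_laplace:
  fixes \<alpha> :: real and w :: complex
  assumes \<alpha>: "0 < \<alpha>" and w: "0 < Re w"
  shows "(\<integral>u. of_real (max u 0 powr \<alpha>) * exp (- (w * of_real u)) \<partial>lborel) = Gamma (of_real (\<alpha> + 1)) * w powr (- of_real (\<alpha> + 1))"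
    (is "?F w = ?G w")
proof -
  \<comment> \<open>The absolute value makes the exponent nonnegative, as the holomorphy lemma
    requires. It changes nothing, because the weight vanishes for u < 0.\<close>
  let ?H = "\<lambda>w. (\<integral>u. of_real (max u 0 powr \<alpha>) * exp (- (w * of_real \<bar>u\<bar>)) \<partial>lborel)"
  have e: "of_real (max u 0 powr \<alpha>) * exp (- (w * of_real \<bar>u\<bar>)) = of_real (max u 0 powr \<alpha>) * exp (- (w * of_real u))" for u and w :: complex
    using \<alpha> by (cases "u \<le> 0") (auto simp: max_def)
  have e': "max u 0 powr \<alpha> * exp (- (w * \<bar>u\<bar>)) = max u 0 powr \<alpha> * exp (- (w * u))" for u and w :: real
    using \<alpha> by (cases "u \<le> 0") (auto simp: max_def)
  have "?H w = ?G w"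
  proof (rule holomorphic_eq_on_half_plane[where F = ?H and G = ?G])
    show "?H holomorphic_on {w. 0 < Re w}"
    proof (rule holomorphic_laplace_integral)
      show "integrable lborel (\<lambda>t. exp (- (a * \<bar>t\<bar>)) * norm (complex_of_real (max t 0 powr \<alpha>)))" if "0 < a" for a
        using gamma_laplace_real(1)[OF \<alpha> that] by (subst mult.commute) (simp add: e')
    qed auto
    show "?G holomorphic_on {w. 0 < Re w}"
      by (intro holomorphic_intros) (auto simp: complex_nonpos_Reals_iff)
    show "?H (of_real a) = ?G (of_real a)" if a: "0 < a" for a
    proof -
      have "?H (of_real a) = (\<integral>u. complex_of_real (max u 0 powr \<alpha> * exp (- (a * u))) \<partial>lborel)"
        unfolding e by (simp add: exp_of_real[symmetric])
      also have "\<dots> = of_real (Gamma (\<alpha> + 1) * a powr (- (\<alpha> + 1)))"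
        unfolding integral_complex_of_real gamma_laplace_real(2)[OF \<alpha> a] ..
      also have "\<dots> = ?G (of_real a)"
        using a by (simp add: Gamma_complex_of_real powr_of_real[symmetric] flip: of_real_add of_real_minus)
      finally show ?thesis .
    qed
  qed (use w in auto)
  then show ?thesis unfolding e by simp
qed

lemma integrable_norm_vertical_line_powr:
  assumes "1 < \<beta>"
  shows "integrable lborel (\<lambda>t. norm (Complex 1 t) powr (- \<beta>))"
proof -
  let ?g = "\<lambda>x::real. if x \<in> {1..} then x powr (- \<beta>) else 0"
  have "(?g has_integral - (1 powr (- \<beta> + 1)) / (- \<beta> + 1)) UNIV"
    using has_integral_powr_to_inf[of "- \<beta>" 1] assms by (subst has_integral_restrict_UNIV) auto
  then have g: "integrable lborel ?g"
    by (intro has_bochner_integral_lborel_nonneg(1)) auto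
  have g': "integrable lborel (\<lambda>x. ?g (0 + (- 1) * x))"
    using g by (subst lborel_integrable_real_affine_iff) auto
  have h: "integrable lborel (indicator {-1..1} :: real \<Rightarrow> real)" by simp
  show ?thesis
  proof (rule Bochner_Integration.integrable_bound[OF Bochner_Integration.integrable_add[OF Bochner_Integration.integrable_add[OF g g'] h]])
    show "(\<lambda>t. norm (Complex 1 t) powr (- \<beta>)) \<in> borel_measurable lborel"
      by (simp add: cmod_def)
    show "AE t in lborel. norm (norm (Complex 1 t) powr (- \<beta>)) \<le> norm (?g t + ?g (0 + (- 1) * t) + indicator {-1..1} t)"
    proof (rule AE_I2)
      fix t :: real
      have n: "norm (Complex 1 t) \<ge> \<bar>t\<bar>" "norm (Complex 1 t) \<ge> 1"
        using abs_Im_le_cmod[of "Complex 1 t"] abs_Re_le_cmod[of "Complex 1 t"] by auto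
      have 1: "norm (Complex 1 t) powr (- \<beta>) \<le> 1"
        using powr_mono2'[of "-\<beta>" 1 "norm (Complex 1 t)"] n assms by simp
      have 2: "norm (Complex 1 t) powr (- \<beta>) \<le> \<bar>t\<bar> powr (- \<beta>)" if "t \<noteq> 0"
        using powr_mono2'[of "-\<beta>" "\<bar>t\<bar>" "norm (Complex 1 t)"] n assms that by simp
      consider "t \<ge> 1" | "t \<le> -1" | "-1 < t" "t < 1" by linarith
      then show "norm (norm (Complex 1 t) powr (- \<beta>)) \<le> norm (?g t + ?g (0 + (- 1) * t) + indicator {-1..1} t)"
        by cases (use 1 2 in \<open>auto simp: indicator_def\<close>)
    qed
  qed
qed

text \<open>Gaussian summation. The factor exp (- \<epsilon> t^2) makes Fubini legitimate and turns
  the double integral into an average of \<open>G\<close> against a Gaussian of width sqrt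
  \<epsilon> about \<open>r\<close>; this tends to 2 pi \<open>G r\<close> since \<open>G\<close> is
  bounded and continuous. On the other side integrability of \<open>H\<close> lets the factor be
  removed.\<close>

lemma fourier_inversion_real:
  fixes G H :: "real \<Rightarrow> complex"
  assumes G: "integrable lborel G" and cont: "\<And>x. isCont G x" and bd: "\<And>x. norm (G x) \<le> B"
    and H: "\<And>t. H t = (\<integral>u. G u * exp (- (\<i> * of_real (t * u))) \<partial>lborel)" and intH: "integrable lborel H"
  shows "(\<integral>t. H t * exp (\<i> * of_real (t * r)) \<partial>lborel) = 2 * pi * G r"
proof (rule LIMSEQ_unique)
  have [measurable]: "G \<in> borel_measurable borel" "H \<in> borel_measurable borel"
    using G intH by auto
  define \<epsilon> where "\<epsilon> k = 1 / real (Suc k)" for k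
  have \<epsilon>: "\<epsilon> k > 0" for k by (simp add: \<epsilon>_def)
  have \<epsilon>0: "\<epsilon> \<longlonglongrightarrow> 0" unfolding \<epsilon>_def by (rule lim_1_over_n[THEN LIMSEQ_Suc])
  define A where "A k = (\<integral>t. H t * exp (\<i> * of_real (t * r)) * exp (- (\<epsilon> k * t\<^sup>2)) \<partial>lborel)" for k
  show "A \<longlonglongrightarrow> (\<integral>t. H t * exp (\<i> * of_real (t * r)) \<partial>lborel)"
    unfolding A_def
  proof (rule integral_dominated_convergence)
    show "integrable lborel (\<lambda>t. norm (H t))" using intH by simp
    show "AE t in lborel. (\<lambda>k. H t * exp (\<i> * of_real (t * r)) * exp (- (\<epsilon> k * t\<^sup>2))) \<longlonglongrightarrow> H t * exp (\<i> * of_real (t * r))"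
    proof (rule AE_I2)
      fix t
      have "(\<lambda>k. H t * exp (\<i> * of_real (t * r)) * exp (- (\<epsilon> k * t\<^sup>2))) \<longlonglongrightarrow> H t * exp (\<i> * of_real (t * r)) * exp (- (0 * t\<^sup>2))"
        by (intro tendsto_intros \<epsilon>0)
      then show "(\<lambda>k. H t * exp (\<i> * of_real (t * r)) * exp (- (\<epsilon> k * t\<^sup>2))) \<longlonglongrightarrow> H t * exp (\<i> * of_real (t * r))" by simp
    qed
    show "AE t in lborel. norm (H t * exp (\<i> * of_real (t * r)) * exp (- (\<epsilon> k * t\<^sup>2))) \<le> norm (H t)" for k
      using \<epsilon>[of k] by (auto simp: norm_mult norm_exp_eq_Re intro!: AE_I2 mult_left_le)
  qed (auto)
  have A: "A k = 2 * sqrt pi * (\<integral>s. G (r + 2 * sqrt (\<epsilon> k) * s) * complex_of_real (exp (- (s\<^sup>2))) \<partial>lborel)" for k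
  proof -
    define e where "e = \<epsilon> k"
    have e: "e > 0" using \<epsilon> by (simp add: e_def)
    have sq: "(r - (r + 2 * sqrt e * s))\<^sup>2 / (4 * e) = s\<^sup>2" for s :: real
      using e by (simp add: power_mult_distrib)
    have "A k = (\<integral>t. (\<integral>u. G u * exp (- (\<i> * of_real (t * u))) * (exp (\<i> * of_real (t * r)) * exp (- (e * t\<^sup>2))) \<partial>lborel) \<partial>lborel)"
      by (simp only: A_def H e_def integral_mult_left_zero[symmetric] mult.assoc)
    also have "\<dots> = (\<integral>u. (\<integral>t. G u * exp (- (\<i> * of_real (t * u))) * (exp (\<i> * of_real (t * r)) * exp (- (e * t\<^sup>2))) \<partial>lborel) \<partial>lborel)"
    proof (rule lborel_pair.Fubini_integral)
      show "integrable (lborel \<Otimes>\<^sub>M lborel) (\<lambda>(u, t). G u * exp (- (\<i> * of_real (t * u))) * (exp (\<i> * of_real (t * r)) * exp (- (e * t\<^sup>2))))"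
      proof (rule lborel_pair.integrable_pair_bound[where a = "\<lambda>u. norm (G u)" and b = "\<lambda>t. exp (- (e * t\<^sup>2))"])
        show "integrable lborel (\<lambda>t. exp (- (e * t\<^sup>2)))" by (rule gaussian_fourier_1d_real(1)[OF e])
      qed (use G in \<open>auto simp: norm_mult norm_exp_eq_Re\<close>)
    qed
    also have "\<dots> = (\<integral>u. G u * (sqrt (pi / e) * exp (- ((r - u)\<^sup>2 / (4 * e)))) \<partial>lborel)"
    proof (rule Bochner_Integration.integral_cong[OF refl])
      fix u
      define x where "x = (r - u) / (2 * pi)"
      have "exp (- (\<i> * of_real (t * u))) * (exp (\<i> * of_real (t * r)) * exp (- (e * t\<^sup>2)))
        = exp (2 * pi * \<i> * (x * t)) * exp (- (of_real e * of_real (t\<^sup>2)))" for t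
      proof -
        have "2 * pi * \<i> * (x * t) = \<i> * of_real (t * r) - \<i> * of_real (t * u)"
          by (simp add: x_def algebra_simps diff_divide_distrib)
        then show ?thesis
          by (simp only:) (simp add: exp_diff exp_minus exp_of_real[symmetric] field_simps)
      qed
      then have "(\<integral>t. G u * exp (- (\<i> * of_real (t * u))) * (exp (\<i> * of_real (t * r)) * exp (- (e * t\<^sup>2))) \<partial>lborel)
         = G u * (\<integral>t. exp (2 * pi * \<i> * (x * t)) * exp (- (of_real e * of_real (t\<^sup>2))) \<partial>lborel)"
        by (simp add: mult.assoc)
      also have "\<dots> = G u * (csqrt (of_real pi / of_real e) * exp (- (of_real pi ^ 2 * of_real x ^ 2 / of_real e)))"
        by (subst gaussian_fourier_1d_real(2)[OF e]) simp
      also have "csqrt (of_real pi / of_real e) = sqrt (pi / e)"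
        using e by (simp add: csqrt_of_real_nonneg flip: of_real_divide)
      also have "- (complex_of_real pi ^ 2 * of_real x ^ 2 / of_real e) = of_real (- ((r - u)\<^sup>2 / (4 * e)))"
        by (simp add: x_def power_divide power_mult_distrib)
      finally show "(\<integral>t. G u * exp (- (\<i> * of_real (t * u))) * (exp (\<i> * of_real (t * r)) * exp (- (e * t\<^sup>2))) \<partial>lborel)
         = G u * (sqrt (pi / e) * exp (- ((r - u)\<^sup>2 / (4 * e))))"
        by (simp only: exp_of_real of_real_mult)
    qed
    also have "\<dots> = (2 * sqrt e) *\<^sub>R (\<integral>s. G (r + 2 * sqrt e * s) * (sqrt (pi / e) * exp (- ((r - (r + 2 * sqrt e * s))\<^sup>2 / (4 * e)))) \<partial>lborel)"
      using e by (subst lborel_integral_real_affine[where c = "2 * sqrt e" and t = r]) auto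
    also have "(\<lambda>s. G (r + 2 * sqrt e * s) * (sqrt (pi / e) * exp (- ((r - (r + 2 * sqrt e * s))\<^sup>2 / (4 * e)))))
        = (\<lambda>s. sqrt (pi / e) * (G (r + 2 * sqrt e * s) * complex_of_real (exp (- (s\<^sup>2)))))"
      by (rule ext) (simp only: sq, simp add: mult_ac exp_of_real[symmetric])
    also have "(2 * sqrt e) *\<^sub>R (\<integral>s. sqrt (pi / e) * (G (r + 2 * sqrt e * s) * complex_of_real (exp (- (s\<^sup>2)))) \<partial>lborel)
       = 2 * (sqrt e * sqrt (pi / e)) * (\<integral>s. G (r + 2 * sqrt e * s) * complex_of_real (exp (- (s\<^sup>2))) \<partial>lborel)"
      by (simp add: scaleR_conv_of_real)
    also have "sqrt e * sqrt (pi / e) = sqrt pi" using e by (simp add: real_sqrt_divide)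
    finally show ?thesis by (simp add: e_def)
  qed
  have "complex_of_real (integral\<^sup>L lborel (\<lambda>s::real. exp (- (s\<^sup>2)))) = (\<integral>t. exp (2 * pi * \<i> * (0 * t)) * exp (- (of_real 1 * of_real (t\<^sup>2))) \<partial>lborel)"
    by (simp add: integral_complex_of_real[symmetric] exp_of_real[symmetric] del: integral_complex_of_real)
  also have "\<dots> = complex_of_real (sqrt pi)"
    using gaussian_fourier_1d_real(2)[of 1 0] by (simp add: csqrt_of_real_nonneg)
  finally have g1: "integral\<^sup>L lborel (\<lambda>s::real. exp (- (s\<^sup>2))) = sqrt pi"
    by (simp only: of_real_eq_iff)
  have g0: "integrable lborel (\<lambda>s::real. exp (- (s\<^sup>2)))"
    using gaussian_fourier_1d_real(1)[of 1] by simp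
  have "(\<lambda>k. (\<integral>s. G (r + 2 * sqrt (\<epsilon> k) * s) * complex_of_real (exp (- (s\<^sup>2))) \<partial>lborel)) \<longlonglongrightarrow> (\<integral>s. G r * complex_of_real (exp (- (s\<^sup>2))) \<partial>lborel)"
  proof (rule integral_dominated_convergence)
    show "integrable lborel (\<lambda>s. B * exp (- (s\<^sup>2)))" using g0 by (intro integrable_mult_right) auto
    show "AE s in lborel. (\<lambda>k. G (r + 2 * sqrt (\<epsilon> k) * s) * complex_of_real (exp (- (s\<^sup>2)))) \<longlonglongrightarrow> G r * complex_of_real (exp (- (s\<^sup>2)))"
    proof (rule AE_I2, intro tendsto_intros isCont_tendsto_compose[OF cont])
      fix s
      have "(\<lambda>k. r + 2 * sqrt (\<epsilon> k) * s) \<longlonglongrightarrow> r + 2 * sqrt 0 * s"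
        by (intro tendsto_intros \<epsilon>0)
      then show "(\<lambda>k. r + 2 * sqrt (\<epsilon> k) * s) \<longlonglongrightarrow> r" by simp
    qed
    show "AE s in lborel. norm (G (r + 2 * sqrt (\<epsilon> k) * s) * complex_of_real (exp (- (s\<^sup>2)))) \<le> B * exp (- (s\<^sup>2))" for k
      using bd by (auto simp: norm_mult intro!: AE_I2 mult_right_mono)
  qed auto
  then have "A \<longlonglongrightarrow> 2 * sqrt pi * (\<integral>s. G r * complex_of_real (exp (- (s\<^sup>2))) \<partial>lborel)"
    unfolding A by (intro tendsto_intros)
  also have "2 * sqrt pi * (\<integral>s. G r * complex_of_real (exp (- (s\<^sup>2))) \<partial>lborel) = 2 * (complex_of_real (sqrt pi) * of_real (sqrt pi)) * G r"
    by (simp add: g1)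
  also have "complex_of_real (sqrt pi) * of_real (sqrt pi) = of_real pi"
    by (simp flip: of_real_mult)
  finally show "A \<longlonglongrightarrow> 2 * pi * G r" by simp
qed

lemma Re_pos_line [simp]: "Re (Complex 1 t) = 1" "Complex 1 t \<noteq> 0"
  by (auto simp: complex_eq_iff)

lemma borel_measurable_Complex_1 [measurable]: "(\<lambda>t. Complex 1 t) \<in> borel_measurable borel"
  unfolding Complex_eq by measurable

lemma borel_measurable_Complex_1_powr [measurable]: "(\<lambda>t. Complex 1 t powr w) \<in> borel_measurable borel"
proof (intro borel_measurable_continuous_onI continuous_at_imp_continuous_on ballI)
  have "isCont (\<lambda>t. exp (w * Ln (Complex 1 t))) t" for t
  proof (intro continuous_intros isCont_Ln')
    show "isCont (Complex 1) t"
      unfolding Complex_eq by (intro continuous_intros)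
  qed (auto simp: complex_nonpos_Reals_iff)
  then show "isCont (\<lambda>t. Complex 1 t powr w) t" for t
    by (simp add: powr_def)
qed

text \<open>For r < 0 the integral is 0, so the restriction to the unit ball in the operator comes
  out of the formula by itself. The condition \<alpha> > 0 gives absolute convergence on the line
  and continuity at r = 0.\<close>

lemma laplace_inversion_powr:
  fixes \<alpha> r :: real
  assumes \<alpha>: "0 < \<alpha>"
  shows "(\<integral>t. exp (Complex 1 t * of_real r) * Complex 1 t powr (- of_real (\<alpha> + 1)) \<partial>lborel)
           = of_real (2 * pi / Gamma (\<alpha> + 1) * max r 0 powr \<alpha>)"
proof -
  \<comment> \<open>The factor exp (- u) turns the Laplace transform on Re z = 1 into the Fourier
    transform \<open>H\<close> of an integrable function.\<close>
  define G where "G u = complex_of_real (max u 0 powr \<alpha> * exp (- u))" for u :: real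
  define H where "H t = complex_of_real (Gamma (\<alpha> + 1)) * Complex 1 t powr (- of_real (\<alpha> + 1))" for t
  have "Gamma (\<alpha> + 1) > 0" by (rule Gamma_real_pos) (use \<alpha> in simp)
  then have \<Gamma>: "Gamma (\<alpha> + 1) \<noteq> 0" by (rule less_imp_neq[symmetric])
  have intG: "integrable lborel G"
    using gamma_laplace_real(1)[of \<alpha> 1] \<alpha> unfolding G_def by (intro integrable_of_real) simp
  have "(\<integral>t. H t * exp (\<i> * of_real (t * r)) \<partial>lborel) = 2 * pi * G r"
  proof (rule fourier_inversion_real[OF intG, where B = "\<alpha> powr \<alpha>"])
    show "isCont G x" for x
      unfolding G_def using \<alpha> by (intro continuous_intros) auto
    show "H t = (\<integral>u. G u * exp (- (\<i> * of_real (t * u))) \<partial>lborel)" for t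
    proof -
      have "G u * exp (- (\<i> * of_real (t * u))) = of_real (max u 0 powr \<alpha>) * exp (- (Complex 1 t * of_real u))" for u
        unfolding G_def of_real_mult[of "_ powr _"] exp_of_real[symmetric] mult.assoc exp_add[symmetric]
        by (simp add: Complex_eq algebra_simps)
      then show ?thesis
        using gamma_laplace[OF \<alpha>, of "Complex 1 t"] by (simp add: H_def flip: Gamma_complex_of_real)
    qed
    show "integrable lborel H"
      unfolding H_def
    proof (intro integrable_mult_right, rule Bochner_Integration.integrable_bound)
      show "integrable lborel (\<lambda>t. norm (Complex 1 t) powr (- (\<alpha> + 1)))"
        using integrable_norm_vertical_line_powr[of "\<alpha> + 1"] \<alpha> by simp
    qed (auto simp: norm_powr_real_powr')
    show "norm (G x) \<le> \<alpha> powr \<alpha>" for x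
    proof (cases "x > 0")
      case True
      have "x / \<alpha> \<le> exp (x / \<alpha>)" using exp_ge_add_one_self[of "x / \<alpha>"] by linarith
      then have "x \<le> \<alpha> * exp (x / \<alpha>)" using \<alpha> by (simp add: field_simps)
      then have "x powr \<alpha> \<le> (\<alpha> * exp (x / \<alpha>)) powr \<alpha>" using True \<alpha> by (intro powr_mono2) auto
      also have "\<dots> = \<alpha> powr \<alpha> * exp x" using \<alpha> by (simp add: powr_mult exp_powr_real)
      finally have "x powr \<alpha> * exp (- x) \<le> \<alpha> powr \<alpha>" by (simp add: exp_minus field_simps)
      then show ?thesis using True by (simp add: G_def max_def norm_mult)
    qed (use \<alpha> in \<open>simp add: G_def max_def\<close>)
  qed
  moreover have "exp (Complex 1 t * of_real r) * Complex 1 t powr (- of_real (\<alpha> + 1)) = exp r / Gamma (\<alpha> + 1) * (H t * exp (\<i> * of_real (t * r)))" for t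
    using \<Gamma> by (simp add: H_def Complex_eq ring_distribs exp_add exp_of_real mult_ac)
  ultimately show ?thesis
    by (simp add: G_def exp_minus)
qed

section \<open>Oscillatory integrals on the vertical line\<close>

text \<open>Integrate by parts with the antiderivative exp (\<i> \<phi>) / (\<i> \<phi>'). Because
  \<phi>'' has a sign, the remaining integral of \<phi>'' / \<phi>'^2 telescopes to a difference of
  values of 1 / \<phi>'. Two boundary terms and two such values give the 4.\<close>

lemma van_der_Corput_first:
  fixes \<phi> \<phi>' \<phi>'' :: "real \<Rightarrow> real"
  assumes ab: "a \<le> b" and \<mu>: "0 < \<mu>"
    and d1: "\<And>t. t \<in> {a..b} \<Longrightarrow> (\<phi> has_real_derivative \<phi>' t) (at t)"
    and d2: "\<And>t. t \<in> {a..b} \<Longrightarrow> (\<phi>' has_real_derivative \<phi>'' t) (at t)"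
    and pos: "\<And>t. t \<in> {a..b} \<Longrightarrow> 0 \<le> \<phi>'' t"
    and big: "\<And>t. t \<in> {a..b} \<Longrightarrow> \<mu> \<le> \<bar>\<phi>' t\<bar>"
  shows "norm (integral {a..b} (\<lambda>t. exp (\<i> * of_real (\<phi> t)))) \<le> 4 / \<mu>"
proof -
  define F where "F t = exp (\<i> * of_real (\<phi> t)) / (\<i> * of_real (\<phi>' t))" for t
  define e where "e t = exp (\<i> * complex_of_real (\<phi> t))" for t
  define g where "g t = e t * of_real (\<phi>'' t / (\<phi>' t)\<^sup>2)" for t
  have nz: "\<phi>' t \<noteq> 0" if "t \<in> {a..b}" for t using big[OF that] \<mu> by auto
  have cont: "continuous_on {a..b} \<phi>"
    by (rule DERIV_continuous_on[OF has_field_derivative_at_within[OF d1]])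
  have eint: "e integrable_on {a..b}"
    unfolding e_def by (intro integrable_continuous_interval continuous_intros cont)
  have F: "((\<lambda>t. e t + \<i> * g t) has_integral (F b - F a)) {a..b}"
  proof (rule fundamental_theorem_of_calculus[OF ab])
    fix t assume t: "t \<in> {a..b}"
    have 1: "((\<lambda>t. complex_of_real (\<phi> t)) has_vector_derivative of_real (\<phi>' t)) (at t within {a..b})"
      "((\<lambda>t. complex_of_real (\<phi>' t)) has_vector_derivative of_real (\<phi>'' t)) (at t within {a..b})"
      using d1[OF t] d2[OF t] 
      by (auto intro!: has_vector_derivative_of_real simp: has_real_derivative_iff_has_vector_derivative intro: has_vector_derivative_at_within)
    have "((\<lambda>w. exp (\<i> * w)) has_field_derivative \<i> * e t) (at (complex_of_real (\<phi> t)) within X)" for X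
      unfolding e_def by (auto intro!: derivative_eq_intros)
    from field_vector_diff_chain_within[OF 1(1) this]
    have 2: "(e has_vector_derivative (of_real (\<phi>' t) * (\<i> * e t))) (at t within {a..b})"
      by (simp add: o_def e_def[abs_def])
    have "((\<lambda>w. 1 / (\<i> * w)) has_field_derivative (\<i> / of_real ((\<phi>' t)\<^sup>2))) (at (complex_of_real (\<phi>' t)) within X)" for X
      using nz[OF t] by (auto intro!: derivative_eq_intros simp: field_simps power2_eq_square)
    from field_vector_diff_chain_within[OF 1(2) this]
    have 3: "((\<lambda>t. 1 / (\<i> * complex_of_real (\<phi>' t))) has_vector_derivative (of_real (\<phi>'' t) * (\<i> / of_real ((\<phi>' t)\<^sup>2)))) (at t within {a..b})"
      by (simp add: o_def)
    have "((\<lambda>t. e t * (1 / (\<i> * complex_of_real (\<phi>' t)))) has_vector_derivative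
       (e t * (of_real (\<phi>'' t) * (\<i> / of_real ((\<phi>' t)\<^sup>2))) + (of_real (\<phi>' t) * (\<i> * e t)) * (1 / (\<i> * complex_of_real (\<phi>' t))))) (at t within {a..b})"
      by (rule has_vector_derivative_mult[OF 2 3])
    moreover have "e t * (of_real (\<phi>'' t) * (\<i> / of_real ((\<phi>' t)\<^sup>2))) + (of_real (\<phi>' t) * (\<i> * e t)) * (1 / (\<i> * complex_of_real (\<phi>' t))) = e t + \<i> * g t"
      using nz[OF t] by (simp add: g_def)
    moreover have "(\<lambda>t. e t * (1 / (\<i> * complex_of_real (\<phi>' t)))) = F"
      by (auto simp: F_def e_def fun_eq_iff)
    ultimately show "(F has_vector_derivative e t + \<i> * g t) (at t within {a..b})" by simp
  qed
  have q: "((\<lambda>t. \<phi>'' t / (\<phi>' t)\<^sup>2) has_integral (- (1 / \<phi>' b) - (- (1 / \<phi>' a)))) {a..b}"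
  proof (rule fundamental_theorem_of_calculus[OF ab])
    fix t assume t: "t \<in> {a..b}"
    have "((\<lambda>t. - (1 / \<phi>' t)) has_real_derivative \<phi>'' t / (\<phi>' t)\<^sup>2) (at t)"
      using d2[OF t] nz[OF t] by (auto intro!: derivative_eq_intros simp: power2_eq_square)
    then show "((\<lambda>t. - (1 / \<phi>' t)) has_vector_derivative \<phi>'' t / (\<phi>' t)\<^sup>2) (at t within {a..b})"
      by (simp add: has_real_derivative_iff_has_vector_derivative has_vector_derivative_at_within)
  qed
  have gint: "(\<lambda>t. \<i> * g t) integrable_on {a..b}"
    using integrable_diff[OF has_integral_integrable[OF F] eint] by simp
  have "integral {a..b} e = (F b - F a) - integral {a..b} (\<lambda>t. \<i> * g t)"
    using integral_unique[OF F] Henstock_Kurzweil_Integration.integral_add[OF eint gint] by (simp add: eq_diff_eq)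
  then have "norm (integral {a..b} e) \<le> norm (F b) + norm (F a) + norm (integral {a..b} (\<lambda>t. \<i> * g t))"
    using norm_triangle_ineq4[of "F b - F a" "integral {a..b} (\<lambda>t. \<i> * g t)"] norm_triangle_ineq4[of "F b" "F a"] by simp
  moreover have "norm (integral {a..b} (\<lambda>t. \<i> * g t)) \<le> integral {a..b} (\<lambda>t. \<phi>'' t / (\<phi>' t)\<^sup>2)"
    using gint has_integral_integrable[OF q] pos
    by (intro integral_norm_bound_integral) (auto simp: g_def e_def norm_mult norm_divide norm_power)
  moreover have "integral {a..b} (\<lambda>t. \<phi>'' t / (\<phi>' t)\<^sup>2) = - (1 / \<phi>' b) + 1 / \<phi>' a"
    using integral_unique[OF q] by simp
  moreover have inv: "\<bar>1 / \<phi>' t\<bar> \<le> 1 / \<mu>" if "t \<in> {a..b}" for t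
    using big[OF that] \<mu> by (simp add: field_simps) 
  moreover have "norm (F a) = \<bar>1 / \<phi>' a\<bar>" "norm (F b) = \<bar>1 / \<phi>' b\<bar>"
    by (simp_all add: F_def norm_divide norm_mult)
  moreover have "\<bar>1 / \<phi>' a\<bar> \<le> 1 / \<mu>" "\<bar>1 / \<phi>' b\<bar> \<le> 1 / \<mu>" using inv ab by auto
  ultimately have "norm (integral {a..b} e) \<le> 1 / \<mu> + 1 / \<mu> + (1 / \<mu> + 1 / \<mu>)" by linarith
  then show ?thesis by (simp add: e_def[abs_def])
qed

text \<open>Around the point where \<phi>' is smallest in modulus remove an interval of half-length
  \<delta>, estimated by its length; outside it the first-derivative test applies with \<mu> =
  \<kappa> \<delta>. The constant is 4 + 2 + 4.\<close>

lemma van_der_Corput_second: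
  fixes \<phi> \<phi>' \<phi>'' :: "real \<Rightarrow> real"
  assumes ab: "a \<le> b" and \<kappa>: "0 < \<kappa>"
    and d1: "\<And>t. t \<in> {a..b} \<Longrightarrow> (\<phi> has_real_derivative \<phi>' t) (at t)"
    and d2: "\<And>t. t \<in> {a..b} \<Longrightarrow> (\<phi>' has_real_derivative \<phi>'' t) (at t)"
    and big: "\<And>t. t \<in> {a..b} \<Longrightarrow> \<kappa> \<le> \<phi>'' t"
  shows "norm (integral {a..b} (\<lambda>t. exp (\<i> * of_real (\<phi> t)))) \<le> 10 / sqrt \<kappa>"
proof -
  have incr: "\<kappa> * (t - s) \<le> \<phi>' t - \<phi>' s" if "s \<in> {a..b}" "t \<in> {a..b}" "s \<le> t" for s t
  proof -
    have "\<phi>' s - \<kappa> * s \<le> \<phi>' t - \<kappa> * t"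
    proof (rule DERIV_nonneg_imp_nondecreasing[OF that(3)])
      fix x assume "s \<le> x" "x \<le> t"
      then have x: "x \<in> {a..b}" using that by auto
      have "((\<lambda>x. \<phi>' x - \<kappa> * x) has_real_derivative \<phi>'' x - \<kappa>) (at x)"
        using d2[OF x] by (auto intro!: derivative_eq_intros)
      then show "\<exists>y. ((\<lambda>x. \<phi>' x - \<kappa> * x) has_real_derivative y) (at x) \<and> 0 \<le> y"
        using big[OF x] by (intro exI[of _ "\<phi>'' x - \<kappa>"]) auto
    qed
    then show ?thesis by (simp add: algebra_simps)
  qed
  have cont': "continuous_on {a..b} \<phi>'"
    by (rule DERIV_continuous_on[OF has_field_derivative_at_within[OF d2]])
  have cont: "continuous_on {a..b} \<phi>"
    by (rule DERIV_continuous_on[OF has_field_derivative_at_within[OF d1]])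
  \<comment> \<open>\<open>c\<close> is a zero of \<phi>', or the endpoint nearest to one when
    \<phi>' keeps its sign; in each case |\<phi>'| grows at least like \<kappa> |t - c|.\<close>
  obtain c where c: "c \<in> {a..b}" "\<And>t. t \<in> {a..b} \<Longrightarrow> c < t \<Longrightarrow> \<kappa> * (t - c) \<le> \<phi>' t"
    "\<And>t. t \<in> {a..b} \<Longrightarrow> t < c \<Longrightarrow> \<phi>' t \<le> - (\<kappa> * (c - t))"
  proof -
    consider "0 \<le> \<phi>' a" | "\<phi>' b \<le> 0" | "\<phi>' a \<le> 0" "0 \<le> \<phi>' b" by linarith
    then show ?thesis
    proof cases
      case 1
      have "\<kappa> * (t - a) \<le> \<phi>' t" if "t \<in> {a..b}" for t using incr[of a t] that 1 by auto
      then show ?thesis using ab by (intro that[of a]) auto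
    next
      case 2
      have "\<phi>' t \<le> - (\<kappa> * (b - t))" if "t \<in> {a..b}" for t using incr[of t b] that 2 by auto
      then show ?thesis using ab by (intro that[of b]) auto
    next
      case 3
      then obtain c where c: "a \<le> c" "c \<le> b" "\<phi>' c = 0"
        using IVT'[of \<phi>' a 0 b] ab cont' by auto
      show ?thesis
        using incr[of c] incr[of _ c] c by (intro that[of c]) fastforce+
    qed
  qed
  \<comment> \<open>This choice balances the length 2 \<delta> against the bound 4 / (\<kappa>
    \<delta>).\<close>
  define \<delta> where "\<delta> = 1 / sqrt \<kappa>"
  have \<delta>: "\<delta> > 0" "\<kappa> * \<delta> = sqrt \<kappa>" using \<kappa> by (auto simp: \<delta>_def real_div_sqrt)
  define l r where "l = max a (c - \<delta>)" and "r = min b (c + \<delta>)"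
  have lr: "a \<le> l" "l \<le> r" "r \<le> b" "r - l \<le> 2 * \<delta>" using c(1) \<delta> by (auto simp: l_def r_def)
  define e where "e t = exp (\<i> * complex_of_real (\<phi> t))" for t
  have eint: "e integrable_on {u..v}" if "a \<le> u" "v \<le> b" for u v
    unfolding e_def
    by (intro integrable_continuous_interval continuous_intros continuous_on_subset[OF cont]) (use that in auto)
  have 1: "norm (integral {a..l} e) \<le> 4 / sqrt \<kappa>"
  proof (cases "a < l")
    case True
    then have l: "l = c - \<delta>" by (auto simp: l_def)
    show ?thesis
      unfolding e_def
    proof (rule van_der_Corput_first[where \<phi>' = \<phi>' and \<phi>'' = \<phi>''])
      fix t assume t: "t \<in> {a..l}"
      then have t': "t \<in> {a..b}" "\<delta> \<le> c - t" "t < c" using lr l \<delta> by auto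
      show "(\<phi> has_real_derivative \<phi>' t) (at t)" "(\<phi>' has_real_derivative \<phi>'' t) (at t)" "0 \<le> \<phi>'' t"
        using d1 d2 big[OF t'(1)] \<kappa> t' by auto
      have "\<kappa> * \<delta> \<le> \<kappa> * (c - t)" using t' \<kappa> by (intro mult_left_mono) auto
      then show "sqrt \<kappa> \<le> \<bar>\<phi>' t\<bar>" using c(3)[OF t'(1) t'(3)] \<delta> by linarith
    qed (use lr \<kappa> in auto)
  next
    case False
    then have "l = a" using lr by auto
    then show ?thesis using \<kappa> by simp
  qed
  have 2: "norm (integral {r..b} e) \<le> 4 / sqrt \<kappa>"
  proof (cases "r < b")
    case True
    then have r: "r = c + \<delta>" by (auto simp: r_def)
    show ?thesis
      unfolding e_def
    proof (rule van_der_Corput_first[where \<phi>' = \<phi>' and \<phi>'' = \<phi>''])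
      fix t assume t: "t \<in> {r..b}"
      then have t': "t \<in> {a..b}" "\<delta> \<le> t - c" "c < t" using lr r \<delta> by auto
      show "(\<phi> has_real_derivative \<phi>' t) (at t)" "(\<phi>' has_real_derivative \<phi>'' t) (at t)" "0 \<le> \<phi>'' t"
        using d1 d2 big[OF t'(1)] \<kappa> t' by auto
      have "\<kappa> * \<delta> \<le> \<kappa> * (t - c)" using t' \<kappa> by (intro mult_left_mono) auto
      then show "sqrt \<kappa> \<le> \<bar>\<phi>' t\<bar>" using c(2)[OF t'(1) t'(3)] \<delta> by linarith
    qed (use lr \<kappa> in auto)
  next
    case False
    then have "r = b" using lr by auto
    then show ?thesis using \<kappa> by simp
  qed
  have 3: "norm (integral {l..r} e) \<le> 2 / sqrt \<kappa>"
  proof -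
    have "norm (integral {l..r} e) \<le> integral {l..r} (\<lambda>_. 1::real)"
      using lr eint by (intro integral_norm_bound_integral) (auto simp: e_def)
    also have "\<dots> = r - l" using lr by simp
    also have "\<dots> \<le> 2 / sqrt \<kappa>" using lr by (simp add: \<delta>_def)
    finally show ?thesis .
  qed
  have "integral {a..b} e = integral {a..l} e + (integral {l..r} e + integral {r..b} e)"
    using lr eint by (simp add: Henstock_Kurzweil_Integration.integral_combine)
  then have "norm (integral {a..b} e) \<le> norm (integral {a..l} e) + (norm (integral {l..r} e) + norm (integral {r..b} e))"
    using norm_triangle_ineq[of "integral {a..l} e" "integral {l..r} e + integral {r..b} e"]
      norm_triangle_ineq[of "integral {l..r} e" "integral {r..b} e"] by simp
  also have "\<dots> \<le> 4 / sqrt \<kappa> + (2 / sqrt \<kappa> + 4 / sqrt \<kappa>)" using 1 2 3 by linarith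
  finally show ?thesis by (simp add: e_def[abs_def])
qed

text \<open>The phase \<open>t + A t / (1 + t\<^sup>2)\<close> is the imaginary part of \<open>z - A / z\<close> on the line \<open>z = 1 + \<i>t\<close>.\<close>

lemma heat_phase_integral_bound:
  fixes A R T :: real
  assumes A: "0 \<le> A" and R: "2 \<le> R" "R \<le> T" "T \<le> 2 * R"
  shows "norm (integral {R..T} (\<lambda>t. exp (\<i> * of_real (t + A * t / (1 + t\<^sup>2))))) \<le> 80 * sqrt R"
proof -
  define \<phi>' where "\<phi>' t = 1 + A * (1 - t\<^sup>2) / (1 + t\<^sup>2)\<^sup>2" for t
  define \<phi>'' where "\<phi>'' t = 2 * A * t * (t\<^sup>2 - 3) / (1 + t\<^sup>2) ^ 3" for t
  have nz: "1 + t\<^sup>2 \<noteq> 0" "0 < 1 + t\<^sup>2" for t :: real using zero_le_power2[of t] by linarith+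
  have d1: "((\<lambda>t. t + A * t / (1 + t\<^sup>2)) has_real_derivative \<phi>' t) (at t)" for t
  proof (rule DERIV_cong)
    show "((\<lambda>t. t + A * t / (1 + t\<^sup>2)) has_real_derivative 1 + (A * (1 + t\<^sup>2) - A * t * (2 * t)) / ((1 + t\<^sup>2) * (1 + t\<^sup>2))) (at t)"
      using nz[of t] by (auto intro!: derivative_eq_intros)
    show "1 + (A * (1 + t\<^sup>2) - A * t * (2 * t)) / ((1 + t\<^sup>2) * (1 + t\<^sup>2)) = \<phi>' t"
      unfolding \<phi>'_def power2_eq_square by (simp add: algebra_simps)
  qed
  have d2: "(\<phi>' has_real_derivative \<phi>'' t) (at t)" for t
  proof (rule DERIV_cong)
    show "(\<phi>' has_real_derivative (A * (- (2 * t)) * (1 + t\<^sup>2)\<^sup>2 - A * (1 - t\<^sup>2) * (2 * (1 + t\<^sup>2) * (2 * t))) / ((1 + t\<^sup>2)\<^sup>2 * (1 + t\<^sup>2)\<^sup>2)) (at t)"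
      using nz[of t] unfolding \<phi>'_def[abs_def] by (auto intro!: derivative_eq_intros)
    have "A * (- (2 * t)) * (1 + t\<^sup>2)\<^sup>2 - A * (1 - t\<^sup>2) * (2 * (1 + t\<^sup>2) * (2 * t)) = (1 + t\<^sup>2) * (2 * A * t * (t\<^sup>2 - 3))"
      by (simp add: algebra_simps power2_eq_square)
    moreover have "(1 + t\<^sup>2)\<^sup>2 * (1 + t\<^sup>2)\<^sup>2 = (1 + t\<^sup>2) * (1 + t\<^sup>2) ^ 3"
      by (simp only: power2_eq_square power3_eq_cube mult.assoc)
    ultimately show "(A * (- (2 * t)) * (1 + t\<^sup>2)\<^sup>2 - A * (1 - t\<^sup>2) * (2 * (1 + t\<^sup>2) * (2 * t))) / ((1 + t\<^sup>2)\<^sup>2 * (1 + t\<^sup>2)\<^sup>2) = \<phi>'' t"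
      unfolding \<phi>''_def by (simp only: mult_divide_mult_cancel_left[OF nz(1)])
  qed
  \<comment> \<open>For large t the second derivative behaves like 2 A / t^3. The bound t >= 2 keeps
    t^2 - 3 >= t^2 / 4, away from the zero at sqrt 3; this is why R >= 2 is assumed.\<close>
  have lower: "A / (32 * R ^ 3) \<le> \<phi>'' t" if t: "t \<in> {R..T}" for t
  proof -
    have t2: "2 \<le> t" "t \<le> 2 * R" using t R by auto
    then have t4: "4 \<le> t\<^sup>2" using power_mono[of 2 t 2] by simp
    have "t ^ 3 \<le> (2 * R) ^ 3" using t2 by (intro power_mono) auto
    then have t3: "t ^ 3 \<le> 8 * R ^ 3" by (simp add: power_mult_distrib)
    have "(1 + t\<^sup>2) ^ 3 \<le> (5 / 4 * t\<^sup>2) ^ 3" using t4 by (intro power_mono) auto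
    also have "\<dots> = 125 / 64 * t ^ 6" by (simp add: power_mult_distrib power_divide flip: power_mult)
    finally have den: "(1 + t\<^sup>2) ^ 3 \<le> 2 * t ^ 6" by (rule order_trans) (simp add: mult_right_mono)
    have num: "t ^ 3 / 4 \<le> t * (t\<^sup>2 - 3)"
    proof -
      have "t * (t\<^sup>2 / 4) \<le> t * (t\<^sup>2 - 3)" using t2 t4 by (intro mult_left_mono) auto
      then show ?thesis by (simp add: power3_eq_cube power2_eq_square)
    qed
    have pos3: "0 < t ^ 3" "0 < R ^ 3" using t2 R by simp_all
    have "4 * t ^ 3 \<le> 32 * R ^ 3" using t3 by linarith
    then have "1 / (32 * R ^ 3) \<le> 1 / (4 * t ^ 3)"
      using pos3 by (intro divide_left_mono mult_pos_pos) simp_all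
    then have "(1 / (32 * R ^ 3)) * (1 + t\<^sup>2) ^ 3 \<le> (1 / (4 * t ^ 3)) * (2 * t ^ 6)"
      using den pos3 nz(2)[of t] by (intro mult_mono) simp_all
    also have "\<dots> = 2 * (t ^ 3 / 4)" using t2 by (simp add: power_numeral_reduce)
    also have "\<dots> \<le> 2 * (t * (t\<^sup>2 - 3))" using num by simp
    finally have "1 / (32 * R ^ 3) \<le> 2 * (t * (t\<^sup>2 - 3)) / (1 + t\<^sup>2) ^ 3"
      using nz[of t] by (simp add: pos_le_divide_eq)
    then have "A * (1 / (32 * R ^ 3)) \<le> A * (2 * (t * (t\<^sup>2 - 3)) / (1 + t\<^sup>2) ^ 3)"
      using A by (rule mult_left_mono)
    then show ?thesis by (simp add: \<phi>''_def mult_ac)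
  qed
  have lower0: "0 \<le> \<phi>'' t" if "t \<in> {R..T}" for t
    using order_trans[OF _ lower[OF that], of 0] A R by auto
  \<comment> \<open>A stationary point lies near t = sqrt A. If A is at most R^2 / 2, there is none
    on the interval and \<phi>' >= 1/2; otherwise \<phi>'' >= 1 / (64 R). Both alternatives give a
    bound free of A, that is, uniform in the positions of the kernel.\<close>
  show ?thesis
  proof (cases "A \<le> R\<^sup>2 / 2")
    case True
    have "norm (integral {R..T} (\<lambda>t. exp (\<i> * of_real (t + A * t / (1 + t\<^sup>2))))) \<le> 4 / (1 / 2)"
    proof (rule van_der_Corput_first[OF R(2) _ d1 d2 lower0])
      fix t assume t: "t \<in> {R..T}"
      have tR: "R\<^sup>2 \<le> t\<^sup>2" using t R by (intro power_mono) auto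
      have "A * (t\<^sup>2 - 1) \<le> (t\<^sup>2 / 2) * (t\<^sup>2 + 1)"
        using A tR True power_mono[of 2 R 2] R by (intro mult_mono) simp_all
      also have "\<dots> \<le> 1 / 2 * (1 + t\<^sup>2)\<^sup>2" by (simp add: power2_eq_square algebra_simps)
      finally have "A * (t\<^sup>2 - 1) / (1 + t\<^sup>2)\<^sup>2 \<le> 1 / 2"
        using nz[of t] by (simp add: pos_divide_le_eq)
      moreover have "\<phi>' t = 1 - A * (t\<^sup>2 - 1) / (1 + t\<^sup>2)\<^sup>2"
        by (simp add: \<phi>'_def right_diff_distrib diff_divide_distrib)
      ultimately show "1 / 2 \<le> \<bar>\<phi>' t\<bar>" by linarith
    qed auto
    also have "4 / (1 / 2) = (8::real)" by simp
    also have "8 \<le> 80 * sqrt R"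
    proof -
      have "1 \<le> sqrt R" using R by simp
      then show ?thesis by linarith
    qed
    finally show ?thesis .
  next
    case False
    have "norm (integral {R..T} (\<lambda>t. exp (\<i> * of_real (t + A * t / (1 + t\<^sup>2))))) \<le> 10 / sqrt (1 / (64 * R))"
    proof (rule van_der_Corput_second[OF R(2) _ d1 d2])
      fix t assume t: "t \<in> {R..T}"
      have "1 / (64 * R) = (R\<^sup>2 / 2) / (32 * R ^ 3)" using R by (simp add: power_numeral_reduce)
      also have "\<dots> \<le> A / (32 * R ^ 3)" using False R by (intro divide_right_mono) auto
      also have "\<dots> \<le> \<phi>'' t" by (rule lower[OF t])
      finally show "1 / (64 * R) \<le> \<phi>'' t" .
    qed (use R in auto)
    also have "10 / sqrt (1 / (64 * R)) = 80 * sqrt R"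
      using R real_sqrt_mult[of 64 R] by (simp add: real_sqrt_divide)
    finally show ?thesis .
  qed
qed

text \<open>Integration by parts against the primitive of \<open>e\<close>: an amplitude costs only
  its final value plus its total variation. \<open>g\<close> is a majorant of the derivative whose
  integral is known.\<close>

lemma integral_mult_bounded_variation:
  fixes e \<psi> \<psi>' :: "real \<Rightarrow> complex" and g :: "real \<Rightarrow> real"
  assumes ab: "a \<le> b" and e: "continuous_on {a..b} e"
    and M: "\<And>t. t \<in> {a..b} \<Longrightarrow> norm (integral {a..t} e) \<le> M"
    and d: "\<And>t. t \<in> {a..b} \<Longrightarrow> (\<psi> has_vector_derivative \<psi>' t) (at t within {a..b})"
    and \<psi>': "continuous_on {a..b} \<psi>'"
    and g: "\<And>t. t \<in> {a..b} \<Longrightarrow> norm (\<psi>' t) \<le> g t" "(g has_integral V) {a..b}"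
    and P: "norm (\<psi> b) \<le> P"
  shows "norm (integral {a..b} (\<lambda>t. e t * \<psi> t)) \<le> M * (P + V)"
proof -
  define E where "E t = integral {a..t} e" for t
  have M0: "0 \<le> M" using M[of a] ab norm_ge_zero order_trans by auto
  have dE: "(E has_vector_derivative e t) (at t within {a..b})" if "t \<in> {a..b}" for t
    unfolding E_def by (rule integral_has_vector_derivative[OF e that])
  have cE: "continuous_on {a..b} E"
    by (rule continuous_on_vector_derivative[OF dE])
  have c\<psi>: "continuous_on {a..b} \<psi>"
    by (rule continuous_on_vector_derivative[OF d])
  have ftc: "((\<lambda>t. E t * \<psi>' t + e t * \<psi> t) has_integral (E b * \<psi> b - E a * \<psi> a)) {a..b}"
    by (rule fundamental_theorem_of_calculus[OF ab has_vector_derivative_mult[OF dE d]])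
  have i1: "(\<lambda>t. E t * \<psi>' t) integrable_on {a..b}" "(\<lambda>t. e t * \<psi> t) integrable_on {a..b}"
    by (intro integrable_continuous_interval continuous_intros cE c\<psi> \<psi>' e)+
  have "integral {a..b} (\<lambda>t. e t * \<psi> t) = E b * \<psi> b - integral {a..b} (\<lambda>t. E t * \<psi>' t)"
    using integral_unique[OF ftc] Henstock_Kurzweil_Integration.integral_add[OF i1] by (simp add: E_def algebra_simps)
  then have "norm (integral {a..b} (\<lambda>t. e t * \<psi> t)) \<le> norm (E b * \<psi> b) + norm (integral {a..b} (\<lambda>t. E t * \<psi>' t))"
    by (simp add: norm_triangle_ineq4)
  also have "norm (E b * \<psi> b) \<le> M * P"
    unfolding norm_mult using M[of b] ab P M0 by (intro mult_mono) (auto simp: E_def)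
  also have "norm (integral {a..b} (\<lambda>t. E t * \<psi>' t)) \<le> integral {a..b} (\<lambda>t. M * g t)"
  proof (rule integral_norm_bound_integral[OF i1(1)])
    show "(\<lambda>t. M * g t) integrable_on {a..b}" using has_integral_mult_right[OF g(2), of M] by blast
    show "norm (E t * \<psi>' t) \<le> M * g t" if "t \<in> {a..b}" for t
      unfolding norm_mult using M[OF that] g(1)[OF that] M0 by (intro mult_mono) (auto simp: E_def)
  qed
  also have "\<dots> = M * V" using integral_unique[OF g(2)] by simp
  finally show ?thesis by (simp add: algebra_simps)
qed

section \<open>The kernel of a piece: uniform bounds over a dyadic shell\<close>

lemma vertical_line_powr_derivative:
  "((\<lambda>t. Complex 1 t powr w) has_vector_derivative \<i> * w * Complex 1 t powr (w - 1)) (at t within S)"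
proof -
  have 1: "(Complex 1 has_vector_derivative \<i>) (at t within S)"
    unfolding Complex_eq by (auto intro!: derivative_eq_intros has_vector_derivative_of_real)
  have "((\<lambda>z. z powr w) has_field_derivative (w * Complex 1 t powr (w - 1))) (at (Complex 1 t) within X)" for X
    by (rule has_field_derivative_at_within[OF has_field_derivative_powr]) (simp add: complex_nonpos_Reals_iff)
  from field_vector_diff_chain_within[OF 1 this] show ?thesis
    by (simp add: o_def mult_ac)
qed

lemma norm_Complex_1: "norm (Complex 1 t) ^ 2 = 1 + t\<^sup>2" "\<bar>t\<bar> \<le> norm (Complex 1 t)" "1 \<le> norm (Complex 1 t)"
  using abs_Im_le_cmod[of "Complex 1 t"] abs_Re_le_cmod[of "Complex 1 t"] by (auto simp: cmod_power2)

lemma exp_diff_divide_Complex_1: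
  fixes A t :: real
  shows "exp (Complex 1 t - of_real A / Complex 1 t)
    = exp (\<i> * of_real (t + A * t / (1 + t\<^sup>2))) * of_real (exp (1 - A / (1 + t\<^sup>2)))"
proof -
  have nz: "1 + t\<^sup>2 \<noteq> 0" using zero_le_power2[of t] by linarith
  have "of_real A / Complex 1 t = Complex (A / (1 + t\<^sup>2)) (- (A * t / (1 + t\<^sup>2)))"
    unfolding nonzero_divide_eq_eq[OF Re_pos_line(2)] using nz
    by (simp add: complex_eq_iff power2_eq_square flip: add_divide_distrib) (simp add: field_simps)
  then have "Complex 1 t - of_real A / Complex 1 t = \<i> * of_real (t + A * t / (1 + t\<^sup>2)) + of_real (1 - A / (1 + t\<^sup>2))"
    by (simp add: complex_eq_iff)
  then show ?thesis by (simp only: exp_add exp_of_real)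
qed

text \<open>For \<open>\<beta> = \<alpha> + 1 + n\<close> and \<open>A = \<pi>\<^sup>2 (|x - y|\<^sup>2 + |x - y'|\<^sup>2)\<close> this is, up to the factor \<open>\<pi>\<^sup>n\<close>, the
  Laplace weight times the kernels of the two heat flows.\<close>

definition kernel_integrand :: "real \<Rightarrow> real \<Rightarrow> real \<Rightarrow> complex"
  where "kernel_integrand \<beta> A t = exp (Complex 1 t - of_real A / Complex 1 t) * Complex 1 t powr (- of_real \<beta>)"

lemma isCont_Complex_1 [continuous_intros]: "isCont (Complex 1) t"
  unfolding Complex_eq by (intro continuous_intros)

lemma continuous_on_Complex_1 [continuous_intros]: "continuous_on S (Complex 1)"
  by (intro continuous_at_imp_continuous_on ballI isCont_Complex_1)

lemma continuous_on_Complex_1_powr [continuous_intros]: "continuous_on S (\<lambda>t. Complex 1 t powr w)"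
  by (rule continuous_on_vector_derivative[OF vertical_line_powr_derivative])

lemma continuous_on_kernel_integrand: "continuous_on S (kernel_integrand \<beta> A)"
  unfolding kernel_integrand_def by (intro continuous_intros) auto

lemma norm_kernel_integrand_le:
  assumes "0 \<le> A"
  shows "norm (kernel_integrand \<beta> A t) \<le> exp 1 * norm (Complex 1 t) powr (- \<beta>)"
proof -
  have "norm (exp (Complex 1 t - of_real A / Complex 1 t)) = exp (1 - A / (1 + t\<^sup>2))"
    by (simp add: norm_exp_eq_Re Re_divide)
  also have "\<dots> \<le> exp 1" using assms by simp
  finally show ?thesis
    unfolding kernel_integrand_def norm_mult by (intro mult_mono) (auto simp: norm_powr_real_powr')
qed

lemma kernel_integrand_cnj: "kernel_integrand \<beta> A (- t) = cnj (kernel_integrand \<beta> A t)"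
proof -
  have "Complex 1 (- t) = cnj (Complex 1 t)" by (simp add: complex_eq_iff)
  moreover have "cnj (Complex 1 t) powr (- of_real \<beta>) = cnj (Complex 1 t powr (- of_real \<beta>))"
    by (subst cnj_powr) (auto simp: complex_nonpos_Reals_iff)
  ultimately show ?thesis by (simp add: kernel_integrand_def exp_cnj)
qed

text \<open>The amplitude is q(t) z^(-\<beta>) with q(t) = exp (1 - A / (1 + t^2)). Although q
  depends on \<open>A\<close>, it increases for t > 0 and stays below exp 1, so its variation is
  bounded uniformly in \<open>A\<close>. The amplitude thus contributes R^(-\<beta>), the phase sqrt
  R.\<close>

lemma kernel_integral_bound:
  assumes A: "0 \<le> A" and R: "2 \<le> R" and \<beta>: "0 < \<beta>"
  shows "norm (integral {R..2 * R} (kernel_integrand \<beta> A)) \<le> 80 * exp 1 * (\<beta> + 2) * R powr (1 / 2 - \<beta>)"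
proof -
  define q where "q t = exp (1 - A / (1 + t\<^sup>2))" for t
  define q' where "q' t = q t * (2 * A * t / (1 + t\<^sup>2)\<^sup>2)" for t
  define e where "e t = exp (\<i> * complex_of_real (t + A * t / (1 + t\<^sup>2)))" for t
  define p where "p = (\<lambda>t. Complex 1 t powr (- of_real \<beta>))"
  define p' where "p' = (\<lambda>t. \<i> * (- of_real \<beta>) * Complex 1 t powr (- of_real \<beta> - 1))"
  \<comment> \<open>Only q' is kept exactly, because it is nonnegative and integrates to q (2 R) - q
    R; a pointwise bound for q' would depend on \<open>A\<close>.\<close>
  define g where "g t = exp 1 * \<beta> * R powr (- \<beta> - 1) + R powr (- \<beta>) * q' t" for t
  have nz: "1 + t\<^sup>2 \<noteq> 0" "0 < 1 + t\<^sup>2" for t :: real using zero_le_power2[of t] by linarith+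
  have nzc: "1 + (complex_of_real t)\<^sup>2 \<noteq> 0" for t using nz(1)[of t] by (metis of_real_1 of_real_add of_real_eq_0_iff of_real_power)
  have q: "0 < q t" "q t \<le> exp 1" for t using A nz[of t] by (auto simp: q_def)
  have dq: "(q has_real_derivative q' t) (at t)" for t
    unfolding q_def[abs_def] q'_def q_def using nz[of t]
    by (auto intro!: derivative_eq_intros simp: power2_eq_square)
  have cq: "continuous_on S q'" "continuous_on S q" for S
    unfolding q'_def q_def by (intro continuous_intros; use nz in auto)+
  have dp: "(p has_vector_derivative p' t) (at t within {R..2*R})" for t
    unfolding p_def p'_def by (rule vertical_line_powr_derivative)
  have tR: "norm (Complex 1 t) powr (- c) \<le> R powr (- c)" if "t \<in> {R..2 * R}" "0 \<le> c" for t c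
    using that R norm_Complex_1(2)[of t] by (intro powr_mono2') auto
  have np: "norm (p t) \<le> R powr (- \<beta>)" if "t \<in> {R..2 * R}" for t
    using tR[OF that, of \<beta>] \<beta> by (simp add: p_def norm_powr_real_powr')
  have np': "norm (p' t) \<le> \<beta> * R powr (- \<beta> - 1)" if "t \<in> {R..2 * R}" for t
    using tR[OF that, of "\<beta> + 1"] \<beta> by (simp add: p'_def norm_mult norm_powr_real_powr')
  have eq: "kernel_integrand \<beta> A = (\<lambda>t. e t * (of_real (q t) * p t))"
    by (simp add: fun_eq_iff kernel_integrand_def exp_diff_divide_Complex_1 e_def p_def q_def)
  have "norm (integral {R..2*R} (\<lambda>t. e t * (of_real (q t) * p t)))
     \<le> 80 * sqrt R * (exp 1 * R powr (- \<beta>) + (exp 1 * \<beta> * R powr (- \<beta> - 1) * R + R powr (- \<beta>) * (q (2*R) - q R)))"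
  proof (rule integral_mult_bounded_variation[where g = g and \<psi>' = "\<lambda>t. of_real (q t) * p' t + of_real (q' t) * p t"])
    show "continuous_on {R..2*R} e"
      unfolding e_def by (intro continuous_intros) (use nz nzc in auto)
    show "norm (integral {R..t} e) \<le> 80 * sqrt R" if "t \<in> {R..2*R}" for t
      unfolding e_def[abs_def] using heat_phase_integral_bound[OF A R, of t] that by auto
    show "((\<lambda>t. complex_of_real (q t) * p t) has_vector_derivative of_real (q t) * p' t + of_real (q' t) * p t) (at t within {R..2*R})" for t
      using dq[of t] by (intro has_vector_derivative_mult dp has_vector_derivative_of_real)
        (simp add: has_real_derivative_iff_has_vector_derivative has_vector_derivative_at_within)
    show "continuous_on {R..2*R} (\<lambda>t. of_real (q t) * p' t + of_real (q' t) * p t)"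
      unfolding p'_def p_def by (intro continuous_intros cq)
    show "norm (of_real (q t) * p' t + of_real (q' t) * p t) \<le> g t" if t: "t \<in> {R..2*R}" for t
    proof -
      have q'0: "0 \<le> q' t" using t R A q[of t] by (auto simp: q'_def intro!: mult_nonneg_nonneg divide_nonneg_nonneg)
      have "norm (of_real (q t) * p' t + of_real (q' t) * p t) \<le> q t * norm (p' t) + q' t * norm (p t)"
        using q[of t] q'0 by (intro norm_triangle_le) (simp add: norm_mult)
      also have "\<dots> \<le> exp 1 * (\<beta> * R powr (- \<beta> - 1)) + q' t * R powr (- \<beta>)"
        using q[of t] q'0 np[OF t] np'[OF t] by (intro add_mono mult_mono) auto
      finally show ?thesis by (simp add: g_def mult_ac)
    qed
    have "(q' has_integral (q (2*R) - q R)) {R..2*R}"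
      using R dq by (intro fundamental_theorem_of_calculus) (auto simp: has_real_derivative_iff_has_vector_derivative has_vector_derivative_at_within)
    from has_integral_mult_right[OF this] 
    have "((\<lambda>t. R powr (- \<beta>) * q' t) has_integral (R powr (- \<beta>) * (q (2*R) - q R))) {R..2*R}" .
    moreover have "((\<lambda>t. exp 1 * \<beta> * R powr (- \<beta> - 1)) has_integral (exp 1 * \<beta> * R powr (- \<beta> - 1) * R)) {R..2*R}"
      using has_integral_const_real[of "exp 1 * \<beta> * R powr (- \<beta> - 1)" R "2*R"] R by (simp add: mult_ac)
    ultimately show "(g has_integral (exp 1 * \<beta> * R powr (- \<beta> - 1) * R + R powr (- \<beta>) * (q (2*R) - q R))) {R..2*R}"
      unfolding g_def[abs_def] by (rule has_integral_add[rotated])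
    show "norm (of_real (q (2*R)) * p (2*R)) \<le> exp 1 * R powr (- \<beta>)"
      using np[of "2*R"] R q[of "2*R"] by (auto simp: norm_mult intro!: mult_mono)
  qed (use R in auto)
  also have "exp 1 * \<beta> * R powr (- \<beta> - 1) * R = exp 1 * \<beta> * R powr (- \<beta>)"
    using R by (simp add: powr_diff)
  also have "80 * sqrt R * (exp 1 * R powr (- \<beta>) + (exp 1 * \<beta> * R powr (- \<beta>) + R powr (- \<beta>) * (q (2*R) - q R)))
     \<le> 80 * sqrt R * (exp 1 * R powr (- \<beta>) + (exp 1 * \<beta> * R powr (- \<beta>) + R powr (- \<beta>) * exp 1))"
  proof -
    have "q (2 * R) - q R \<le> exp 1" using q[of "2*R"] q[of R] by linarith
    then show ?thesis using R by (intro mult_left_mono add_left_mono) auto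
  qed
  also have "\<dots> = 80 * exp 1 * (\<beta> + 2) * (sqrt R * R powr (- \<beta>))"
    by (simp add: algebra_simps)
  also have "sqrt R * R powr (- \<beta>) = R powr (1 / 2 - \<beta>)"
    using R by (simp add: powr_half_sqrt[symmetric] powr_add[symmetric])
  finally show ?thesis unfolding eq .
qed

definition dyadic_shell :: "nat \<Rightarrow> real set"
  where "dyadic_shell j = {t. \<bar>t\<bar> < 2 ^ Suc j \<and> (j = 0 \<or> 2 ^ j \<le> \<bar>t\<bar>)}"

lemma dyadic_shell_measurable [measurable]: "dyadic_shell j \<in> sets borel"
  unfolding dyadic_shell_def by measurable

lemma dyadic_shell_bounds:
  assumes "t \<in> dyadic_shell j"
  shows "2 ^ j \<le> norm (Complex 1 t)" "norm (Complex 1 t) \<le> 3 * 2 ^ j"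
proof -
  show "2 ^ j \<le> norm (Complex 1 t)"
    using assms norm_Complex_1[of t] by (cases "j = 0") (auto simp: dyadic_shell_def)
  have "norm (Complex 1 t) \<le> 1 + \<bar>t\<bar>" using cmod_le[of "Complex 1 t"] by simp
  also have "\<dots> \<le> 1 * 2 ^ j + 2 * 2 ^ j"
  proof -
    have "1 \<le> (2::real) ^ j" by simp
    moreover have "\<bar>t\<bar> < 2 * 2 ^ j" using assms by (simp add: dyadic_shell_def)
    ultimately show ?thesis by linarith
  qed
  finally show "norm (Complex 1 t) \<le> 3 * 2 ^ j" by simp
qed

lemma emeasure_dyadic_shell: "emeasure lborel (dyadic_shell j) \<le> ennreal (4 * 2 ^ j)"
proof -
  have "emeasure lborel (dyadic_shell j) \<le> emeasure lborel {- (2 ^ Suc j)..2 ^ Suc j :: real}"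
    by (intro emeasure_mono) (auto simp: dyadic_shell_def)
  also have "\<dots> = ennreal (4 * 2 ^ j)" by simp
  finally show ?thesis .
qed

lemma dyadic_shell_cover: "\<exists>!j. t \<in> dyadic_shell j"
proof -
  obtain k where k: "\<bar>t\<bar> < 2 ^ k" using real_arch_pow[of 2 "\<bar>t\<bar>"] by auto
  define j where "j = (LEAST j. \<bar>t\<bar> < 2 ^ Suc j)"
  have ex: "\<bar>t\<bar> < 2 ^ Suc k" using k by (simp add: less_le_trans) 
  have 1: "\<bar>t\<bar> < 2 ^ Suc j" unfolding j_def by (rule LeastI[of _ k]) (rule ex)
  have 2: "2 ^ j \<le> \<bar>t\<bar>" if "j \<noteq> 0"
  proof (rule ccontr)
    assume "\<not> 2 ^ j \<le> \<bar>t\<bar>"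
    then have "\<bar>t\<bar> < 2 ^ Suc (j - 1)" using that by simp
    then have "j \<le> j - 1" unfolding j_def by (rule Least_le)
    then show False using that by simp
  qed
  show ?thesis
  proof (rule ex1I[of _ j])
    show "t \<in> dyadic_shell j" using 1 2 by (auto simp: dyadic_shell_def)
    fix i assume i: "t \<in> dyadic_shell i"
    show "i = j"
    proof (rule linorder_cases[of i j])
      assume "i < j"
      then have "(2::real) ^ Suc i \<le> 2 ^ j" by (intro power_increasing) auto
      then show ?thesis using i 2 \<open>i < j\<close> by (auto simp: dyadic_shell_def)
    next
      assume "j < i"
      then have "(2::real) ^ Suc j \<le> 2 ^ i" by (intro power_increasing) auto
      then show ?thesis using i 1 \<open>j < i\<close> by (auto simp: dyadic_shell_def)
    qed
  qed
qed

lemma kernel_integrand_measurable [measurable]: "kernel_integrand \<beta> A \<in> borel_measurable borel"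
  by (intro borel_measurable_continuous_onI continuous_on_kernel_integrand)

lemma integrable_kernel_integrand:
  assumes "0 \<le> A" "1 < \<beta>"
  shows "integrable lborel (kernel_integrand \<beta> A)"
proof (rule Bochner_Integration.integrable_bound)
  show "integrable lborel (\<lambda>t. exp 1 * norm (Complex 1 t) powr (- \<beta>))"
    using integrable_norm_vertical_line_powr[OF assms(2)] by simp
qed (use norm_kernel_integrand_le[OF assms(1)] in auto)

lemma shell_kernel_bound:
  assumes A: "0 \<le> A" and \<beta>': "1 < \<beta>"
  shows "norm (LINT t:dyadic_shell j|lborel. kernel_integrand \<beta> A t) \<le> 160 * exp 1 * (\<beta> + 2) * (2 ^ j) powr (1 / 2 - \<beta>)"
proof -
  have \<beta>: "0 < \<beta>" using \<beta>' by simp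
  show ?thesis
proof (cases "j = 0")
  case True
  have n: "norm (kernel_integrand \<beta> A t) \<le> exp 1" for t
  proof -
    have "norm (Complex 1 t) powr (- \<beta>) \<le> 1 powr (- \<beta>)"
      using norm_Complex_1(3)[of t] \<beta> by (intro powr_mono2') auto
    then have "exp 1 * norm (Complex 1 t) powr (- \<beta>) \<le> exp (1::real) * 1" by (intro mult_left_mono) auto
    with norm_kernel_integrand_le[OF A, of \<beta> t] show ?thesis by (simp only: mult_1_right order_trans)
  qed
  have fin: "emeasure lborel (dyadic_shell j) < \<infinity>"
    using emeasure_dyadic_shell[of j] by (rule le_less_trans) simp
  have i: "integrable lborel (\<lambda>t. indicator (dyadic_shell j) t *\<^sub>R exp (1::real))"
    using fin by (intro integrable_scaleR_left integrable_real_indicator) auto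
  have "norm (LINT t:dyadic_shell j|lborel. kernel_integrand \<beta> A t) \<le> (\<integral>t. indicator (dyadic_shell j) t *\<^sub>R exp 1 \<partial>lborel)"
    unfolding set_lebesgue_integral_def using n
    by (intro Bochner_Integration.integral_norm_bound_integral i Bochner_Integration.integrable_bound[OF i]) (auto simp: indicator_def)
  also have "\<dots> = measure lborel (dyadic_shell j) * exp 1" by simp
  also have "\<dots> \<le> 4 * exp 1"
    using emeasure_dyadic_shell[of j] True by (intro mult_right_mono) (auto simp: measure_def intro: enn2real_leI)
  also have "\<dots> \<le> 160 * exp 1 * (\<beta> + 2) * 1" using \<beta> by simp
  finally show ?thesis using True by simp
next
  case False
  define R :: real where "R = 2 ^ j"
  have R: "2 \<le> R" using False power_increasing[of 1 j "2::real"] by (simp add: R_def)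
  let ?k = "kernel_integrand \<beta> A"
  have si: "set_integrable lborel {a..b} ?k" for a b
    unfolding set_integrable_def by (intro borel_integrable_compact continuous_on_kernel_integrand) auto
  have "(LINT t:dyadic_shell j|lborel. ?k t) = (LINT t:{- (2 * R)..- R} \<union> {R..2 * R}|lborel. ?k t)"
  proof (rule set_integral_null_delta)
    have "(dyadic_shell j - ({- (2 * R)..- R} \<union> {R..2 * R})) \<union> (({- (2 * R)..- R} \<union> {R..2 * R}) - dyadic_shell j) \<subseteq> {- (2 * R), 2 * R}"
      using R False by (auto simp: dyadic_shell_def R_def abs_if split: if_splits)
    then show "(dyadic_shell j - ({- (2 * R)..- R} \<union> {R..2 * R})) \<union> (({- (2 * R)..- R} \<union> {R..2 * R}) - dyadic_shell j) \<in> null_sets lborel"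
      by (rule null_sets_subset[rotated 2]) (auto intro: finite_imp_null_set_lborel)
  qed (auto intro: integrable_kernel_integrand[OF A \<beta>'])
  also have "\<dots> = (LINT t:{- (2 * R)..- R}|lborel. ?k t) + (LINT t:{R..2 * R}|lborel. ?k t)"
    using R by (intro set_integral_Un si) auto
  also have "(LINT t:{- (2 * R)..- R}|lborel. ?k t) = cnj (LINT t:{R..2 * R}|lborel. ?k t)"
  proof -
    have "(LINT t:{- (2 * R)..- R}|lborel. ?k t) = (\<integral>t. indicator {- (2 * R)..- R} (0 + (-1) * t) *\<^sub>R ?k (0 + (-1) * t) \<partial>lborel)"
      unfolding set_lebesgue_integral_def by (subst lborel_integral_real_affine[where c = "-1" and t = 0]) auto
    also have "\<dots> = (\<integral>t. cnj (indicator {R..2 * R} t *\<^sub>R ?k t) \<partial>lborel)"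
      by (intro Bochner_Integration.integral_cong refl) (auto simp: kernel_integrand_cnj indicator_def)
    finally show ?thesis unfolding set_lebesgue_integral_def by (simp only: Bochner_Integration.integral_cnj)
  qed
  also have "(LINT t:{R..2 * R}|lborel. ?k t) = integral {R..2 * R} ?k"
    by (rule set_borel_integral_eq_integral(2)[OF si])
  finally have "norm (LINT t:dyadic_shell j|lborel. ?k t) \<le> 2 * norm (integral {R..2 * R} ?k)"
    using norm_triangle_ineq[of "cnj (integral {R..2 * R} ?k)" "integral {R..2 * R} ?k"] by simp
  also have "\<dots> \<le> 2 * (80 * exp 1 * (\<beta> + 2) * R powr (1 / 2 - \<beta>))"
    using kernel_integral_bound[OF A R \<beta>] by simp
  finally show ?thesis by (simp add: R_def)
qed
qed

section \<open>Complex heat flow\<close>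

text \<open>On the line Re (1 / z) = 1 / |z|^2, so the modulus is a Gaussian of width comparable to
  |z|. This is the source of the localization at scale R.\<close>

lemma norm_heat_kernel:
  fixes x :: "'a::euclidean_space"
  shows "norm (heat_kernel (Complex 1 t) x)
    = sqrt (pi / norm (Complex 1 t)) ^ DIM('a) * exp (- (pi\<^sup>2 * (norm x)\<^sup>2 / (norm (Complex 1 t))\<^sup>2))"
proof -
  have "Re (of_real (pi\<^sup>2 * (norm x)\<^sup>2) / Complex 1 t) = pi\<^sup>2 * (norm x)\<^sup>2 / (norm (Complex 1 t))\<^sup>2"
    by (simp add: Re_divide cmod_power2)
  then show ?thesis
    unfolding heat_kernel_def by (simp add: norm_mult norm_power norm_divide norm_exp_eq_Re norm_csqrt del: of_real_mult of_real_power)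
qed

lemma norm_heat_kernel_le:
  fixes x :: "'a::euclidean_space"
  shows "norm (heat_kernel (Complex 1 t) x) \<le> sqrt pi ^ DIM('a)"
proof -
  have "pi / norm (Complex 1 t) \<le> pi" using norm_Complex_1(3)[of t] by (simp add: field_simps)
  then have "sqrt (pi / norm (Complex 1 t)) ^ DIM('a) \<le> sqrt pi ^ DIM('a)" by (intro power_mono) auto
  then have "norm (heat_kernel (Complex 1 t) x) \<le> sqrt pi ^ DIM('a) * 1"
    unfolding norm_heat_kernel by (intro mult_mono) auto
  then show ?thesis by simp
qed

lemma heat_kernel_measurable [measurable (raw)]:
  fixes g :: "'m \<Rightarrow> 'a::euclidean_space"
  assumes [measurable]: "f \<in> borel_measurable M" "g \<in> borel_measurable M"
  shows "(\<lambda>w. heat_kernel (Complex 1 (f w)) (g w)) \<in> borel_measurable M"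
proof -
  have "isCont (\<lambda>t. csqrt (of_real pi / Complex 1 t)) t" for t
  proof (rule isCont_csqrt')
    show "of_real pi / Complex 1 t \<notin> \<real>\<^sub>\<le>\<^sub>0" by (rule pi_divide_not_nonpos_Reals) simp
  qed (auto intro!: continuous_intros)
  then have [measurable]: "(\<lambda>t. csqrt (of_real pi / Complex 1 t)) \<in> borel_measurable borel"
    by (intro borel_measurable_continuous_onI continuous_at_imp_continuous_on ballI)
  show ?thesis unfolding heat_kernel_def by measurable
qed

definition heat :: "complex \<Rightarrow> ('a::euclidean_space \<Rightarrow> complex) \<Rightarrow> 'a \<Rightarrow> complex"
  where "heat z f x = (\<integral>y. f y * heat_kernel z (x - y) \<partial>lborel)"

lemma heat_measurable [measurable (raw)]:
  fixes g :: "'m \<Rightarrow> 'a::euclidean_space"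
  assumes [measurable]: "h \<in> borel_measurable borel" "f \<in> borel_measurable M" "g \<in> borel_measurable M"
  shows "(\<lambda>w. heat (Complex 1 (f w)) h (g w)) \<in> borel_measurable M"
  unfolding heat_def by measurable

lemma integrable_mult_heat_kernel:
  fixes f :: "'a::euclidean_space \<Rightarrow> complex"
  assumes f: "integrable lborel f"
  shows "integrable lborel (\<lambda>y. f y * heat_kernel (Complex 1 t) (x - y))"
proof (rule Bochner_Integration.integrable_bound)
  have [measurable]: "f \<in> borel_measurable borel" using f by auto
  show "integrable lborel (\<lambda>y. norm (f y) * sqrt pi ^ DIM('a))" using f by simp
  show "(\<lambda>y. f y * heat_kernel (Complex 1 t) (x - y)) \<in> borel_measurable lborel" by measurable
  show "AE y in lborel. norm (f y * heat_kernel (Complex 1 t) (x - y)) \<le> norm (norm (f y) * sqrt pi ^ DIM('a))"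
    using norm_heat_kernel_le by (auto simp: norm_mult intro!: AE_I2 mult_left_mono)
qed

lemma norm_heat_le:
  fixes f :: "'a::euclidean_space \<Rightarrow> complex"
  assumes f: "integrable lborel f"
  shows "norm (heat (Complex 1 t) f x) \<le> sqrt pi ^ DIM('a) * (\<integral>y. norm (f y) \<partial>lborel)"
proof -
  have "norm (heat (Complex 1 t) f x) \<le> (\<integral>y. norm (f y) * sqrt pi ^ DIM('a) \<partial>lborel)"
    unfolding heat_def using f norm_heat_kernel_le
    by (intro Bochner_Integration.integral_norm_bound_integral integrable_mult_heat_kernel) (auto simp: norm_mult intro!: mult_left_mono)
  then show ?thesis by (simp add: mult.commute)
qed

lemma heat_add:
  assumes "integrable lborel f" "integrable lborel g"
  shows "heat (Complex 1 t) (\<lambda>y. f y + g y) x = heat (Complex 1 t) f x + heat (Complex 1 t) g x"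
  unfolding heat_def distrib_right
  by (intro Bochner_Integration.integral_add integrable_mult_heat_kernel assms)

section \<open>L^2 estimates for the heat flow through its autocorrelation\<close>

lemma nn_integral_gaussian:
  assumes a: "0 < a"
  shows "(\<integral>\<^sup>+x. ennreal (exp (- (a * (norm (x::'a::euclidean_space))\<^sup>2))) \<partial>lborel) = ennreal (sqrt (pi / a) ^ DIM('a))"
    and "integrable lborel (\<lambda>x::'a. exp (- (a * (norm x)\<^sup>2)))"
proof -
  have e: "exp (2 * pi * \<i> * of_real ((0::'a) \<bullet> \<xi>)) * exp (- (of_real a * of_real ((norm \<xi>)\<^sup>2))) = complex_of_real (exp (- (a * (norm \<xi>)\<^sup>2)))" for \<xi> :: 'a
    by (simp add: exp_of_real[symmetric])
  have i: "integrable lborel (\<lambda>x::'a. complex_of_real (exp (- (a * (norm x)\<^sup>2))))"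
    using gaussian_fourier(1)[of "of_real a" "0::'a"] a unfolding e by simp
  then show i': "integrable lborel (\<lambda>x::'a. exp (- (a * (norm x)\<^sup>2)))"
    using complex_of_real_integrable_eq by blast
  have "complex_of_real (\<integral>x. exp (- (a * (norm (x::'a))\<^sup>2)) \<partial>lborel) = heat_kernel (of_real a) (0::'a)"
    using gaussian_fourier(2)[of "of_real a" "0::'a"] a unfolding e by (simp only: integral_complex_of_real) simp
  also have "\<dots> = complex_of_real (sqrt (pi / a) ^ DIM('a))"
    using a by (simp add: heat_kernel_def csqrt_of_real_nonneg flip: of_real_divide)
  finally have "(\<integral>x. exp (- (a * (norm (x::'a))\<^sup>2)) \<partial>lborel) = sqrt (pi / a) ^ DIM('a)"
    by (simp only: of_real_eq_iff)
  then show "(\<integral>\<^sup>+x. ennreal (exp (- (a * (norm (x::'a))\<^sup>2))) \<partial>lborel) = ennreal (sqrt (pi / a) ^ DIM('a))"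
    using nn_integral_eq_integral[OF i'] by simp
qed

text \<open>On the Fourier side the correlation is the transform of |exp (- z |\<xi>|^2)|^2 = exp (-
  2 |\<xi>|^2), which sees only Re z = 1. The proof evaluates the integral directly: centred at the
  midpoint of \<open>y\<close> and \<open>y'\<close> the integrand becomes a Gaussian times a
  character.\<close>

lemma heat_kernel_correlation:
  fixes y y' :: "'a::euclidean_space"
  shows "(\<integral>x. heat_kernel (Complex 1 t) (x - y) * cnj (heat_kernel (Complex 1 t) (x - y')) \<partial>lborel)
    = of_real (sqrt (pi / 2) ^ DIM('a) * exp (- (pi\<^sup>2 * (norm (y - y'))\<^sup>2 / 2)))"
proof -
  define z where "z = Complex 1 t"
  define N where "N = (norm z)\<^sup>2"
  define k where "k = (1 / 2) *\<^sub>R (y' - y)"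
  define m where "m = (1 / 2) *\<^sub>R (y + y')"
  define a where "a = 2 * pi\<^sup>2 / N"
  \<comment> \<open>The terms linear in s cancel in the real part, since the two kernels sit at s +
    k and s - k; conjugation makes them add up in the imaginary part, to 2 pi v . s.\<close>
  define v where "v = (2 * pi * t / N) *\<^sub>R k"
  have N: "N = 1 + t\<^sup>2" "N > 0" unfolding N_def z_def norm_Complex_1(1) using zero_le_power2[of t] by linarith+
  have a: "a > 0" using N by (simp add: a_def)
  have invz: "1 / z = Complex (1 / N) (- (t / N))"
    unfolding z_def N(1) by (simp add: complex_eq_iff Re_divide Im_divide)
  have dist: "(norm (s + k))\<^sup>2 = (norm s)\<^sup>2 + (norm k)\<^sup>2 + 2 * (s \<bullet> k)" "(norm (s - k))\<^sup>2 = (norm s)\<^sup>2 + (norm k)\<^sup>2 - 2 * (s \<bullet> k)" for s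
    by (simp_all add: power2_norm_eq_inner algebra_simps inner_commute)
  have *: "heat_kernel z (m + 1 *\<^sub>R s - y) * cnj (heat_kernel z (m + 1 *\<^sub>R s - y'))
     = of_real ((pi / norm z) ^ DIM('a) * exp (- (a * (norm k)\<^sup>2))) * (exp (2 * pi * \<i> * of_real (v \<bullet> s)) * exp (- (of_real a * of_real ((norm s)\<^sup>2))))" for s
  proof -
    have "y = (1 / 2) *\<^sub>R y + (1 / 2) *\<^sub>R y" "y' = (1 / 2) *\<^sub>R y' + (1 / 2) *\<^sub>R y'" by (simp_all flip: scaleR_add_left)
    then have mk: "m + 1 *\<^sub>R s - y = s + k" "m + 1 *\<^sub>R s - y' = s - k"
      unfolding m_def k_def by (simp_all add: algebra_simps)
    have "csqrt (of_real pi / z) * cnj (csqrt (of_real pi / z)) = of_real (pi / norm z)"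
      unfolding complex_norm_square[symmetric] by (simp add: norm_csqrt norm_divide)
    then have c: "csqrt (of_real pi / z) ^ DIM('a) * cnj (csqrt (of_real pi / z)) ^ DIM('a) = of_real ((pi / norm z) ^ DIM('a))"
      by (simp add: power_mult_distrib[symmetric])
    have "- (of_real (pi\<^sup>2 * (norm (s + k))\<^sup>2) / z) + cnj (- (of_real (pi\<^sup>2 * (norm (s - k))\<^sup>2) / z))
       = - (of_real (pi\<^sup>2 * (norm (s + k))\<^sup>2) * (1 / z)) - of_real (pi\<^sup>2 * (norm (s - k))\<^sup>2) * cnj (1 / z)"
      by simp
    also have "\<dots> = of_real (- (a * (norm k)\<^sup>2)) + (2 * pi * \<i> * of_real (v \<bullet> s) + (- (of_real a * of_real ((norm s)\<^sup>2))))"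
      unfolding invz dist using N(2)
      by (simp add: complex_eq_iff a_def v_def inner_commute[of k s] field_simps power2_eq_square)
    finally have "exp (- (of_real (pi\<^sup>2 * (norm (s + k))\<^sup>2) / z)) * cnj (exp (- (of_real (pi\<^sup>2 * (norm (s - k))\<^sup>2) / z)))
       = exp (of_real (- (a * (norm k)\<^sup>2))) * (exp (2 * pi * \<i> * of_real (v \<bullet> s)) * exp (- (of_real a * of_real ((norm s)\<^sup>2))))"
      unfolding exp_cnj exp_add[symmetric] by simp
    then show ?thesis unfolding mk heat_kernel_def using c
      by (simp add: exp_of_real[symmetric] mult_ac)
  qed
  have int: "integrable lborel (\<lambda>x. heat_kernel z (x - y) * cnj (heat_kernel z (x - y')))"
  proof -
    have "integrable lborel (\<lambda>s. heat_kernel z (m + 1 *\<^sub>R s - y) * cnj (heat_kernel z (m + 1 *\<^sub>R s - y')))"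
      unfolding * using gaussian_fourier(1)[of "of_real a" v] a by (intro integrable_mult_right) simp
    from integrable_lborel_affine(1)[OF this, of 1 "- m"] show ?thesis by simp
  qed
  have "(\<integral>x. heat_kernel z (x - y) * cnj (heat_kernel z (x - y')) \<partial>lborel)
     = (\<integral>s. heat_kernel z (m + 1 *\<^sub>R s - y) * cnj (heat_kernel z (m + 1 *\<^sub>R s - y')) \<partial>lborel)"
    using integrable_lborel_affine(2)[OF int, of 1 m] by simp
  also have "\<dots> = of_real ((pi / norm z) ^ DIM('a) * exp (- (a * (norm k)\<^sup>2))) * heat_kernel (of_real a) v"
    unfolding * integral_mult_right_zero using gaussian_fourier(2)[of "of_real a" v] a by simp
  also have "heat_kernel (of_real a) v = of_real (sqrt (pi / a) ^ DIM('a) * exp (- (pi\<^sup>2 * (norm v)\<^sup>2 / a)))"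
  proof -
    have "csqrt (of_real pi / of_real a) = of_real (sqrt (pi / a))"
      using a by (simp add: csqrt_of_real_nonneg flip: of_real_divide)
    then show ?thesis by (simp add: heat_kernel_def exp_of_real[symmetric])
  qed
  also have "of_real ((pi / norm z) ^ DIM('a) * exp (- (a * (norm k)\<^sup>2))) * of_real (sqrt (pi / a) ^ DIM('a) * exp (- (pi\<^sup>2 * (norm v)\<^sup>2 / a)))
     = complex_of_real (((pi / norm z) * sqrt (pi / a)) ^ DIM('a) * exp (- (a * (norm k)\<^sup>2 + pi\<^sup>2 * (norm v)\<^sup>2 / a)))"
    by (simp add: power_mult_distrib exp_diff exp_minus field_simps)
  also have "(pi / norm z) * sqrt (pi / a) = sqrt (pi / 2)"
  proof (rule power2_eq_imp_eq)
    have "((pi / norm z) * sqrt (pi / a))\<^sup>2 = pi\<^sup>2 / N * (pi / a)"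
      using a by (simp add: power_mult_distrib power_divide N_def)
    also have "\<dots> = (sqrt (pi / 2))\<^sup>2"
      using N(2) by (simp add: a_def power2_eq_square)
    finally show "((pi / norm z) * sqrt (pi / a))\<^sup>2 = (sqrt (pi / 2))\<^sup>2" .
  qed (use a in auto)
  \<comment> \<open>Here the dependence on t disappears: the two contributions are 2 pi^2 / N and 2
    pi^2 t^2 / N times |k|^2, and N = 1 + t^2.\<close>
  also have "a * (norm k)\<^sup>2 + pi\<^sup>2 * (norm v)\<^sup>2 / a = pi\<^sup>2 * (norm (y - y'))\<^sup>2 / 2"
  proof -
    have v: "(norm v)\<^sup>2 = (2 * pi * t / N)\<^sup>2 * (norm k)\<^sup>2" unfolding v_def norm_scaleR power_mult_distrib power2_abs ..
    have k: "(norm k)\<^sup>2 = (norm (y - y'))\<^sup>2 / 4" by (simp add: k_def power_mult_distrib norm_minus_commute power_divide)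
    have "a * (norm k)\<^sup>2 + pi\<^sup>2 * (norm v)\<^sup>2 / a = (a + pi\<^sup>2 * (2 * pi * t / N)\<^sup>2 / a) * (norm k)\<^sup>2"
      unfolding v by (simp add: algebra_simps)
    also have "pi\<^sup>2 * (2 * pi * t / N)\<^sup>2 / a = 2 * pi\<^sup>2 * t\<^sup>2 / N"
      using N(2) by (simp add: a_def field_simps power2_eq_square)
    also have "a + 2 * pi\<^sup>2 * t\<^sup>2 / N = 2 * pi\<^sup>2"
    proof -
      have "a + 2 * pi\<^sup>2 * t\<^sup>2 / N = 2 * pi\<^sup>2 * (1 + t\<^sup>2) / N"
        by (simp add: a_def add_divide_distrib[symmetric] algebra_simps)
      then show ?thesis using N(2) by (simp add: N(1)[symmetric])
    qed
    finally show ?thesis by (simp add: k)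
  qed
  finally show ?thesis by (simp add: z_def)
qed

abbreviation heat_energy :: "real \<Rightarrow> ('a::euclidean_space \<Rightarrow> complex) \<Rightarrow> ennreal"
  where "heat_energy t f \<equiv> \<integral>\<^sup>+x. ennreal ((norm (heat (Complex 1 t) f x))\<^sup>2) \<partial>lborel"

text \<open>The autocorrelation of the heat kernel at time \<open>1 + \<i>t\<close>, which is independent of \<open>t\<close>.\<close>

definition corr_kernel :: "'a::euclidean_space \<Rightarrow> real"
  where "corr_kernel h = sqrt (pi / 2) ^ DIM('a) * exp (- (pi\<^sup>2 * (norm h)\<^sup>2 / 2))"

lemma corr_kernel_nonneg [simp]: "0 \<le> corr_kernel h"
  by (simp add: corr_kernel_def)

lemma corr_kernel_le: "corr_kernel (h::'a::euclidean_space) \<le> sqrt (pi / 2) ^ DIM('a)"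
  by (simp add: corr_kernel_def mult_left_le)

lemma corr_kernel_measurable [measurable]: "corr_kernel \<in> borel_measurable borel"
  unfolding corr_kernel_def by measurable

text \<open>The mass is the value of exp (- 2 |\<xi>|^2) at frequency 0. Being exactly 1, it makes
  the flow a contraction on L^2.\<close>

lemma nn_integral_corr_kernel: "(\<integral>\<^sup>+h. ennreal (corr_kernel (h::'a::euclidean_space)) \<partial>lborel) = 1"
proof -
  have "(\<integral>\<^sup>+h. ennreal (corr_kernel (h::'a)) \<partial>lborel)
      = (\<integral>\<^sup>+h. ennreal (sqrt (pi / 2) ^ DIM('a)) * ennreal (exp (- ((pi\<^sup>2 / 2) * (norm (h::'a))\<^sup>2))) \<partial>lborel)"
    by (simp add: corr_kernel_def ennreal_mult[symmetric])
  also have "\<dots> = ennreal (sqrt (pi / 2) ^ DIM('a)) * ennreal (sqrt (pi / (pi\<^sup>2 / 2)) ^ DIM('a))"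
  proof -
    have "(\<lambda>h::'a. ennreal (exp (- ((pi\<^sup>2 / 2) * (norm h)\<^sup>2)))) \<in> borel_measurable lborel" by measurable
    then show ?thesis by (subst nn_integral_cmult, assumption, subst nn_integral_gaussian(1)) simp_all
  qed
  also have "\<dots> = ennreal ((sqrt (pi / 2) * sqrt (pi / (pi\<^sup>2 / 2))) ^ DIM('a))"
    by (simp add: ennreal_mult[symmetric] power_mult_distrib)
  also have "sqrt (pi / 2) * sqrt (pi / (pi\<^sup>2 / 2)) = 1"
    by (simp add: real_sqrt_mult[symmetric] power2_eq_square del: real_sqrt_mult)
  finally show ?thesis by simp
qed

lemma borel_measurable_cnj' [measurable (raw)]:
  assumes "f \<in> borel_measurable M"
  shows "(\<lambda>x. cnj (f x)) \<in> borel_measurable M"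
  by (rule measurable_compose[OF assms borel_measurable_continuous_onI]) (intro continuous_intros)

text \<open>Expand the square and integrate in x first. The kernel then enters only through its
  autocorrelation, so the right-hand side is free of t although the kernel itself spreads as |t|
  grows.\<close>

lemma heat_L2:
  fixes f :: "'a::euclidean_space \<Rightarrow> complex"
  assumes f: "integrable lborel f"
  shows "heat_energy t f
    \<le> (\<integral>\<^sup>+y. \<integral>\<^sup>+y'. ennreal (norm (f y) * norm (f y') * corr_kernel (y - y')) \<partial>lborel \<partial>lborel)"
proof -
  have [measurable]: "f \<in> borel_measurable borel" using f by auto
  define hk where "hk = (heat_kernel (Complex 1 t) :: 'a \<Rightarrow> complex)"
  have [measurable]: "hk \<in> borel_measurable borel" unfolding hk_def by measurable
  define F where "F p x = f (fst p) * cnj (f (snd p)) * (hk (x - fst p) * cnj (hk (x - snd p)))" for p x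
  have Fm [measurable]: "(\<lambda>(p, x). F p x) \<in> borel_measurable (lborel \<Otimes>\<^sub>M lborel)"
    unfolding F_def lborel_prod[symmetric] by measurable
  \<comment> \<open>For Fubini one kernel is bounded by its supremum and the other is integrated.
    \<open>M\<close> may depend on t, as only its finiteness enters.\<close>
  define M where "M = ennreal (sqrt pi ^ DIM('a)) * (\<integral>\<^sup>+x. ennreal (norm (hk x)) \<partial>lborel)"
  have M: "M < \<infinity>"
  proof -
    define a where "a = pi\<^sup>2 / (norm (Complex 1 t))\<^sup>2"
    have a: "a > 0" using norm_Complex_1(3)[of t] by (auto simp: a_def)
    have "(\<integral>\<^sup>+x. ennreal (norm (hk x)) \<partial>lborel)
      = (\<integral>\<^sup>+x. ennreal (sqrt (pi / norm (Complex 1 t)) ^ DIM('a)) * ennreal (exp (- (a * (norm (x::'a))\<^sup>2))) \<partial>lborel)"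
      by (simp add: hk_def norm_heat_kernel a_def ennreal_mult[symmetric])
    also have "\<dots> < \<infinity>"
    proof -
      have "(\<lambda>x::'a. ennreal (exp (- (a * (norm x)\<^sup>2)))) \<in> borel_measurable lborel" by measurable
      then show ?thesis
        by (subst nn_integral_cmult, assumption, subst nn_integral_gaussian(1)[OF a]) (simp add: ennreal_mult_less_top)
    qed
    finally show ?thesis by (simp add: M_def ennreal_mult_less_top)
  qed
  have b: "integrable lborel (\<lambda>p. norm (f (fst p)) * norm (f (snd p)))"
    unfolding lborel_prod[symmetric]
    by (rule lborel_pair.integrable_pair_bound[where a = "\<lambda>x. norm (f x)" and b = "\<lambda>x. norm (f x)"]) (use f in auto)
  have intF: "integrable (lborel \<Otimes>\<^sub>M lborel) (\<lambda>(p, x). F p x)"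
  proof (rule integrableI_bounded[OF Fm])
    have "(\<integral>\<^sup>+w. ennreal (norm (case w of (p, x) \<Rightarrow> F p x)) \<partial>(lborel \<Otimes>\<^sub>M lborel)) = (\<integral>\<^sup>+p. \<integral>\<^sup>+x. ennreal (norm (F p x)) \<partial>lborel \<partial>lborel)"
      by (subst lborel.nn_integral_fst[symmetric]) auto
    also have "\<dots> \<le> (\<integral>\<^sup>+p. ennreal (norm (f (fst p)) * norm (f (snd p))) * M \<partial>lborel)"
    proof (intro nn_integral_mono)
      fix p :: "'a \<times> 'a"
      have "(\<integral>\<^sup>+x. ennreal (norm (F p x)) \<partial>lborel)
        \<le> (\<integral>\<^sup>+x. ennreal (norm (f (fst p)) * norm (f (snd p))) * (ennreal (sqrt pi ^ DIM('a)) * ennreal (norm (hk (x - snd p)))) \<partial>lborel)"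
      proof (intro nn_integral_mono)
        fix x
        have "norm (F p x) \<le> norm (f (fst p)) * norm (f (snd p)) * (sqrt pi ^ DIM('a) * norm (hk (x - snd p)))"
          unfolding F_def norm_mult complex_mod_cnj hk_def
          by (intro mult_mono norm_heat_kernel_le) auto
        then show "ennreal (norm (F p x)) \<le> ennreal (norm (f (fst p)) * norm (f (snd p))) * (ennreal (sqrt pi ^ DIM('a)) * ennreal (norm (hk (x - snd p))))"
          by (simp add: ennreal_mult[symmetric])
      qed
      also have "\<dots> = ennreal (norm (f (fst p)) * norm (f (snd p))) * M"
        using nn_integral_lborel_translate(1)[of "\<lambda>x. ennreal (norm (hk x))" "snd p"]
        by (simp add: nn_integral_cmult M_def)
      finally show "(\<integral>\<^sup>+x. ennreal (norm (F p x)) \<partial>lborel) \<le> ennreal (norm (f (fst p)) * norm (f (snd p))) * M" .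
    qed
    also have "\<dots> = (\<integral>\<^sup>+p. ennreal (norm (f (fst p)) * norm (f (snd p))) \<partial>lborel) * M"
      using borel_measurable_integrable[OF b] by (intro nn_integral_multc) simp
    also have "\<dots> < \<infinity>"
      using b M by (auto simp: integrable_iff_bounded ennreal_mult_less_top abs_mult)
    finally show "(\<integral>\<^sup>+w. ennreal (norm (case w of (p, x) \<Rightarrow> F p x)) \<partial>(lborel \<Otimes>\<^sub>M lborel)) < \<infinity>" .
  qed
  have inner: "(\<integral>p. F p x \<partial>lborel) = of_real ((norm (heat (Complex 1 t) f x))\<^sup>2)" for x
  proof -
    have int: "integrable (lborel \<Otimes>\<^sub>M lborel) (\<lambda>p. F p x)"
      by (rule lborel_pair.integrable_pair_bound[where a = "\<lambda>y. norm (f y * hk (x - y))" and b = "\<lambda>y. norm (f y * hk (x - y))"])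
        (use integrable_norm[OF integrable_mult_heat_kernel[OF f, of t x]] in \<open>auto simp: F_def norm_mult hk_def\<close>)
    have "(\<integral>p. F p x \<partial>lborel) = (\<integral>y. \<integral>y'. F (y, y') x \<partial>lborel \<partial>lborel)"
      using lborel_pair.integral_fst'[OF int] by (simp add: lborel_prod)
    also have "\<dots> = (\<integral>y. (f y * hk (x - y)) * cnj (heat (Complex 1 t) f x) \<partial>lborel)"
    proof (intro Bochner_Integration.integral_cong refl)
      fix y
      have "(\<integral>y'. F (y, y') x \<partial>lborel) = (\<integral>y'. (f y * hk (x - y)) * cnj (f y' * hk (x - y')) \<partial>lborel)"
        by (intro Bochner_Integration.integral_cong refl) (simp add: F_def mult_ac)
      then show "(\<integral>y'. F (y, y') x \<partial>lborel) = (f y * hk (x - y)) * cnj (heat (Complex 1 t) f x)"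
        by (simp add: heat_def hk_def Bochner_Integration.integral_cnj[symmetric] del: Bochner_Integration.integral_cnj complex_cnj_mult)
    qed
    also have "\<dots> = heat (Complex 1 t) f x * cnj (heat (Complex 1 t) f x)"
      by (simp add: heat_def[of _ f x] hk_def)
    finally show ?thesis by (simp only: complex_norm_square)
  qed
  have outer: "(\<integral>x. F p x \<partial>lborel) = f (fst p) * cnj (f (snd p)) * of_real (corr_kernel (fst p - snd p))" for p
    unfolding F_def integral_mult_right_zero hk_def heat_kernel_correlation corr_kernel_def ..
  have i2: "integrable lborel (\<lambda>x. (norm (heat (Complex 1 t) f x))\<^sup>2)"
    using lborel_pair.integrable_snd[OF intF] unfolding inner by (simp only: complex_of_real_integrable_eq)
  have i3: "integrable lborel (\<lambda>p. f (fst p) * cnj (f (snd p)) * of_real (corr_kernel (fst p - snd p)))"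
    using lborel_pair.integrable_fst[OF intF] unfolding outer .
  have "heat_energy t f = ennreal (\<integral>x. (norm (heat (Complex 1 t) f x))\<^sup>2 \<partial>lborel)"
    by (rule nn_integral_eq_integral[OF i2]) auto
  also have "(\<integral>x. (norm (heat (Complex 1 t) f x))\<^sup>2 \<partial>lborel) = norm (\<integral>x. (\<integral>p. F p x \<partial>lborel) \<partial>lborel)"
    unfolding inner integral_complex_of_real by simp
  also have "(\<integral>x. (\<integral>p. F p x \<partial>lborel) \<partial>lborel) = (\<integral>p. f (fst p) * cnj (f (snd p)) * of_real (corr_kernel (fst p - snd p)) \<partial>lborel)"
    unfolding outer[symmetric] by (rule lborel_pair.Fubini_integral[OF intF])
  also have "ennreal (norm \<dots>) \<le> (\<integral>\<^sup>+p. ennreal (norm (f (fst p) * cnj (f (snd p)) * of_real (corr_kernel (fst p - snd p)))) \<partial>lborel)"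
    by (rule integral_norm_bound_ennreal[OF i3])
  also have "\<dots> = (\<integral>\<^sup>+y. \<integral>\<^sup>+y'. ennreal (norm (f y) * norm (f y') * corr_kernel (y - y')) \<partial>lborel \<partial>lborel)"
    unfolding lborel_prod[symmetric]
    by (subst lborel.nn_integral_fst[symmetric]) (auto simp: norm_mult)
  finally show ?thesis .
qed

text \<open>Schur's test: 2 |f(y)| |f(y')| is at most the sum of the squares, and the correlation
  kernel has mass 1 in either variable.\<close>

lemma heat_L2_L2:
  fixes f :: "'a::euclidean_space \<Rightarrow> complex"
  assumes f: "integrable lborel f"
  shows "heat_energy t f \<le> (\<integral>\<^sup>+x. ennreal ((norm (f x))\<^sup>2) \<partial>lborel)"
proof -
  have [measurable]: "f \<in> borel_measurable borel" using f by auto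
  let ?h = "\<lambda>y. ennreal ((norm (f y))\<^sup>2 / 2)"
  let ?k = "\<lambda>y y'. ennreal (corr_kernel (y - y' :: 'a))"
  have k: "(\<integral>\<^sup>+y'. ?k y y' \<partial>lborel) = 1" "(\<integral>\<^sup>+y. ?k y y' \<partial>lborel) = 1" for y y'
    using nn_integral_lborel_translate[of "\<lambda>x::'a. ennreal (corr_kernel x)"] nn_integral_corr_kernel[where 'a = 'a] by simp_all
  have "heat_energy t f
    \<le> (\<integral>\<^sup>+y. \<integral>\<^sup>+y'. ennreal (norm (f y) * norm (f y') * corr_kernel (y - y')) \<partial>lborel \<partial>lborel)" by (rule heat_L2[OF f])
  also have "\<dots> \<le> (\<integral>\<^sup>+y. \<integral>\<^sup>+y'. ?h y * ?k y y' + ?h y' * ?k y y' \<partial>lborel \<partial>lborel)"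
  proof (intro nn_integral_mono)
    fix y y'
    have "2 * (norm (f y) * norm (f y')) \<le> (norm (f y))\<^sup>2 + (norm (f y'))\<^sup>2"
      using sum_squares_bound[of "norm (f y)" "norm (f y')"] by (simp add: mult.assoc)
    then have "norm (f y) * norm (f y') * corr_kernel (y - y') \<le> ((norm (f y))\<^sup>2 / 2 + (norm (f y'))\<^sup>2 / 2) * corr_kernel (y - y')"
      by (intro mult_right_mono) auto
    then show "ennreal (norm (f y) * norm (f y') * corr_kernel (y - y')) \<le> ?h y * ?k y y' + ?h y' * ?k y y'"
      by (simp add: ennreal_mult[symmetric] ennreal_plus[symmetric] distrib_right del: ennreal_plus)
  qed
  also have "\<dots> = (\<integral>\<^sup>+y. \<integral>\<^sup>+y'. ?h y * ?k y y' \<partial>lborel \<partial>lborel) + (\<integral>\<^sup>+y. \<integral>\<^sup>+y'. ?h y' * ?k y y' \<partial>lborel \<partial>lborel)"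
    by (simp add: nn_integral_add)
  also have "(\<integral>\<^sup>+y. \<integral>\<^sup>+y'. ?h y' * ?k y y' \<partial>lborel \<partial>lborel) = (\<integral>\<^sup>+y'. \<integral>\<^sup>+y. ?h y' * ?k y y' \<partial>lborel \<partial>lborel)"
    by (rule lborel_pair.Fubini') measurable
  also have "(\<integral>\<^sup>+y. \<integral>\<^sup>+y'. ?h y * ?k y y' \<partial>lborel \<partial>lborel) + (\<integral>\<^sup>+y'. \<integral>\<^sup>+y. ?h y' * ?k y y' \<partial>lborel \<partial>lborel)
     = (\<integral>\<^sup>+y. ?h y \<partial>lborel) + (\<integral>\<^sup>+y. ?h y \<partial>lborel)"
    by (simp add: nn_integral_cmult k)
  also have "\<dots> = (\<integral>\<^sup>+x. ennreal ((norm (f x))\<^sup>2) \<partial>lborel)"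
    by (subst nn_integral_add[symmetric]) (auto simp: ennreal_plus[symmetric] simp del: ennreal_plus)
  finally show ?thesis .
qed

lemma heat_L1_L2:
  fixes f :: "'a::euclidean_space \<Rightarrow> complex"
  assumes f: "integrable lborel f" and A: "0 \<le> A" "(\<integral>\<^sup>+x. ennreal (norm (f x)) \<partial>lborel) \<le> ennreal A"
  shows "heat_energy t f \<le> ennreal (sqrt (pi / 2) ^ DIM('a) * A\<^sup>2)"
proof -
  have [measurable]: "f \<in> borel_measurable borel" using f by auto
  let ?c = "ennreal (sqrt (pi / 2) ^ DIM('a))"
  let ?I = "(\<integral>\<^sup>+x. ennreal (norm (f x)) \<partial>lborel)"
  have "heat_energy t f
    \<le> (\<integral>\<^sup>+y. \<integral>\<^sup>+y'. ennreal (norm (f y) * norm (f y') * corr_kernel (y - y')) \<partial>lborel \<partial>lborel)" by (rule heat_L2[OF f])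
  also have "\<dots> \<le> (\<integral>\<^sup>+y. \<integral>\<^sup>+y'. ?c * ennreal (norm (f y)) * ennreal (norm (f y')) \<partial>lborel \<partial>lborel)"
  proof (intro nn_integral_mono)
    fix y y'
    have "norm (f y) * norm (f y') * corr_kernel (y - y') \<le> norm (f y) * norm (f y') * sqrt (pi / 2) ^ DIM('a)"
      by (intro mult_left_mono corr_kernel_le) auto
    then show "ennreal (norm (f y) * norm (f y') * corr_kernel (y - y')) \<le> ?c * ennreal (norm (f y)) * ennreal (norm (f y'))"
      by (simp add: ennreal_mult[symmetric] mult_ac)
  qed
  also have "\<dots> = ?c * ?I * ?I"
    by (simp add: nn_integral_cmult nn_integral_multc)
  also have "\<dots> \<le> ?c * ennreal A * ennreal A"
    by (intro mult_mono A) auto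
  also have "\<dots> = ennreal (sqrt (pi / 2) ^ DIM('a) * A\<^sup>2)"
    using A by (simp add: ennreal_mult[symmetric] power2_eq_square mult.assoc)
  finally show ?thesis .
qed

text \<open>From |a + b|^2 <= 2 |a|^2 + 2 |b|^2, with the L^2 bound 1 for small values and the
  supremum of \<open>corr_kernel\<close> for large ones.\<close>

definition bernstein_const :: "'a::euclidean_space itself \<Rightarrow> real"
  where "bernstein_const _ = sqrt (2 + 2 * sqrt (pi / 2) ^ DIM('a))"

lemma bernstein_const_ge: "1 \<le> bernstein_const TYPE('a::euclidean_space)"
  "sqrt (pi / 2) ^ DIM('a) \<le> (bernstein_const TYPE('a::euclidean_space))\<^sup>2"
proof -
  have "0 \<le> sqrt (pi / 2) ^ DIM('a)" by simp
  then show "1 \<le> bernstein_const TYPE('a)" "sqrt (pi / 2) ^ DIM('a) \<le> (bernstein_const TYPE('a))\<^sup>2"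
    by (auto simp: bernstein_const_def simp del: real_sqrt_ge_0_iff)
qed

lemma nn_integral_large_values:
  fixes f :: "'a \<Rightarrow> complex"
  assumes [measurable]: "f \<in> borel_measurable M" and p: "1 \<le> p" and A: "0 < A"
    and fA: "(\<integral>\<^sup>+x. ennreal (norm (f x) powr p) \<partial>M) \<le> ennreal (A powr p)"
  shows "(\<integral>\<^sup>+x. ennreal (norm (if A < norm (f x) then f x else 0)) \<partial>M) \<le> ennreal A"
proof -
  have "(\<integral>\<^sup>+x. ennreal (norm (if A < norm (f x) then f x else 0)) \<partial>M) \<le> (\<integral>\<^sup>+x. ennreal (A powr (1 - p)) * ennreal (norm (f x) powr p) \<partial>M)"
  proof (intro nn_integral_mono)
    fix x
    have "norm (if A < norm (f x) then f x else 0) \<le> A powr (1 - p) * norm (f x) powr p"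
    proof (cases "A < norm (f x)")
      case True
      then have "norm (f x) = norm (f x) powr (1 - p) * norm (f x) powr p"
        using A by (simp add: powr_add[symmetric])
      also have "\<dots> \<le> A powr (1 - p) * norm (f x) powr p"
        using True p A by (intro mult_right_mono powr_mono2') auto
      finally show ?thesis using True by simp
    qed simp
    then show "ennreal (norm (if A < norm (f x) then f x else 0)) \<le> ennreal (A powr (1 - p)) * ennreal (norm (f x) powr p)"
      by (simp add: ennreal_mult[symmetric])
  qed
  also have "\<dots> \<le> ennreal (A powr (1 - p)) * ennreal (A powr p)"
    by (simp add: nn_integral_cmult mult_left_mono fA)
  also have "\<dots> = ennreal A" using A by (simp add: ennreal_mult[symmetric] powr_add[symmetric])
  finally show ?thesis .
qed

text \<open>Bernstein's inequality, uniform in \<open>t\<close>: small values of \<open>f\<close> are estimated in \<open>L\<^sup>2\<close>, large ones in \<open>L\<^sup>1\<close>.\<close>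

lemma heat_Lp_L2:
  fixes f :: "'a::euclidean_space \<Rightarrow> complex"
  assumes f: "integrable lborel f" and p: "1 \<le> p" "p \<le> 2" and A: "0 < A"
    and fA: "Lp_mass p f \<le> ennreal (A powr p)"
  shows "heat_energy t f \<le> ennreal ((bernstein_const TYPE('a) * A)\<^sup>2)"
proof -
  have [measurable]: "f \<in> borel_measurable borel" using f by auto
  \<comment> \<open>The cut is made at height \<open>A\<close>, the bound for the L^p norm itself:
    then the L^2 norm of the small part and the L^1 norm of the large part are both at most
    \<open>A\<close>.\<close>
  define s where "s x = (if norm (f x) \<le> A then f x else 0)" for x
  define l where "l x = (if A < norm (f x) then f x else 0)" for x
  have [measurable]: "s \<in> borel_measurable borel" "l \<in> borel_measurable borel" unfolding s_def l_def by measurable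
  have int: "integrable lborel s" "integrable lborel l"
    by (rule Bochner_Integration.integrable_bound[OF f]; auto simp: s_def l_def)+
  have fsl: "f = (\<lambda>x. s x + l x)" by (auto simp: s_def l_def fun_eq_iff)
  have s2: "(\<integral>\<^sup>+x. ennreal ((norm (s x))\<^sup>2) \<partial>lborel) \<le> ennreal (A\<^sup>2)"
  proof -
    have "(\<integral>\<^sup>+x. ennreal ((norm (s x))\<^sup>2) \<partial>lborel) \<le> (\<integral>\<^sup>+x. ennreal (A powr (2 - p)) * ennreal (norm (f x) powr p) \<partial>lborel)"
    proof (intro nn_integral_mono)
      fix x
      have "(norm (s x))\<^sup>2 \<le> A powr (2 - p) * norm (f x) powr p"
      proof (cases "norm (f x) \<le> A \<and> f x \<noteq> 0")
        case True
        then have "(norm (s x))\<^sup>2 = norm (f x) powr (2 - p) * norm (f x) powr p"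
          by (simp add: s_def powr_add[symmetric])
        also have "\<dots> \<le> A powr (2 - p) * norm (f x) powr p"
          using True p by (intro mult_right_mono powr_mono2) auto
        finally show ?thesis .
      qed (auto simp: s_def)
      then show "ennreal ((norm (s x))\<^sup>2) \<le> ennreal (A powr (2 - p)) * ennreal (norm (f x) powr p)"
        by (simp add: ennreal_mult[symmetric])
    qed
    also have "\<dots> \<le> ennreal (A powr (2 - p)) * ennreal (A powr p)"
      by (simp add: nn_integral_cmult mult_left_mono fA)
    also have "\<dots> = ennreal (A\<^sup>2)" using A by (simp add: ennreal_mult[symmetric] powr_add[symmetric])
    finally show ?thesis .
  qed
  have l1: "(\<integral>\<^sup>+x. ennreal (norm (l x)) \<partial>lborel) \<le> ennreal A"
    unfolding l_def by (rule nn_integral_large_values[OF _ p(1) A fA]) simp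
  have "heat_energy t f
    \<le> (\<integral>\<^sup>+x. 2 * ennreal ((norm (heat (Complex 1 t) s x))\<^sup>2) + 2 * ennreal ((norm (heat (Complex 1 t) l x))\<^sup>2) \<partial>lborel)"
  proof (intro nn_integral_mono)
    fix x
    let ?a = "norm (heat (Complex 1 t) s x)" and ?b = "norm (heat (Complex 1 t) l x)"
    have "norm (heat (Complex 1 t) f x) \<le> ?a + ?b"
      unfolding fsl heat_add[OF int] by (rule norm_triangle_ineq)
    then have "(norm (heat (Complex 1 t) f x))\<^sup>2 \<le> (?a + ?b)\<^sup>2" by (intro power_mono) auto
    also have "\<dots> \<le> 2 * ?a\<^sup>2 + 2 * ?b\<^sup>2" using sum_squares_bound[of ?a ?b] by (simp add: power2_sum)
    finally have "ennreal ((norm (heat (Complex 1 t) f x))\<^sup>2) \<le> ennreal (2 * ?a\<^sup>2 + 2 * ?b\<^sup>2)" by (rule ennreal_leI)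
    then show "ennreal ((norm (heat (Complex 1 t) f x))\<^sup>2) \<le> 2 * ennreal (?a\<^sup>2) + 2 * ennreal (?b\<^sup>2)"
      by (simp add: ennreal_mult ennreal_plus)
  qed
  also have "\<dots> = 2 * heat_energy t s + 2 * heat_energy t l"
    by (simp add: nn_integral_add nn_integral_cmult)
  also have "\<dots> \<le> 2 * ennreal (A\<^sup>2) + 2 * ennreal (sqrt (pi / 2) ^ DIM('a) * A\<^sup>2)"
    using A by (intro add_mono mult_left_mono order_trans[OF heat_L2_L2[OF int(1)] s2] heat_L1_L2[OF int(2) _ l1]) auto
  also have "\<dots> = ennreal (2 * A\<^sup>2 + 2 * (sqrt (pi / 2) ^ DIM('a) * A\<^sup>2))"
    by (simp add: ennreal_mult ennreal_plus)
  also have "2 * A\<^sup>2 + 2 * (sqrt (pi / 2) ^ DIM('a) * A\<^sup>2) = (bernstein_const TYPE('a) * A)\<^sup>2"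
    by (simp add: bernstein_const_def power_mult_distrib algebra_simps add_nonneg_nonneg)
  finally show ?thesis .
qed

section \<open>Dyadic pieces of the operator\<close>

lemma powr_add_le_add_powr:
  fixes a b p :: real
  assumes "0 \<le> a" "0 \<le> b" "0 < p" "p \<le> 1"
  shows "(a + b) powr p \<le> a powr p + b powr p"
proof (cases "a + b = 0")
  case False
  then have s: "a + b > 0" using assms by simp
  have u: "u \<le> u powr p" if "0 \<le> u" "u \<le> 1" for u :: real
  proof (cases "u = 0")
    case False
    then show ?thesis using powr_mono'[of p 1 u] that assms by simp
  qed simp
  have "1 = a / (a + b) + b / (a + b)" using s by (simp add: add_divide_distrib[symmetric])
  also have "\<dots> \<le> (a / (a + b)) powr p + (b / (a + b)) powr p"
    using s assms by (intro add_mono u) (auto simp: field_simps)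
  also have "\<dots> = (a powr p + b powr p) / (a + b) powr p"
    using s assms by (simp add: powr_divide add_divide_distrib)
  finally show ?thesis using s by (simp add: field_simps)
qed (use assms in auto)

lemma norm_sum_powr_le:
  fixes F :: "'i \<Rightarrow> complex"
  assumes "finite K" "0 < p" "p \<le> 1"
  shows "norm (\<Sum>k\<in>K. F k) powr p \<le> (\<Sum>k\<in>K. norm (F k) powr p)"
  using assms(1)
proof induction
  case (insert k K)
  have "norm (\<Sum>k\<in>insert k K. F k) powr p \<le> (norm (F k) + norm (\<Sum>k\<in>K. F k)) powr p"
    using insert assms by (intro powr_mono2) (auto intro: norm_triangle_ineq)
  also have "\<dots> \<le> norm (F k) powr p + norm (\<Sum>k\<in>K. F k) powr p"
    using assms by (intro powr_add_le_add_powr) auto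
  finally show ?case using insert by simp
qed simp

text \<open>Every t lies in exactly one shell, so the partial sums converge by dominated
  convergence; subadditivity of the p-th power passes to the limit.\<close>

lemma norm_integral_powr_le_suminf_shells:
  fixes F :: "real \<Rightarrow> complex"
  assumes F: "integrable lborel F" and p: "0 < p" "p \<le> 1"
  shows "ennreal (norm (\<integral>t. F t \<partial>lborel) powr p) \<le> (\<Sum>j. ennreal (norm (LINT t:dyadic_shell j|lborel. F t) powr p))"
proof -
  have [measurable]: "F \<in> borel_measurable borel" using F by auto
  have part: "\<exists>k. \<forall>N. (\<Sum>j<N. indicator (dyadic_shell j) t *\<^sub>R F t) = (if k < N then F t else 0)" for t
  proof -
    obtain k where k: "t \<in> dyadic_shell k" "\<And>j. t \<in> dyadic_shell j \<Longrightarrow> j = k" using dyadic_shell_cover[of t] by blast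
    have "indicator (dyadic_shell j) t *\<^sub>R F t = (if j = k then F t else 0)" for j
    proof (cases "j = k")
      case False
      then have "t \<notin> dyadic_shell j" using k(2) by blast
      then show ?thesis using False by simp
    qed (use k(1) in simp)
    then show ?thesis by (intro exI[of _ k]) (simp add: sum.delta)
  qed
  have "(\<lambda>N. \<integral>t. (\<Sum>j<N. indicator (dyadic_shell j) t *\<^sub>R F t) \<partial>lborel) \<longlonglongrightarrow> (\<integral>t. F t \<partial>lborel)"
  proof (rule integral_dominated_convergence[where w = "\<lambda>t. norm (F t)"])
    show "AE t in lborel. (\<lambda>N. \<Sum>j<N. indicator (dyadic_shell j) t *\<^sub>R F t) \<longlonglongrightarrow> F t"
    proof (rule AE_I2)
      fix t
      obtain k where k: "\<And>N. (\<Sum>j<N. indicator (dyadic_shell j) t *\<^sub>R F t) = (if k < N then F t else 0)" using part[of t] by auto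
      have "eventually (\<lambda>N. (\<Sum>j<N. indicator (dyadic_shell j) t *\<^sub>R F t) = F t) sequentially"
        unfolding k using eventually_gt_at_top[of k] by eventually_elim simp
      then show "(\<lambda>N. \<Sum>j<N. indicator (dyadic_shell j) t *\<^sub>R F t) \<longlonglongrightarrow> F t" by (rule tendsto_eventually)
    qed
    show "AE t in lborel. norm (\<Sum>j<N. indicator (dyadic_shell j) t *\<^sub>R F t) \<le> norm (F t)" for N
    proof (rule AE_I2)
      fix t
      obtain k where k: "\<And>N. (\<Sum>j<N. indicator (dyadic_shell j) t *\<^sub>R F t) = (if k < N then F t else 0)" using part[of t] by auto
      show "norm (\<Sum>j<N. indicator (dyadic_shell j) t *\<^sub>R F t) \<le> norm (F t)" unfolding k by simp
    qed
  qed (use F in auto)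
  moreover have "(\<integral>t. (\<Sum>j<N. indicator (dyadic_shell j) t *\<^sub>R F t) \<partial>lborel) = (\<Sum>j<N. LINT t:dyadic_shell j|lborel. F t)" for N
    unfolding set_lebesgue_integral_def
    by (intro Bochner_Integration.integral_sum integrable_mult_indicator F) auto
  ultimately have lim: "(\<lambda>N. \<Sum>j<N. LINT t:dyadic_shell j|lborel. F t) \<longlonglongrightarrow> (\<integral>t. F t \<partial>lborel)" by simp
  have "(\<lambda>N. ennreal (norm (\<Sum>j<N. LINT t:dyadic_shell j|lborel. F t) powr p)) \<longlonglongrightarrow> ennreal (norm (\<integral>t. F t \<partial>lborel) powr p)"
    using p by (intro tendsto_ennrealI tendsto_powr2 tendsto_norm lim tendsto_const) auto
  moreover have "ennreal (norm (\<Sum>j<N. LINT t:dyadic_shell j|lborel. F t) powr p) \<le> (\<Sum>j. ennreal (norm (LINT t:dyadic_shell j|lborel. F t) powr p))" for N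
  proof -
    have "ennreal (norm (\<Sum>j<N. LINT t:dyadic_shell j|lborel. F t) powr p) \<le> ennreal (\<Sum>j<N. norm (LINT t:dyadic_shell j|lborel. F t) powr p)"
      by (intro ennreal_leI norm_sum_powr_le p) auto
    also have "\<dots> = (\<Sum>j<N. ennreal (norm (LINT t:dyadic_shell j|lborel. F t) powr p))" by (simp add: sum_ennreal)
    also have "\<dots> \<le> (\<Sum>j. ennreal (norm (LINT t:dyadic_shell j|lborel. F t) powr p))"
      by (rule sum_le_suminf) auto
    finally show ?thesis .
  qed
  ultimately show ?thesis using LIMSEQ_le_const2 by blast
qed

definition br_symbol :: "real \<Rightarrow> real \<Rightarrow> complex"
  where "br_symbol \<alpha> t = exp (Complex 1 t) * Complex 1 t powr (- of_real (\<alpha> + 1))"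

lemma br_symbol_measurable [measurable]: "br_symbol \<alpha> \<in> borel_measurable borel"
  unfolding br_symbol_def by measurable

lemma norm_br_symbol: "norm (br_symbol \<alpha> t) = exp 1 * norm (Complex 1 t) powr (- (\<alpha> + 1))"
  by (simp add: br_symbol_def norm_mult norm_powr_real_powr')

lemma norm_br_symbol_le:
  assumes "0 < \<alpha>" shows "norm (br_symbol \<alpha> t) \<le> exp 1"
proof -
  have "norm (Complex 1 t) powr (- (\<alpha> + 1)) \<le> 1 powr (- (\<alpha> + 1))"
    using norm_Complex_1(3)[of t] assms by (intro powr_mono2') auto
  then show ?thesis by (simp add: norm_br_symbol)
qed

definition br_piece :: "real \<Rightarrow> nat \<Rightarrow> ('a::euclidean_space \<Rightarrow> complex) \<Rightarrow> ('a \<Rightarrow> complex) \<Rightarrow> 'a \<Rightarrow> complex"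
  where "br_piece \<alpha> j f g x = (LINT t:dyadic_shell j|lborel. br_symbol \<alpha> t * heat (Complex 1 t) f x * heat (Complex 1 t) g x)"

lemma br_piece_measurable [measurable]:
  assumes [measurable]: "f \<in> borel_measurable borel" "g \<in> borel_measurable borel"
  shows "br_piece \<alpha> j f g \<in> borel_measurable borel"
  unfolding br_piece_def set_lebesgue_integral_def by measurable

lemma br_piece_commute: "br_piece \<alpha> j f g x = br_piece \<alpha> j g f x"
  by (simp add: br_piece_def mult_ac)

lemma integrable_br_integrand:
  fixes f g :: "'a::euclidean_space \<Rightarrow> complex"
  assumes \<alpha>: "0 < \<alpha>" and f: "integrable lborel f" and g: "integrable lborel g"
  shows "integrable lborel (\<lambda>t. br_symbol \<alpha> t * heat (Complex 1 t) f x * heat (Complex 1 t) g x)"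
proof (rule Bochner_Integration.integrable_bound)
  have [measurable]: "f \<in> borel_measurable borel" "g \<in> borel_measurable borel" using f g by auto
  let ?a = "sqrt pi ^ DIM('a) * (\<integral>y. norm (f y) \<partial>lborel)" and ?b = "sqrt pi ^ DIM('a) * (\<integral>y. norm (g y) \<partial>lborel)"
  show "integrable lborel (\<lambda>t. norm (Complex 1 t) powr (- (\<alpha> + 1)) * (exp 1 * (?a * ?b)))"
    using integrable_norm_vertical_line_powr[of "\<alpha> + 1"] \<alpha> by (intro integrable_mult_left) auto
  show "(\<lambda>t. br_symbol \<alpha> t * heat (Complex 1 t) f x * heat (Complex 1 t) g x) \<in> borel_measurable lborel" by measurable
  show "AE t in lborel. norm (br_symbol \<alpha> t * heat (Complex 1 t) f x * heat (Complex 1 t) g x) \<le> norm (norm (Complex 1 t) powr (- (\<alpha> + 1)) * (exp 1 * (?a * ?b)))"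
  proof (rule AE_I2)
    fix t
    have "norm (br_symbol \<alpha> t * heat (Complex 1 t) f x * heat (Complex 1 t) g x) \<le> (exp 1 * norm (Complex 1 t) powr (- (\<alpha> + 1))) * ?a * ?b"
      unfolding norm_mult norm_br_symbol by (intro mult_mono norm_heat_le f g) auto
    also have "\<dots> = norm (Complex 1 t) powr (- (\<alpha> + 1)) * (exp 1 * (?a * ?b))" by (simp add: mult_ac)
    also have "\<dots> \<le> norm \<dots>" by simp
    finally show "norm (br_symbol \<alpha> t * heat (Complex 1 t) f x * heat (Complex 1 t) g x) \<le> norm (norm (Complex 1 t) powr (- (\<alpha> + 1)) * (exp 1 * (?a * ?b)))" .
  qed
qed

lemma set_integrable_br_integrand:
  fixes f g :: "'a::euclidean_space \<Rightarrow> complex"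
  assumes \<alpha>: "0 < \<alpha>" and f: "integrable lborel f" and g: "integrable lborel g"
  shows "set_integrable lborel (dyadic_shell j) (\<lambda>t. br_symbol \<alpha> t * heat (Complex 1 t) f x * heat (Complex 1 t) g x)"
  unfolding set_integrable_def
  by (intro integrable_mult_indicator integrable_br_integrand assms) auto

lemma br_piece_add:
  fixes f g h :: "'a::euclidean_space \<Rightarrow> complex"
  assumes \<alpha>: "0 < \<alpha>" and "integrable lborel f" "integrable lborel h" "integrable lborel g"
  shows "br_piece \<alpha> j (\<lambda>y. f y + h y) g x = br_piece \<alpha> j f g x + br_piece \<alpha> j h g x"
proof -
  have eq: "(\<lambda>t. br_symbol \<alpha> t * heat (Complex 1 t) (\<lambda>y. f y + h y) x * heat (Complex 1 t) g x)
    = (\<lambda>t. br_symbol \<alpha> t * heat (Complex 1 t) f x * heat (Complex 1 t) g x + br_symbol \<alpha> t * heat (Complex 1 t) h x * heat (Complex 1 t) g x)"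
    unfolding heat_add[OF assms(2,3)] by (simp add: distrib_left distrib_right)
  show ?thesis
    unfolding br_piece_def eq by (rule set_integral_add(2); rule set_integrable_br_integrand; fact)
qed

lemma br_piece_sum:
  fixes f :: "'i \<Rightarrow> 'a::euclidean_space \<Rightarrow> complex"
  assumes \<alpha>: "0 < \<alpha>" and K: "finite K" and f: "\<And>k. k \<in> K \<Longrightarrow> integrable lborel (f k)" and g: "integrable lborel g"
  shows "br_piece \<alpha> j (\<lambda>y. \<Sum>k\<in>K. f k y) g x = (\<Sum>k\<in>K. br_piece \<alpha> j (f k) g x)"
  using K f
proof induction
  case empty
  then show ?case by (simp add: br_piece_def heat_def)
next
  case (insert k K)
  then show ?case
    using br_piece_add[OF \<alpha>, of "f k" "\<lambda>y. \<Sum>k\<in>K. f k y" g j x] g by simp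
qed

text \<open>The two kernels carry \<open>csqrt\<close> twice, so the roots combine to the integer
  power (pi / z)^n and merge with the Laplace weight into the single exponent \<alpha> + 1 +
  n.\<close>

lemma br_symbol_heat_kernels:
  fixes u v :: "'a::euclidean_space"
  shows "br_symbol \<alpha> t * heat_kernel (Complex 1 t) u * heat_kernel (Complex 1 t) v
     = of_real (pi ^ DIM('a)) * kernel_integrand (\<alpha> + 1 + DIM('a)) (pi\<^sup>2 * ((norm u)\<^sup>2 + (norm v)\<^sup>2)) t"
proof -
  define z where "z = Complex 1 t"
  have z: "z \<noteq> 0" by (simp add: z_def)
  have "csqrt (of_real pi / z) ^ DIM('a) * csqrt (of_real pi / z) ^ DIM('a) = (of_real pi / z) ^ DIM('a)"
    unfolding power_mult_distrib[symmetric] unfolding power2_eq_square[symmetric] power2_csqrt ..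
  then have 1: "csqrt (of_real pi / z) ^ DIM('a) * csqrt (of_real pi / z) ^ DIM('a) = of_real (pi ^ DIM('a)) / z ^ DIM('a)"
    by (simp add: power_divide)
  have 2: "z powr (- of_real (\<alpha> + 1)) / z ^ DIM('a) = z powr (- of_real (\<alpha> + 1 + DIM('a)))"
  proof -
    have "z powr (- of_real (\<alpha> + 1 + DIM('a))) = z powr (- of_real (\<alpha> + 1) - of_nat DIM('a))" by (simp add: algebra_simps)
    also have "\<dots> = z powr (- of_real (\<alpha> + 1)) / z powr (of_nat DIM('a))" by (rule powr_diff)
    also have "z powr (of_nat DIM('a)) = z ^ DIM('a)" using z by (simp add: powr_nat')
    finally show ?thesis by simp
  qed
  have 3: "exp z * exp (- (of_real (pi\<^sup>2 * (norm u)\<^sup>2) / z)) * exp (- (of_real (pi\<^sup>2 * (norm v)\<^sup>2) / z))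
     = exp (z - of_real (pi\<^sup>2 * ((norm u)\<^sup>2 + (norm v)\<^sup>2)) / z)"
    unfolding exp_add[symmetric] by (simp add: algebra_simps add_divide_distrib)
  have "br_symbol \<alpha> t * heat_kernel z u * heat_kernel z v
    = (exp z * exp (- (of_real (pi\<^sup>2 * (norm u)\<^sup>2) / z)) * exp (- (of_real (pi\<^sup>2 * (norm v)\<^sup>2) / z)))
      * (z powr (- of_real (\<alpha> + 1)) * (csqrt (of_real pi / z) ^ DIM('a) * csqrt (of_real pi / z) ^ DIM('a)))"
    unfolding br_symbol_def heat_kernel_def z_def[symmetric] by (simp only: mult_ac)
  also have "z powr (- of_real (\<alpha> + 1)) * (csqrt (of_real pi / z) ^ DIM('a) * csqrt (of_real pi / z) ^ DIM('a))
    = of_real (pi ^ DIM('a)) * (z powr (- of_real (\<alpha> + 1)) / z ^ DIM('a))"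
    unfolding 1 by simp
  finally show ?thesis
    unfolding 2 3 kernel_integrand_def z_def[symmetric] by (simp only: mult_ac)
qed

definition piece_kernel_const :: "real \<Rightarrow> nat \<Rightarrow> real"
  where "piece_kernel_const \<alpha> n = pi ^ n * (160 * exp 1 * (\<alpha> + 1 + n + 2))"

lemma integrable_shell_const: "integrable lborel (\<lambda>t. indicator (dyadic_shell j) t * (c::real))"
proof -
  have "emeasure lborel (dyadic_shell j) < \<infinity>"
    using emeasure_dyadic_shell[of j] by (rule le_less_trans) simp
  then show ?thesis by (intro integrable_mult_left integrable_real_indicator) auto
qed

text \<open>After Fubini the kernel of the piece is a shell integral of
  \<open>kernel_integrand\<close>, whose bound does not involve the parameter \<open>A\<close> and
  hence none of the points x, y, y'. The exponent is 1/2 - \<beta> for \<beta> = \<alpha> + 1 +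
  n.\<close>

lemma norm_br_piece_le:
  fixes f g :: "'a::euclidean_space \<Rightarrow> complex"
  assumes \<alpha>: "0 < \<alpha>" and f: "integrable lborel f" and g: "integrable lborel g"
  shows "norm (br_piece \<alpha> j f g x) \<le> piece_kernel_const \<alpha> DIM('a) * (2 ^ j) powr (- \<alpha> - 1 / 2 - DIM('a))
     * (\<integral>y. norm (f y) \<partial>lborel) * (\<integral>y. norm (g y) \<partial>lborel)"
proof -
  have [measurable]: "f \<in> borel_measurable borel" "g \<in> borel_measurable borel" using f g by auto
  let ?J = "dyadic_shell j" and ?\<beta> = "\<alpha> + 1 + DIM('a)"
  let ?C = "piece_kernel_const \<alpha> DIM('a) * (2 ^ j) powr (- \<alpha> - 1 / 2 - DIM('a))"
  define F where "F p t = indicator ?J t *\<^sub>R (br_symbol \<alpha> t * (f (fst p) * heat_kernel (Complex 1 t) (x - fst p)) * (g (snd p) * heat_kernel (Complex 1 t) (x - snd p)))" for p t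
  have Fm [measurable]: "(\<lambda>(p, t). F p t) \<in> borel_measurable (lborel \<Otimes>\<^sub>M lborel)"
    unfolding F_def lborel_prod[symmetric] by measurable
  have b: "integrable lborel (\<lambda>p. norm (f (fst p)) * norm (g (snd p)))"
    unfolding lborel_prod[symmetric]
    by (rule lborel_pair.integrable_pair_bound[where a = "\<lambda>x. norm (f x)" and b = "\<lambda>x. norm (g x)"]) (use f g in auto)
  note symb = norm_br_symbol_le[OF \<alpha>]
  have intF: "integrable (lborel \<Otimes>\<^sub>M lborel) (\<lambda>(p, t). F p t)"
  proof (rule lborel_pair.integrable_pair_bound[OF Fm b integrable_shell_const[of j "exp 1 * (sqrt pi ^ DIM('a) * sqrt pi ^ DIM('a))"]])
    fix p :: "'a \<times> 'a" and t
    have "norm (F p t) \<le> indicator ?J t * (exp 1 * (norm (f (fst p)) * sqrt pi ^ DIM('a)) * (norm (g (snd p)) * sqrt pi ^ DIM('a)))"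
      unfolding F_def norm_scaleR norm_mult
      by (intro mult_mono symb norm_heat_kernel_le mult_nonneg_nonneg) (auto simp: indicator_def)
    then show "norm (case (p, t) of (p, t) \<Rightarrow> F p t) \<le> norm (f (fst p)) * norm (g (snd p)) * (indicator ?J t * (exp 1 * (sqrt pi ^ DIM('a) * sqrt pi ^ DIM('a))))"
      by (simp add: mult_ac)
  qed
  have inner: "(\<integral>p. F p t \<partial>lborel) = indicator ?J t *\<^sub>R (br_symbol \<alpha> t * heat (Complex 1 t) f x * heat (Complex 1 t) g x)" for t
  proof -
    have int: "integrable (lborel \<Otimes>\<^sub>M lborel) (\<lambda>p. F p t)"
    proof (rule lborel_pair.integrable_pair_bound)
      show "integrable lborel (\<lambda>y. norm (indicator ?J t *\<^sub>R br_symbol \<alpha> t) * norm (f y * heat_kernel (Complex 1 t) (x - y)))"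
        "integrable lborel (\<lambda>y. norm (g y * heat_kernel (Complex 1 t) (x - y)))"
        by (intro integrable_mult_right integrable_norm integrable_mult_heat_kernel f g)+
    qed (auto simp: F_def norm_mult mult_ac)
    have "(\<integral>p. F p t \<partial>lborel) = (\<integral>y. \<integral>y'. F (y, y') t \<partial>lborel \<partial>lborel)"
      using lborel_pair.integral_fst'[OF int] by (simp add: lborel_prod)
    also have "\<dots> = (\<integral>y. (indicator ?J t *\<^sub>R (br_symbol \<alpha> t * heat (Complex 1 t) g x)) * (f y * heat_kernel (Complex 1 t) (x - y)) \<partial>lborel)"
    proof (intro Bochner_Integration.integral_cong refl)
      fix y
      have "(\<integral>y'. F (y, y') t \<partial>lborel) = (\<integral>y'. (indicator ?J t *\<^sub>R (br_symbol \<alpha> t * (f y * heat_kernel (Complex 1 t) (x - y)))) * (g y' * heat_kernel (Complex 1 t) (x - y')) \<partial>lborel)"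
        by (intro Bochner_Integration.integral_cong refl) (simp add: F_def mult_ac)
      then show "(\<integral>y'. F (y, y') t \<partial>lborel) = (indicator ?J t *\<^sub>R (br_symbol \<alpha> t * heat (Complex 1 t) g x)) * (f y * heat_kernel (Complex 1 t) (x - y))"
        unfolding integral_mult_right_zero heat_def[symmetric] by (simp add: mult_ac)
    qed
    also have "\<dots> = indicator ?J t *\<^sub>R (br_symbol \<alpha> t * heat (Complex 1 t) f x * heat (Complex 1 t) g x)"
      unfolding integral_mult_right_zero heat_def[of _ f, symmetric] by (simp add: mult_ac)
    finally show ?thesis .
  qed
  have outer: "(\<integral>t. F p t \<partial>lborel) = f (fst p) * g (snd p) * (of_real (pi ^ DIM('a)) * (LINT t:?J|lborel. kernel_integrand ?\<beta> (pi\<^sup>2 * ((norm (x - fst p))\<^sup>2 + (norm (x - snd p))\<^sup>2)) t))" for p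
  proof -
    have "F p t = (f (fst p) * g (snd p) * of_real (pi ^ DIM('a))) * (indicator ?J t *\<^sub>R kernel_integrand ?\<beta> (pi\<^sup>2 * ((norm (x - fst p))\<^sup>2 + (norm (x - snd p))\<^sup>2)) t)" for t
    proof -
      have "F p t = (f (fst p) * g (snd p)) * (indicator ?J t *\<^sub>R (br_symbol \<alpha> t * heat_kernel (Complex 1 t) (x - fst p) * heat_kernel (Complex 1 t) (x - snd p)))"
        by (simp add: F_def mult_ac)
      then show ?thesis unfolding br_symbol_heat_kernels by (simp add: mult_ac)
    qed
    then show ?thesis by (simp only: integral_mult_right_zero set_lebesgue_integral_def mult.assoc)
  qed
  have C: "norm (of_real (pi ^ DIM('a)) * (LINT t:?J|lborel. kernel_integrand ?\<beta> (pi\<^sup>2 * ((norm (x - fst p))\<^sup>2 + (norm (x - snd p))\<^sup>2)) t)) \<le> ?C" for p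
  proof -
    have "norm (LINT t:?J|lborel. kernel_integrand ?\<beta> (pi\<^sup>2 * ((norm (x - fst p))\<^sup>2 + (norm (x - snd p))\<^sup>2)) t)
       \<le> 160 * exp 1 * (?\<beta> + 2) * (2 ^ j) powr (1 / 2 - ?\<beta>)"
      using \<alpha> by (intro shell_kernel_bound) auto
    then have "pi ^ DIM('a) * norm (LINT t:?J|lborel. kernel_integrand ?\<beta> (pi\<^sup>2 * ((norm (x - fst p))\<^sup>2 + (norm (x - snd p))\<^sup>2)) t)
       \<le> pi ^ DIM('a) * (160 * exp 1 * (?\<beta> + 2) * (2 ^ j) powr (1 / 2 - ?\<beta>))" by (intro mult_left_mono) auto
    moreover have "1 / 2 - ?\<beta> = - \<alpha> - 1 / 2 - DIM('a)" by simp
    ultimately show ?thesis by (simp only: norm_mult norm_of_real piece_kernel_const_def) (simp add: mult_ac)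
  qed
  have "br_piece \<alpha> j f g x = (\<integral>t. (\<integral>p. F p t \<partial>lborel) \<partial>lborel)"
    unfolding inner br_piece_def set_lebesgue_integral_def ..
  also have "\<dots> = (\<integral>p. (\<integral>t. F p t \<partial>lborel) \<partial>lborel)"
    by (rule lborel_pair.Fubini_integral[OF intF])
  also have "norm \<dots> \<le> (\<integral>p. (norm (f (fst p)) * norm (g (snd p))) * ?C \<partial>lborel)"
  proof (rule Bochner_Integration.integral_norm_bound_integral)
    show "integrable lborel (\<lambda>p. (\<integral>t. F p t \<partial>lborel))" by (rule lborel_pair.integrable_fst[OF intF])
    show "integrable lborel (\<lambda>p. norm (f (fst p)) * norm (g (snd p)) * ?C)" by (rule integrable_mult_left[OF b])
    show "norm (\<integral>t. F p t \<partial>lborel) \<le> norm (f (fst p)) * norm (g (snd p)) * ?C" for p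
      unfolding outer norm_mult[of "f _ * g _"] norm_mult[of "f _"] by (intro mult_left_mono C) auto
  qed
  also have "\<dots> = (\<integral>p. norm (f (fst p)) * norm (g (snd p)) \<partial>lborel) * ?C" by simp
  also have "(\<integral>p. norm (f (fst p)) * norm (g (snd p)) \<partial>lborel) = (\<integral>y. norm (f y) \<partial>lborel) * (\<integral>y. norm (g y) \<partial>lborel)"
    using lborel_pair.integral_fst'[of "\<lambda>p. norm (f (fst p)) * norm (g (snd p))"] b by (simp add: lborel_prod)
  finally show ?thesis by (simp add: mult_ac)
qed

text \<open>Cauchy-Schwarz in x for each t, followed by integration in t: the weight is R^(-\<alpha>
  - 1) and the shell has length about R. Assuming bounds on the energies rather than on L^2 norms
  lets Bernstein's inequality be inserted for either function.\<close>

lemma br_piece_L2_L2: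
  fixes f g :: "'a::euclidean_space \<Rightarrow> complex"
  assumes \<alpha>: "0 < \<alpha>" and f: "integrable lborel f" and g: "integrable lborel g" and ab: "0 \<le> a" "0 \<le> b"
    and fa: "\<And>t. heat_energy t f \<le> ennreal (a\<^sup>2)"
    and gb: "\<And>t. heat_energy t g \<le> ennreal (b\<^sup>2)"
  shows "(\<integral>\<^sup>+x. ennreal (norm (br_piece \<alpha> j f g x)) \<partial>lborel) \<le> ennreal (4 * exp 1 * (2 ^ j) powr (- \<alpha>) * a * b)"
proof -
  have [measurable]: "f \<in> borel_measurable borel" "g \<in> borel_measurable borel" using f g by auto
  let ?J = "dyadic_shell j"
  let ?u = "\<lambda>t x. norm (heat (Complex 1 t) f x)" and ?v = "\<lambda>t x. norm (heat (Complex 1 t) g x)"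
  define c where "c = exp 1 * (2 ^ j :: real) powr (- (\<alpha> + 1))"
  have symb: "norm (br_symbol \<alpha> t) \<le> c" if "t \<in> ?J" for t
    unfolding norm_br_symbol c_def using dyadic_shell_bounds(1)[OF that] \<alpha>
    by (intro mult_left_mono powr_mono2') auto
  have CS: "(\<integral>\<^sup>+x. ennreal (?u t x * ?v t x) \<partial>lborel) \<le> ennreal (a * b)" for t
    using nn_integral_Holder_powr[of "\<lambda>x. (?u t x)\<^sup>2" lborel "\<lambda>x. (?v t x)\<^sup>2" "1 / 2" "a\<^sup>2" "b\<^sup>2"] fa[of t] gb[of t] ab
    by (simp add: powr_half_sqrt)
  have "(\<integral>\<^sup>+x. ennreal (norm (br_piece \<alpha> j f g x)) \<partial>lborel) \<le> (\<integral>\<^sup>+x. \<integral>\<^sup>+t. indicator ?J t * (ennreal c * ennreal (?u t x * ?v t x)) \<partial>lborel \<partial>lborel)"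
  proof (intro nn_integral_mono)
    fix x
    have "ennreal (norm (br_piece \<alpha> j f g x)) \<le> (\<integral>\<^sup>+t. ennreal (norm (indicator ?J t *\<^sub>R (br_symbol \<alpha> t * heat (Complex 1 t) f x * heat (Complex 1 t) g x))) \<partial>lborel)"
      unfolding br_piece_def set_lebesgue_integral_def
      using set_integrable_br_integrand[OF \<alpha> f g, of j x] unfolding set_integrable_def
      by (rule integral_norm_bound_ennreal)
    also have "\<dots> \<le> (\<integral>\<^sup>+t. indicator ?J t * (ennreal c * ennreal (?u t x * ?v t x)) \<partial>lborel)"
    proof (intro nn_integral_mono)
      fix t
      show "ennreal (norm (indicator ?J t *\<^sub>R (br_symbol \<alpha> t * heat (Complex 1 t) f x * heat (Complex 1 t) g x))) \<le> indicator ?J t * (ennreal c * ennreal (?u t x * ?v t x))"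
      proof (cases "t \<in> ?J")
        case True
        have "norm (br_symbol \<alpha> t) * (?u t x * ?v t x) \<le> c * (?u t x * ?v t x)"
          using symb[OF True] by (intro mult_right_mono) auto
        then show ?thesis using True by (simp add: norm_mult mult.assoc ennreal_mult[symmetric] c_def)
      qed simp
    qed
    finally show "ennreal (norm (br_piece \<alpha> j f g x)) \<le> (\<integral>\<^sup>+t. indicator ?J t * (ennreal c * ennreal (?u t x * ?v t x)) \<partial>lborel)" .
  qed
  also have "\<dots> = (\<integral>\<^sup>+t. \<integral>\<^sup>+x. indicator ?J t * (ennreal c * ennreal (?u t x * ?v t x)) \<partial>lborel \<partial>lborel)"
    by (rule lborel_pair.Fubini') measurable
  also have "\<dots> = (\<integral>\<^sup>+t. indicator ?J t * (ennreal c * (\<integral>\<^sup>+x. ennreal (?u t x * ?v t x) \<partial>lborel)) \<partial>lborel)"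
    by (simp add: nn_integral_cmult)
  also have "\<dots> \<le> (\<integral>\<^sup>+t. indicator ?J t * (ennreal c * ennreal (a * b)) \<partial>lborel)"
    by (intro nn_integral_mono mult_left_mono CS) auto
  also have "\<dots> = (ennreal c * ennreal (a * b)) * emeasure lborel ?J"
    by (subst mult.commute) (simp add: nn_integral_cmult_indicator)
  also have "\<dots> \<le> (ennreal c * ennreal (a * b)) * ennreal (4 * 2 ^ j)"
    by (intro mult_left_mono emeasure_dyadic_shell) auto
  also have "\<dots> = ennreal (c * (a * b) * (4 * 2 ^ j))"
    using ab by (simp add: ennreal_mult[symmetric] c_def)
  also have "c * (a * b) * (4 * 2 ^ j) = 4 * exp 1 * (2 ^ j) powr (- \<alpha>) * a * b"
  proof -
    have "(2 ^ j :: real) powr (- (\<alpha> + 1)) * 2 ^ j = (2 ^ j) powr (- (\<alpha> + 1)) * (2 ^ j) powr 1" by simp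
    also have "\<dots> = (2 ^ j) powr (- \<alpha>)" unfolding powr_add[symmetric] by simp
    finally show ?thesis by (simp add: c_def mult_ac) 
  qed
  finally show ?thesis .
qed

section \<open>Representation of the bilinear means by heat flows\<close>

lemma heat_eq_fourier:
  fixes f :: "real ^ 'n \<Rightarrow> complex"
  assumes f: "integrable lborel f"
  shows "(\<integral>\<xi>. exp (- (Complex 1 t * of_real ((norm \<xi>)\<^sup>2))) * (fourier f \<xi> * exp (2 * of_real pi * \<i> * of_real (x \<bullet> \<xi>))) \<partial>lborel) = heat (Complex 1 t) f x"
proof -
  have [measurable]: "f \<in> borel_measurable borel" using f by auto
  define z where "z = Complex 1 t"
  \<comment> \<open>As Re z = 1, this is dominated by |f(y)| exp (- |\<xi>|^2), so integrability of
    \<open>f\<close> is enough to exchange the integrals.\<close>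
  define F where "F y \<xi> = f y * (exp (2 * of_real pi * \<i> * of_real ((x - y) \<bullet> \<xi>)) * exp (- (z * of_real ((norm \<xi>)\<^sup>2))))" for y \<xi> :: "real ^ 'n"
  have intF: "integrable (lborel \<Otimes>\<^sub>M lborel) (\<lambda>(y, \<xi>). F y \<xi>)"
  proof (rule lborel_pair.integrable_pair_bound)
    show "(\<lambda>(y, \<xi>). F y \<xi>) \<in> borel_measurable (lborel \<Otimes>\<^sub>M lborel)" unfolding F_def by measurable
    show "integrable lborel (\<lambda>y. norm (f y))" using f by simp
    show "integrable lborel (\<lambda>\<xi>::real ^ 'n. exp (- (1 * (norm \<xi>)\<^sup>2)))" by (rule nn_integral_gaussian(2)) simp
  qed (auto simp: F_def norm_mult norm_exp_eq_Re z_def)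
  have "(\<integral>\<xi>. exp (- (z * of_real ((norm \<xi>)\<^sup>2))) * (fourier f \<xi> * exp (2 * of_real pi * \<i> * of_real (x \<bullet> \<xi>))) \<partial>lborel)
     = (\<integral>\<xi>. \<integral>y. F y \<xi> \<partial>lborel \<partial>lborel)"
  proof (intro Bochner_Integration.integral_cong refl)
    fix \<xi> :: "real ^ 'n"
    have "F y \<xi> = (exp (- (z * of_real ((norm \<xi>)\<^sup>2))) * exp (2 * of_real pi * \<i> * of_real (x \<bullet> \<xi>))) * (f y * exp (- (2 * of_real pi * \<i> * of_real (y \<bullet> \<xi>))))" for y
    proof -
      have "exp (2 * of_real pi * \<i> * of_real ((x - y) \<bullet> \<xi>)) = exp (2 * of_real pi * \<i> * of_real (x \<bullet> \<xi>)) * exp (- (2 * of_real pi * \<i> * of_real (y \<bullet> \<xi>)))"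
        unfolding exp_add[symmetric] by (simp add: inner_diff_left algebra_simps)
      then show ?thesis unfolding F_def by (simp only: mult_ac)
    qed
    then have "(\<integral>y. F y \<xi> \<partial>lborel) = (exp (- (z * of_real ((norm \<xi>)\<^sup>2))) * exp (2 * of_real pi * \<i> * of_real (x \<bullet> \<xi>))) * fourier f \<xi>"
      by (simp only: integral_mult_right_zero fourier_def)
    then show "exp (- (z * of_real ((norm \<xi>)\<^sup>2))) * (fourier f \<xi> * exp (2 * of_real pi * \<i> * of_real (x \<bullet> \<xi>))) = (\<integral>y. F y \<xi> \<partial>lborel)"
      by (simp only: mult_ac)
  qed
  also have "\<dots> = (\<integral>y. \<integral>\<xi>. F y \<xi> \<partial>lborel \<partial>lborel)" by (rule lborel_pair.Fubini_integral[OF intF])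
  also have "\<dots> = heat z f x"
  proof -
    have "(\<integral>\<xi>. F y \<xi> \<partial>lborel) = f y * heat_kernel z (x - y)" for y
      using gaussian_fourier(2)[of z "x - y"] unfolding F_def integral_mult_right_zero by (simp add: z_def)
    then show ?thesis by (simp only: heat_def)
  qed
  finally show ?thesis by (simp only: z_def)
qed

lemma fourier_measurable [measurable]:
  fixes f :: "real ^ 'n \<Rightarrow> complex"
  assumes [measurable]: "f \<in> borel_measurable borel"
  shows "fourier f \<in> borel_measurable borel"
  unfolding fourier_def[abs_def] by measurable

lemma norm_fourier_le:
  fixes f :: "real ^ 'n \<Rightarrow> complex"
  shows "norm (fourier f \<xi>) \<le> (\<integral>y. norm (f y) \<partial>lborel)"
  unfolding fourier_def by (rule order_trans[OF integral_norm_bound]) (simp add: norm_mult norm_exp_eq_Re)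

text \<open>Insert the inversion formula at r = 1 - |\<xi>|^2 - |\<eta>|^2 and exchange the
  integrals: exp (z r) splits into exp z and the two heat multipliers. The exchange uses that
  Fourier transforms are bounded, that Re z = 1 supplies Gaussians in both frequencies, and that
  |z|^(-\<alpha> - 1) is integrable. Outside the ball \<open>max r 0 powr \<alpha>\<close> is
  0.\<close>

lemma bochner_riesz_eq:
  fixes f g :: "real ^ 'n \<Rightarrow> complex"
  assumes \<alpha>: "0 < \<alpha>" and f: "integrable lborel f" and g: "integrable lborel g"
  shows "bochner_riesz \<alpha> f g x = of_real (Gamma (\<alpha> + 1) / (2 * pi)) * (\<integral>t. br_symbol \<alpha> t * heat (Complex 1 t) f x * heat (Complex 1 t) g x \<partial>lborel)"
proof -
  have [measurable]: "f \<in> borel_measurable borel" "g \<in> borel_measurable borel" using f g by auto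
  have "Gamma (\<alpha> + 1) > 0" by (rule Gamma_real_pos) (use \<alpha> in simp)
  then have \<Gamma>: "Gamma (\<alpha> + 1) \<noteq> 0" by (rule less_imp_neq[symmetric])
  define c where "c = Gamma (\<alpha> + 1) / (2 * pi)"
  have c: "c * (2 * pi / Gamma (\<alpha> + 1)) = 1" using \<Gamma> by (simp add: c_def)
  define Hf where "Hf \<xi> = fourier f \<xi> * exp (2 * of_real pi * \<i> * of_real (x \<bullet> \<xi>))" for \<xi>
  define Hg where "Hg \<xi> = fourier g \<xi> * exp (2 * of_real pi * \<i> * of_real (x \<bullet> \<xi>))" for \<xi>
  have [measurable]: "Hf \<in> borel_measurable borel" "Hg \<in> borel_measurable borel"
    unfolding Hf_def Hg_def by measurable
  define q where "q t \<xi> = exp (- (Complex 1 t * of_real ((norm (\<xi>::real ^ 'n))\<^sup>2)))" for t \<xi>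
  define F where "F p t = br_symbol \<alpha> t * ((q t (fst p) * Hf (fst p)) * (q t (snd p) * Hg (snd p)))" for p t
  have nf: "norm (q t \<xi> * Hf \<xi>) \<le> (\<integral>y. norm (f y) \<partial>lborel) * exp (- (1 * (norm \<xi>)\<^sup>2))" for t \<xi>
    using norm_fourier_le[of f \<xi>] by (simp add: q_def Hf_def norm_mult norm_exp_eq_Re mult.commute mult_right_mono)
  have ng: "norm (q t \<xi> * Hg \<xi>) \<le> (\<integral>y. norm (g y) \<partial>lborel) * exp (- (1 * (norm \<xi>)\<^sup>2))" for t \<xi>
    using norm_fourier_le[of g \<xi>] by (simp add: q_def Hg_def norm_mult norm_exp_eq_Re mult.commute mult_right_mono)
  have ig: "integrable lborel (\<lambda>\<xi>::real ^ 'n. c * exp (- (1 * (norm \<xi>)\<^sup>2)))" for c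
    by (intro integrable_mult_right nn_integral_gaussian(2)) simp
  have ib: "integrable (lborel \<Otimes>\<^sub>M lborel) (\<lambda>p. ((\<integral>y. norm (f y) \<partial>lborel) * exp (- (1 * (norm (fst p :: real ^ 'n))\<^sup>2))) * ((\<integral>y. norm (g y) \<partial>lborel) * exp (- (1 * (norm (snd p :: real ^ 'n))\<^sup>2))))"
    by (rule lborel_pair.integrable_pair_bound[OF _ ig ig]) auto
  have intF: "integrable (lborel \<Otimes>\<^sub>M lborel) (\<lambda>(p, t). F p t)"
  proof (rule lborel_pair.integrable_pair_bound)
    show "(\<lambda>(p, t). F p t) \<in> borel_measurable (lborel \<Otimes>\<^sub>M lborel)"
      unfolding F_def q_def lborel_prod[symmetric] by measurable
    show "integrable lborel (\<lambda>p. ((\<integral>y. norm (f y) \<partial>lborel) * exp (- (1 * (norm (fst p :: real ^ 'n))\<^sup>2))) * ((\<integral>y. norm (g y) \<partial>lborel) * exp (- (1 * (norm (snd p :: real ^ 'n))\<^sup>2))))"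
      using ib by (simp only: lborel_prod)
    show "integrable lborel (\<lambda>t. exp 1 * norm (Complex 1 t) powr (- (\<alpha> + 1)))"
      using \<alpha> by (intro integrable_mult_right integrable_norm_vertical_line_powr) simp
    fix p :: "(real ^ 'n) \<times> (real ^ 'n)" and t
    have "norm (F p t) \<le> (exp 1 * norm (Complex 1 t) powr (- (\<alpha> + 1))) * (((\<integral>y. norm (f y) \<partial>lborel) * exp (- (1 * (norm (fst p))\<^sup>2))) * ((\<integral>y. norm (g y) \<partial>lborel) * exp (- (1 * (norm (snd p))\<^sup>2))))"
      unfolding F_def norm_mult[of "br_symbol _ _"] norm_mult[of "q t (fst p) * _"] norm_br_symbol
      by (intro mult_left_mono mult_mono nf ng) auto
    then show "norm (case (p, t) of (p, t) \<Rightarrow> F p t) \<le> (((\<integral>y. norm (f y) \<partial>lborel) * exp (- (1 * (norm (fst p))\<^sup>2))) * ((\<integral>y. norm (g y) \<partial>lborel) * exp (- (1 * (norm (snd p))\<^sup>2)))) * (exp 1 * norm (Complex 1 t) powr (- (\<alpha> + 1)))"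
      by (simp add: mult.commute)
  qed
  have inner: "(\<integral>t. F p t \<partial>lborel) = of_real (2 * pi / Gamma (\<alpha> + 1) * max (1 - (norm (fst p))\<^sup>2 - (norm (snd p))\<^sup>2) 0 powr \<alpha>) * (Hf (fst p) * Hg (snd p))" for p
  proof -
    define r where "r = 1 - (norm (fst p))\<^sup>2 - (norm (snd p))\<^sup>2"
    have "F p t = (exp (Complex 1 t * of_real r) * Complex 1 t powr (- of_real (\<alpha> + 1))) * (Hf (fst p) * Hg (snd p))" for t
    proof -
      have "F p t = (exp (Complex 1 t) * q t (fst p) * q t (snd p)) * (Complex 1 t powr (- of_real (\<alpha> + 1)) * (Hf (fst p) * Hg (snd p)))"
        unfolding F_def br_symbol_def by (simp only: mult_ac)
      also have "exp (Complex 1 t) * q t (fst p) * q t (snd p) = exp (Complex 1 t * of_real r)"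
        unfolding q_def exp_add[symmetric] r_def by (simp add: algebra_simps)
      finally show ?thesis by (simp only: mult.assoc)
    qed
    then show ?thesis
      by (simp only: integral_mult_left_zero laplace_inversion_powr[OF \<alpha>] r_def)
  qed
  have outer: "(\<integral>p. F p t \<partial>lborel) = br_symbol \<alpha> t * heat (Complex 1 t) f x * heat (Complex 1 t) g x" for t
  proof -
    have int: "integrable (lborel \<Otimes>\<^sub>M lborel) (\<lambda>p. (q t (fst p) * Hf (fst p)) * (q t (snd p) * Hg (snd p)))"
    proof (rule lborel_pair.integrable_pair_bound[OF _ ig ig])
      show "(\<lambda>p. (q t (fst p) * Hf (fst p)) * (q t (snd p) * Hg (snd p))) \<in> borel_measurable (lborel \<Otimes>\<^sub>M lborel)"
        unfolding q_def by measurable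
      show "norm ((q t (fst (\<xi>, \<eta>)) * Hf (fst (\<xi>, \<eta>))) * (q t (snd (\<xi>, \<eta>)) * Hg (snd (\<xi>, \<eta>)))) \<le> ((\<integral>y. norm (f y) \<partial>lborel) * exp (- (1 * (norm \<xi>)\<^sup>2))) * ((\<integral>y. norm (g y) \<partial>lborel) * exp (- (1 * (norm \<eta>)\<^sup>2)))" for \<xi> \<eta>
        unfolding fst_conv snd_conv norm_mult[of "q t \<xi> * Hf \<xi>"] by (intro mult_mono nf ng) auto
    qed
    have "(\<integral>p. F p t \<partial>lborel) = br_symbol \<alpha> t * (\<integral>p. (q t (fst p) * Hf (fst p)) * (q t (snd p) * Hg (snd p)) \<partial>lborel)"
      by (simp only: F_def integral_mult_right_zero)
    also have "(\<integral>p. (q t (fst p) * Hf (fst p)) * (q t (snd p) * Hg (snd p)) \<partial>lborel) = (\<integral>\<xi>. \<integral>\<eta>. (q t \<xi> * Hf \<xi>) * (q t \<eta> * Hg \<eta>) \<partial>lborel \<partial>lborel)"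
      using lborel_pair.integral_fst'[OF int] by (simp add: lborel_prod)
    also have "\<dots> = heat (Complex 1 t) f x * heat (Complex 1 t) g x"
      unfolding heat_eq_fourier[OF f, symmetric] heat_eq_fourier[OF g, symmetric] Hf_def[symmetric] Hg_def[symmetric] q_def[symmetric]
      by simp
    finally show ?thesis by (simp only: mult.assoc)
  qed
  have "bochner_riesz \<alpha> f g x = (\<integral>p. c * (\<integral>t. F p t \<partial>lborel) \<partial>lborel)"
    unfolding bochner_riesz_def set_lebesgue_integral_def lborel_prod
  proof (intro Bochner_Integration.integral_cong refl)
    fix p :: "(real ^ 'n) \<times> (real ^ 'n)"
    obtain \<xi> \<eta> where p: "p = (\<xi>, \<eta>)" by force
    define r where "r = 1 - (norm \<xi>)\<^sup>2 - (norm \<eta>)\<^sup>2"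
    have "indicator {(\<xi>, \<eta>). (norm \<xi>)\<^sup>2 + (norm \<eta>)\<^sup>2 \<le> 1} p *\<^sub>R (case p of (\<xi>, \<eta>) \<Rightarrow> of_real ((1 - (norm \<xi>)\<^sup>2 - (norm \<eta>)\<^sup>2) powr \<alpha>) * fourier f \<xi> * fourier g \<eta>
       * exp (2 * of_real pi * \<i> * of_real (x \<bullet> (\<xi> + \<eta>)))) = of_real (max r 0 powr \<alpha>) * (fourier f \<xi> * fourier g \<eta>
       * exp (2 * of_real pi * \<i> * of_real (x \<bullet> (\<xi> + \<eta>))))"
    proof (cases "0 \<le> r")
      case True
      then have "p \<in> {(\<xi>, \<eta>). (norm \<xi>)\<^sup>2 + (norm \<eta>)\<^sup>2 \<le> 1}" by (simp add: p r_def)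
      then show ?thesis using True by (simp add: p r_def[symmetric] mult.assoc)
    next
      case False
      then have "p \<notin> {(\<xi>, \<eta>). (norm \<xi>)\<^sup>2 + (norm \<eta>)\<^sup>2 \<le> 1}" by (simp add: p r_def)
      then show ?thesis using False \<alpha> by simp
    qed
    also have "exp (2 * of_real pi * \<i> * of_real (x \<bullet> (\<xi> + \<eta>))) = exp (2 * of_real pi * \<i> * of_real (x \<bullet> \<xi>)) * exp (2 * of_real pi * \<i> * of_real (x \<bullet> \<eta>))"
      unfolding exp_add[symmetric] by (simp add: inner_add_right algebra_simps)
    also have "of_real (max r 0 powr \<alpha>) * (fourier f \<xi> * fourier g \<eta> * (exp (2 * of_real pi * \<i> * of_real (x \<bullet> \<xi>)) * exp (2 * of_real pi * \<i> * of_real (x \<bullet> \<eta>))))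
       = of_real (c * (2 * pi / Gamma (\<alpha> + 1))) * (of_real (max r 0 powr \<alpha>) * (Hf \<xi> * Hg \<eta>))"
      unfolding c Hf_def Hg_def by (simp add: mult_ac)
    also have "\<dots> = c * (\<integral>t. F p t \<partial>lborel)"
      unfolding inner by (simp only: p fst_conv snd_conv r_def of_real_mult mult.assoc)
    finally show "indicator {(\<xi>, \<eta>). (norm \<xi>)\<^sup>2 + (norm \<eta>)\<^sup>2 \<le> 1} p *\<^sub>R (case p of (\<xi>, \<eta>) \<Rightarrow> of_real ((1 - (norm \<xi>)\<^sup>2 - (norm \<eta>)\<^sup>2) powr \<alpha>) * fourier f \<xi> * fourier g \<eta>
       * exp (2 * of_real pi * \<i> * of_real (x \<bullet> (\<xi> + \<eta>)))) = c * (\<integral>t. F p t \<partial>lborel)" .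
  qed
  also have "\<dots> = of_real c * (\<integral>t. (\<integral>p. F p t \<partial>lborel) \<partial>lborel)"
    unfolding integral_mult_right_zero lborel_pair.Fubini_integral[OF intF] ..
  finally show ?thesis unfolding outer c_def .
qed

section \<open>Local estimates\<close>

text \<open>Bernstein's inequality takes \<open>f\<close> to L^2 without a power of R; only
  \<open>g\<close>, whose exponent is at least 2, pays a power of the volume of its support for
  being placed in L^2.\<close>

lemma br_piece_local_mixed:
  fixes f g :: "'a::euclidean_space \<Rightarrow> complex"
  assumes \<alpha>: "0 < \<alpha>" and f: "integrable lborel f" and g: "integrable lborel g"
    and p: "1 \<le> p" "p \<le> 2" and q: "2 \<le> q" and AB: "0 < A" "0 < B"
    and fA: "Lp_mass p f \<le> ennreal (A powr p)"
    and gB: "Lp_mass q g \<le> ennreal (B powr q)"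
    and D: "D \<in> sets borel" "emeasure lborel D \<le> ennreal V" "0 \<le> V" and supp: "\<And>y. y \<notin> D \<Longrightarrow> g y = 0"
  shows "(\<integral>\<^sup>+x. ennreal (norm (br_piece \<alpha> j f g x)) \<partial>lborel)
    \<le> ennreal (4 * exp 1 * (2 ^ j) powr (- \<alpha>) * (bernstein_const TYPE('a) * A) * (V powr (1 / 2 - 1 / q) * B))"
proof (rule br_piece_L2_L2[OF \<alpha> f g])
  have [measurable]: "f \<in> borel_measurable borel" "g \<in> borel_measurable borel" "D \<in> sets borel" using f g D by auto
  show "0 \<le> bernstein_const TYPE('a) * A" "0 \<le> V powr (1 / 2 - 1 / q) * B"
    using AB bernstein_const_ge(1)[where 'a = 'a] by auto
  show "heat_energy t f \<le> ennreal ((bernstein_const TYPE('a) * A)\<^sup>2)" for t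
    by (rule heat_Lp_L2[OF f p AB(1) fA])
  \<comment> \<open>Hoelder with \<theta> = 2 / q against the indicator of \<open>D\<close>. For q =
    2 the indicator factor still vanishes outside \<open>D\<close>, by \<open>0 powr 0 = 0\<close>,
    in agreement with \<open>g\<close>.\<close>
  have "(\<integral>\<^sup>+x. ennreal ((norm (g x))\<^sup>2) \<partial>lborel) = (\<integral>\<^sup>+x. ennreal ((norm (g x) powr q) powr (2 / q) * (indicator D x) powr (1 - 2 / q)) \<partial>lborel)"
    using q supp by (intro nn_integral_cong) (auto simp: powr_powr indicator_def)
  also have "\<dots> \<le> ennreal ((B powr q) powr (2 / q) * V powr (1 - 2 / q))"
    using q gB D by (intro nn_integral_Holder_powr) (auto simp: ennreal_indicator)
  also have "(B powr q) powr (2 / q) * V powr (1 - 2 / q) = (V powr (1 / 2 - 1 / q) * B)\<^sup>2"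
  proof -
    have "(V powr (1 / 2 - 1 / q))\<^sup>2 = V powr (1 - 2 / q)"
      unfolding power2_eq_square powr_add[symmetric] by simp
    then show ?thesis using AB q by (simp add: powr_powr power_mult_distrib)
  qed
  finally have "(\<integral>\<^sup>+x. ennreal ((norm (g x))\<^sup>2) \<partial>lborel) \<le> ennreal ((V powr (1 / 2 - 1 / q) * B)\<^sup>2)" .
  then show "heat_energy t g \<le> ennreal ((V powr (1 / 2 - 1 / q) * B)\<^sup>2)" for t
    using heat_L2_L2[OF g, of t] by (rule order_trans[rotated])
qed

text \<open>The top level k = 0 has no upper cut: values above \<open>A\<close> are controlled in
  L^1 whatever their size. The other levels are dyadic slices below \<open>A\<close>.\<close>

definition level_part :: "real \<Rightarrow> nat \<Rightarrow> ('a \<Rightarrow> complex) \<Rightarrow> 'a \<Rightarrow> complex"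
  where "level_part A k f y = (if A / 2 ^ k < norm (f y) \<and> (k = 0 \<or> norm (f y) \<le> 2 * (A / 2 ^ k)) then f y else 0)"

lemma sum_level_part:
  assumes "0 < A"
  shows "(\<Sum>k\<le>N. level_part A k f y) = (if A / 2 ^ N < norm (f y) then f y else 0)"
proof (induction N)
  case (Suc N)
  have "A / 2 ^ Suc N < A / 2 ^ N" using assms by (simp add: field_simps)
  moreover have "2 * (A / 2 ^ Suc N) = A / 2 ^ N" by simp
  ultimately show ?case
    using Suc by (auto simp: level_part_def simp del: power_Suc)
qed (simp add: level_part_def)

lemma level_part_measurable [measurable]:
  assumes [measurable]: "f \<in> borel_measurable M"
  shows "level_part A k f \<in> borel_measurable M"
  unfolding level_part_def[abs_def] by measurable

lemma level_part_integrable: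
  fixes f :: "'a::euclidean_space \<Rightarrow> complex"
  assumes f: "integrable lborel f"
  shows "integrable lborel (level_part A k f)"
proof -
  have [measurable]: "f \<in> borel_measurable borel" using f by auto
  show ?thesis by (rule Bochner_Integration.integrable_bound[OF f]) (auto simp: level_part_def)
qed

text \<open>On a slice of height m Chebyshev's inequality bounds the measure by (A / m)^p, so the
  L^1 and L^2 norms are at most about m^(1-p) A^p and m^(1-p/2) A^(p/2). The weights satisfy 1/q =
  \<theta> + (1 - \<theta>)/2 for \<theta> = 2/q - 1, and the weighted product is m^(1-p/q) A^(p/q),
  which is at most A. Thus one q serves for both functions although \<open>f\<close> is only in
  L^p.\<close>

lemma level_part_bounds:
  fixes f :: "'a::euclidean_space \<Rightarrow> complex"
  assumes f: "integrable lborel f" and pq: "1 \<le> p" "p \<le> q" "q \<le> 2" and A: "0 < A"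
    and fA: "Lp_mass p f \<le> ennreal (A powr p)"
  obtains a b where "0 \<le> a" "0 \<le> b" "(\<integral>\<^sup>+x. ennreal (norm (level_part A k f x)) \<partial>lborel) \<le> ennreal a"
    "\<And>t. heat_energy t (level_part A k f) \<le> ennreal (b\<^sup>2)"
    "a powr (2 / q - 1) * b powr (2 - 2 / q) \<le> 2 * bernstein_const TYPE('a) * A"
proof -
  have [measurable]: "f \<in> borel_measurable borel" using f by auto
  define K where "K = bernstein_const TYPE('a)"
  have K: "1 \<le> K" "sqrt (pi / 2) ^ DIM('a) \<le> K\<^sup>2" using bernstein_const_ge[where 'a = 'a] by (auto simp: K_def)
  let ?\<theta> = "2 / q - 1"
  have \<theta>: "0 \<le> ?\<theta>" "?\<theta> \<le> 1" using pq by (auto simp: field_simps)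
  have compl: "2 - 2 / q = 1 - ?\<theta>" by simp
  define m where "m = A / 2 ^ k"
  have m: "0 < m" "m \<le> A" using A by (auto simp: m_def field_simps)
  note int = level_part_integrable[OF f, of A k]
  show ?thesis
  proof (cases "k = 0")
    case True
    have "level_part A k f = (\<lambda>x. if A < norm (f x) then f x else 0)"
      using True by (simp add: level_part_def fun_eq_iff)
    then have 1: "(\<integral>\<^sup>+x. ennreal (norm (level_part A k f x)) \<partial>lborel) \<le> ennreal A"
      using nn_integral_large_values[OF _ pq(1) A fA] by simp
    show ?thesis
    proof (rule that[of A "K * A"])
      show "heat_energy t (level_part A k f) \<le> ennreal ((K * A)\<^sup>2)" for t
        using A K(2) by (intro order_trans[OF heat_L1_L2[OF int _ 1]] ennreal_leI) (auto simp: power_mult_distrib mult_right_mono)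
      have "A powr ?\<theta> * (K * A) powr (1 - ?\<theta>) = K powr (1 - ?\<theta>) * (A powr ?\<theta> * A powr (1 - ?\<theta>))"
        using A K by (simp add: powr_mult mult_ac)
      also have "A powr ?\<theta> * A powr (1 - ?\<theta>) = A" unfolding powr_add[symmetric] using A by simp
      also have "K powr (1 - ?\<theta>) * A \<le> K powr 1 * A"
        using K \<theta> A by (intro mult_right_mono powr_mono) auto
      also have "\<dots> \<le> 2 * K * A" using K A by simp
      finally show "A powr (2 / q - 1) * (K * A) powr (2 - 2 / q) \<le> 2 * bernstein_const TYPE('a) * A"
        unfolding compl K_def .
    qed (use 1 A K in auto)
  next
    case False
    \<comment> \<open>The leading 2 in \<open>a\<close> and \<open>b\<close> is the ratio of the
      largest to the smallest value on the slice.\<close>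
    define a where "a = 2 * m powr (1 - p) * A powr p"
    define b where "b = 2 * m powr (1 - p / 2) * A powr (p / 2)"
    have level: "norm (level_part A k f x) \<noteq> 0 \<Longrightarrow> m < norm (f x) \<and> norm (f x) \<le> 2 * m \<and> level_part A k f x = f x" for x
      using False by (auto simp: level_part_def m_def)
    have ratio: "1 \<le> m powr (- p) * norm (f x) powr p" if "m < norm (f x)" for x
    proof -
      have "1 \<le> (norm (f x) / m) powr p" using that m pq by (intro ge_one_powr_ge_zero) auto
      then show ?thesis using that m by (simp add: powr_divide powr_minus field_simps)
    qed
    have 1: "(\<integral>\<^sup>+x. ennreal (norm (level_part A k f x)) \<partial>lborel) \<le> ennreal a"
    proof -
      have "(\<integral>\<^sup>+x. ennreal (norm (level_part A k f x)) \<partial>lborel) \<le> (\<integral>\<^sup>+x. ennreal (2 * m powr (1 - p)) * ennreal (norm (f x) powr p) \<partial>lborel)"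
      proof (intro nn_integral_mono)
        fix x
        have "norm (level_part A k f x) \<le> 2 * m powr (1 - p) * norm (f x) powr p"
        proof (cases "norm (level_part A k f x) = 0")
          case False
          note l = level[OF False]
          have "norm (level_part A k f x) \<le> 2 * m * 1" using l by simp
          also have "\<dots> \<le> 2 * m * (m powr (- p) * norm (f x) powr p)"
            using m ratio l by (intro mult_left_mono) auto
          also have "\<dots> = 2 * (m powr 1 * m powr (- p)) * norm (f x) powr p" using m by simp
          finally show ?thesis unfolding powr_add[symmetric] by simp
        qed simp
        then show "ennreal (norm (level_part A k f x)) \<le> ennreal (2 * m powr (1 - p)) * ennreal (norm (f x) powr p)"
          by (simp add: ennreal_mult'[symmetric])
      qed
      also have "\<dots> \<le> ennreal (2 * m powr (1 - p)) * ennreal (A powr p)"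
        by (simp add: nn_integral_cmult mult_left_mono fA)
      also have "\<dots> = ennreal a" by (simp add: ennreal_mult'[symmetric] a_def)
      finally show ?thesis .
    qed
    have 2: "(\<integral>\<^sup>+x. ennreal ((norm (level_part A k f x))\<^sup>2) \<partial>lborel) \<le> ennreal (b\<^sup>2)"
    proof -
      have "(\<integral>\<^sup>+x. ennreal ((norm (level_part A k f x))\<^sup>2) \<partial>lborel) \<le> (\<integral>\<^sup>+x. ennreal (4 * m powr (2 - p)) * ennreal (norm (f x) powr p) \<partial>lborel)"
      proof (intro nn_integral_mono)
        fix x
        have "(norm (level_part A k f x))\<^sup>2 \<le> 4 * m powr (2 - p) * norm (f x) powr p"
        proof (cases "norm (level_part A k f x) = 0")
          case False
          note l = level[OF False]
          have "(norm (level_part A k f x))\<^sup>2 \<le> (2 * m)\<^sup>2" using l by (intro power_mono) auto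
          also have "\<dots> = 4 * m\<^sup>2 * 1" by (simp add: power_mult_distrib)
          also have "\<dots> \<le> 4 * m\<^sup>2 * (m powr (- p) * norm (f x) powr p)"
            using m ratio l by (intro mult_left_mono) auto
          also have "\<dots> = 4 * (m powr 2 * m powr (- p)) * norm (f x) powr p" using m by simp
          finally show ?thesis unfolding powr_add[symmetric] by simp
        qed simp
        then show "ennreal ((norm (level_part A k f x))\<^sup>2) \<le> ennreal (4 * m powr (2 - p)) * ennreal (norm (f x) powr p)"
          by (simp add: ennreal_mult'[symmetric])
      qed
      also have "\<dots> \<le> ennreal (4 * m powr (2 - p)) * ennreal (A powr p)"
        by (simp add: nn_integral_cmult mult_left_mono fA)
      also have "\<dots> = ennreal (b\<^sup>2)"
      proof -
        have "(m powr (1 - p / 2))\<^sup>2 = m powr (2 - p)" "(A powr (p / 2))\<^sup>2 = A powr p"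
          unfolding power2_eq_square powr_add[symmetric] by simp_all
        then show ?thesis by (simp add: ennreal_mult'[symmetric] b_def power_mult_distrib)
      qed
      finally show ?thesis .
    qed
    show ?thesis
    proof (rule that[of a b])
      show "heat_energy t (level_part A k f) \<le> ennreal (b\<^sup>2)" for t
        by (rule order_trans[OF heat_L2_L2[OF int] 2])
      have e1: "(1 - p) * ?\<theta> + (1 - p / 2) * (1 - ?\<theta>) = 1 - p / q" "p * ?\<theta> + p / 2 * (1 - ?\<theta>) = p / q"
        using pq by (simp_all add: field_simps)
      have "a powr ?\<theta> * b powr (1 - ?\<theta>) = (2 powr ?\<theta> * 2 powr (1 - ?\<theta>)) * (m powr ((1 - p) * ?\<theta>) * m powr ((1 - p / 2) * (1 - ?\<theta>))) * (A powr (p * ?\<theta>) * A powr (p / 2 * (1 - ?\<theta>)))"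
        using A m by (simp add: a_def b_def powr_mult powr_powr)
      also have "\<dots> = 2 * m powr (1 - p / q) * A powr (p / q)"
        unfolding powr_add[symmetric] e1 by simp
      \<comment> \<open>The height is traded for \<open>A\<close>; the direction is right because p
        <= q makes the exponent nonnegative and m <= A.\<close>
      also have "\<dots> \<le> 2 * A powr (1 - p / q) * A powr (p / q)"
        using m A pq by (intro mult_right_mono mult_left_mono powr_mono2) auto
      also have "\<dots> = 2 * A" using A by (simp add: mult.assoc powr_add[symmetric])
      also have "\<dots> \<le> 2 * K * A" using K A by simp
      finally show "a powr (2 / q - 1) * b powr (2 - 2 / q) \<le> 2 * bernstein_const TYPE('a) * A" unfolding compl K_def .
    qed (use 1 m A in \<open>auto simp: a_def b_def\<close>)
  qed
qed

text \<open>The interpolation step of Region II: on a pair of level sets both estimates hold for the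
  same number, so it is bounded by their weighted geometric mean.\<close>

lemma le_powr_mult_powr:
  fixes s x y \<theta> :: real
  assumes "0 \<le> s" "s \<le> x" "s \<le> y" "0 \<le> \<theta>" "\<theta> \<le> 1"
  shows "s \<le> x powr \<theta> * y powr (1 - \<theta>)"
proof -
  have "s = s powr \<theta> * s powr (1 - \<theta>)" using assms(1) by (cases "s = 0") (simp_all add: powr_add[symmetric])
  also have "\<dots> \<le> x powr \<theta> * y powr (1 - \<theta>)" using assms by (intro mult_mono powr_mono2) auto
  finally show ?thesis .
qed

text \<open>The sum over the \<open>N + 1\<close> levels of each function loses the factor \<open>(N + 1)\<^sup>2\<close>; values below
  \<open>A / 2^N\<close> resp. \<open>B / 2^N\<close> are absorbed in the last term. With \<open>N\<close> a large multiple of \<open>j\<close> the loss is a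
  power of \<open>log R\<close>.\<close>

lemma br_piece_local_diagonal:
  fixes f g :: "'a::euclidean_space \<Rightarrow> complex" and j N :: nat
  assumes \<alpha>: "0 < \<alpha>" and f: "integrable lborel f" and g: "integrable lborel g"
    and pq: "1 \<le> p" "p \<le> q" "q \<le> 2" and AB: "0 < A" "0 < B"
    and fA: "Lp_mass p f \<le> ennreal (A powr p)"
    and gB: "Lp_mass q g \<le> ennreal (B powr q)"
    and D: "D \<in> sets borel" "emeasure lborel D \<le> ennreal V" "0 \<le> V"
    and supp: "\<And>y. y \<notin> D \<Longrightarrow> f y = 0" "\<And>y. y \<notin> D \<Longrightarrow> g y = 0"
    and X: "X \<in> sets borel" "emeasure lborel X \<le> ennreal W" "0 \<le> W"
  defines "Y\<^sub>1 \<equiv> W * (piece_kernel_const \<alpha> DIM('a) * (2 ^ j) powr (- \<alpha> - 1 / 2 - DIM('a)))"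
    and "Y\<^sub>2 \<equiv> 4 * exp 1 * (2 ^ j) powr (- \<alpha>)"
    and "K \<equiv> bernstein_const TYPE('a)"
  shows "(\<integral>\<^sup>+x. indicator X x * ennreal (norm (br_piece \<alpha> j f g x)) \<partial>lborel)
    \<le> ennreal (((real N + 1)\<^sup>2 * (4 * K\<^sup>2) * (Y\<^sub>1 powr (2 / q - 1) * Y\<^sub>2 powr (2 - 2 / q)) + 2 * Y\<^sub>2 * K * sqrt V / 2 ^ N) * A * B)"
proof -
  have [measurable]: "f \<in> borel_measurable borel" "g \<in> borel_measurable borel" "D \<in> sets borel" "X \<in> sets borel" using f g D X by auto
  let ?T = "br_piece \<alpha> j"
  let ?I = "\<lambda>h. (\<integral>\<^sup>+x. indicator X x * ennreal (norm (h x :: complex)) \<partial>lborel)"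
  have K: "1 \<le> K" using bernstein_const_ge(1)[where 'a = 'a] by (simp add: K_def)
  have kc: "0 \<le> piece_kernel_const \<alpha> DIM('a)" using \<alpha> by (simp add: piece_kernel_const_def)
  have Y: "0 \<le> Y\<^sub>1" "0 \<le> Y\<^sub>2" using X kc by (auto simp: Y\<^sub>1_def Y\<^sub>2_def)
  have q\<theta>: "0 \<le> 2 / q - 1" "2 / q - 1 \<le> 1" using pq by (auto simp: field_simps)
  \<comment> \<open>Values below all levels. On the support of volume at most \<open>V\<close> they
    are so small that their L^2 norm is at most \<open>C / 2 ^ N * sqrt V\<close>.\<close>
  define rest where "rest = (\<lambda>C (h :: 'a \<Rightarrow> complex) y. if norm (h y) \<le> C / 2 ^ N then h y else 0)"
  have rest_int: "integrable lborel (rest C h)" if h: "integrable lborel h" for C h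
  proof -
    have [measurable]: "h \<in> borel_measurable borel" using h by auto
    show ?thesis by (rule Bochner_Integration.integrable_bound[OF h]) (auto simp: rest_def)
  qed
  have rest_L2: "(\<integral>\<^sup>+x. ennreal ((norm (heat (Complex 1 t) (rest C h) x))\<^sup>2) \<partial>lborel) \<le> ennreal ((C / 2 ^ N * sqrt V)\<^sup>2)"
    if h: "integrable lborel h" "\<And>y. y \<notin> D \<Longrightarrow> h y = 0" and C: "0 < C" for C h t
  proof -
    have [measurable]: "h \<in> borel_measurable borel" using h by auto
    have "(\<integral>\<^sup>+x. ennreal ((norm (rest C h x))\<^sup>2) \<partial>lborel) \<le> (\<integral>\<^sup>+x. ennreal ((C / 2 ^ N)\<^sup>2) * indicator D x \<partial>lborel)"
    proof (intro nn_integral_mono)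
      fix x
      have "(norm (rest C h x))\<^sup>2 \<le> (C / 2 ^ N)\<^sup>2" using C by (intro power_mono) (auto simp: rest_def)
      then show "ennreal ((norm (rest C h x))\<^sup>2) \<le> ennreal ((C / 2 ^ N)\<^sup>2) * indicator D x"
        using h(2)[of x] by (cases "x \<in> D") (auto simp: rest_def intro: ennreal_leI)
    qed
    also have "\<dots> = ennreal ((C / 2 ^ N)\<^sup>2) * emeasure lborel D" by (simp add: nn_integral_cmult_indicator)
    also have "\<dots> \<le> ennreal ((C / 2 ^ N)\<^sup>2) * ennreal V" by (intro mult_left_mono D) auto
    also have "\<dots> = ennreal ((C / 2 ^ N * sqrt V)\<^sup>2)" using D(3) by (simp add: ennreal_mult[symmetric] power_mult_distrib power_divide)
    finally show ?thesis by (rule order_trans[OF heat_L2_L2[OF rest_int[OF h(1)]]])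
  qed
  define f0 where "f0 y = (\<Sum>k\<le>N. level_part A k f y)" for y
  define g0 where "g0 y = (\<Sum>k\<le>N. level_part B k g y)" for y
  have f0: "integrable lborel f0" and g0: "integrable lborel g0"
    unfolding f0_def[abs_def] g0_def[abs_def] by (intro Bochner_Integration.integrable_sum level_part_integrable f g)+
  have split: "f = (\<lambda>y. f0 y + rest A f y)" "g = (\<lambda>y. g0 y + rest B g y)"
    unfolding f0_def g0_def rest_def using AB by (auto simp: fun_eq_iff sum_level_part)
  have f0A: "Lp_mass p f0 \<le> ennreal (A powr p)"
    using AB by (intro order_trans[OF nn_integral_mono fA]) (auto simp: f0_def sum_level_part intro!: ennreal_leI)
  have L2le: "?I (?T u v) \<le> ennreal (Y\<^sub>2 * a * b)"
    if "integrable lborel u" "integrable lborel v" "0 \<le> a" "0 \<le> b"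
      "\<And>t. heat_energy t u \<le> ennreal (a\<^sup>2)"
      "\<And>t. heat_energy t v \<le> ennreal (b\<^sup>2)" for u v a b
  proof -
    have "?I (?T u v) \<le> (\<integral>\<^sup>+x. ennreal (norm (?T u v x)) \<partial>lborel)"
      by (intro nn_integral_mono) (auto simp: indicator_def)
    also have "\<dots> \<le> ennreal (Y\<^sub>2 * a * b)" unfolding Y\<^sub>2_def by (rule br_piece_L2_L2[OF \<alpha> that])
    finally show ?thesis .
  qed
  have pair: "?I (?T (level_part A k f) (level_part B l g)) \<le> ennreal ((4 * K\<^sup>2) * (Y\<^sub>1 powr (2 / q - 1) * Y\<^sub>2 powr (2 - 2 / q)) * A * B)" for k l
  proof -
    let ?u = "level_part A k f" and ?v = "level_part B l g"
    note uv = level_part_integrable[OF f, of A k] level_part_integrable[OF g, of B l]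
    obtain a b where ab: "0 \<le> a" "0 \<le> b" "(\<integral>\<^sup>+x. ennreal (norm (?u x)) \<partial>lborel) \<le> ennreal a"
      "\<And>t. (\<integral>\<^sup>+x. ennreal ((norm (heat (Complex 1 t) ?u x))\<^sup>2) \<partial>lborel) \<le> ennreal (b\<^sup>2)"
      "a powr (2 / q - 1) * b powr (2 - 2 / q) \<le> 2 * K * A"
      unfolding K_def by (rule level_part_bounds[OF f pq AB(1) fA, where k = k]) blast
    obtain a' b' where ab': "0 \<le> a'" "0 \<le> b'" "(\<integral>\<^sup>+x. ennreal (norm (?v x)) \<partial>lborel) \<le> ennreal a'"
      "\<And>t. (\<integral>\<^sup>+x. ennreal ((norm (heat (Complex 1 t) ?v x))\<^sup>2) \<partial>lborel) \<le> ennreal (b'\<^sup>2)"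
      "a' powr (2 / q - 1) * b' powr (2 - 2 / q) \<le> 2 * K * B"
      unfolding K_def by (rule level_part_bounds[OF g order_trans[OF pq(1,2)] order_refl pq(3) AB(2) gB, where k = l]) blast
    have na: "(\<integral>y. norm (?u y) \<partial>lborel) \<le> a" "(\<integral>y. norm (?v y) \<partial>lborel) \<le> a'"
      using ab(1,3) ab'(1,3) uv by (simp_all add: nn_integral_eq_integral)
    have "?I (?T ?u ?v) \<le> (\<integral>\<^sup>+x. ennreal (piece_kernel_const \<alpha> DIM('a) * (2 ^ j) powr (- \<alpha> - 1 / 2 - DIM('a)) * a * a') * indicator X x \<partial>lborel)"
    proof (intro nn_integral_mono)
      fix x
      have "norm (?T ?u ?v x) \<le> piece_kernel_const \<alpha> DIM('a) * (2 ^ j) powr (- \<alpha> - 1 / 2 - DIM('a)) * (\<integral>y. norm (?u y) \<partial>lborel) * (\<integral>y. norm (?v y) \<partial>lborel)"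
        by (rule norm_br_piece_le[OF \<alpha> uv])
      also have "\<dots> \<le> piece_kernel_const \<alpha> DIM('a) * (2 ^ j) powr (- \<alpha> - 1 / 2 - DIM('a)) * a * a'"
        using na ab(1) ab'(1) kc by (intro mult_mono mult_nonneg_nonneg) auto
      finally show "indicator X x * ennreal (norm (?T ?u ?v x)) \<le> ennreal (piece_kernel_const \<alpha> DIM('a) * (2 ^ j) powr (- \<alpha> - 1 / 2 - DIM('a)) * a * a') * indicator X x"
        by (subst mult.commute, intro mult_right_mono ennreal_leI) auto
    qed
    also have "\<dots> = ennreal (piece_kernel_const \<alpha> DIM('a) * (2 ^ j) powr (- \<alpha> - 1 / 2 - DIM('a)) * a * a') * emeasure lborel X"
      by (simp add: nn_integral_cmult_indicator)
    also have "\<dots> \<le> ennreal (piece_kernel_const \<alpha> DIM('a) * (2 ^ j) powr (- \<alpha> - 1 / 2 - DIM('a)) * a * a') * ennreal W"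
      by (intro mult_left_mono X) auto
    also have "\<dots> = ennreal (Y\<^sub>1 * a * a')"
      using X kc ab(1) ab'(1) by (simp add: ennreal_mult[symmetric] Y\<^sub>1_def mult_ac)
    finally have 1: "?I (?T ?u ?v) \<le> ennreal (Y\<^sub>1 * a * a')" .
    have 2: "?I (?T ?u ?v) \<le> ennreal (Y\<^sub>2 * b * b')"
      by (rule L2le[OF uv ab(2) ab'(2) ab(4) ab'(4)])
    \<comment> \<open>The kernel bound shows that the integral is finite, so the two bounds can be
      compared as real numbers.\<close>
    obtain s where s: "0 \<le> s" "?I (?T ?u ?v) = ennreal s"
      using 1 by (cases "?I (?T ?u ?v)") (auto simp: top_unique)
    have "s \<le> (Y\<^sub>1 * a * a') powr (2 / q - 1) * (Y\<^sub>2 * b * b') powr (1 - (2 / q - 1))"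
      using 1 2 s q\<theta> Y ab ab' by (intro le_powr_mult_powr) (auto simp: ennreal_le_iff)
    also have "1 - (2 / q - 1) = 2 - 2 / q" by simp
    also have "(Y\<^sub>1 * a * a') powr (2 / q - 1) * (Y\<^sub>2 * b * b') powr (2 - 2 / q)
      = (Y\<^sub>1 powr (2 / q - 1) * Y\<^sub>2 powr (2 - 2 / q)) * ((a powr (2 / q - 1) * b powr (2 - 2 / q)) * (a' powr (2 / q - 1) * b' powr (2 - 2 / q)))"
      using Y ab ab' by (simp add: powr_mult mult_ac)
    also have "\<dots> \<le> (Y\<^sub>1 powr (2 / q - 1) * Y\<^sub>2 powr (2 - 2 / q)) * ((2 * K * A) * (2 * K * B))"
      using K AB by (intro mult_left_mono[OF mult_mono[OF ab(5) ab'(5)]]) auto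
    finally show ?thesis unfolding s(2) by (intro ennreal_leI) (simp add: power2_eq_square mult_ac)
  qed
  have main: "?I (?T f0 g0) \<le> ennreal ((real N + 1)\<^sup>2 * ((4 * K\<^sup>2) * (Y\<^sub>1 powr (2 / q - 1) * Y\<^sub>2 powr (2 - 2 / q)) * A * B))"
  proof -
    have "?T f0 g0 x = (\<Sum>k\<le>N. \<Sum>l\<le>N. ?T (level_part A k f) (level_part B l g) x)" for x
    proof -
      have "?T (level_part A k f) g0 x = (\<Sum>l\<le>N. ?T (level_part A k f) (level_part B l g) x)" for k
        unfolding br_piece_commute[of _ _ "level_part A k f"] g0_def[abs_def]
        by (rule br_piece_sum[OF \<alpha> _ level_part_integrable[OF g] level_part_integrable[OF f]]) simp
      moreover have "?T f0 g0 x = (\<Sum>k\<le>N. ?T (level_part A k f) g0 x)"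
        unfolding f0_def[abs_def] by (rule br_piece_sum[OF \<alpha> _ level_part_integrable[OF f] g0]) simp
      ultimately show ?thesis by simp
    qed
    then have "?I (?T f0 g0) \<le> (\<integral>\<^sup>+x. (\<Sum>k\<le>N. \<Sum>l\<le>N. indicator X x * ennreal (norm (?T (level_part A k f) (level_part B l g) x))) \<partial>lborel)"
    proof (intro nn_integral_mono)
      fix x
      assume eq: "\<And>x. ?T f0 g0 x = (\<Sum>k\<le>N. \<Sum>l\<le>N. ?T (level_part A k f) (level_part B l g) x)"
      have "norm (?T f0 g0 x) \<le> (\<Sum>k\<le>N. \<Sum>l\<le>N. norm (?T (level_part A k f) (level_part B l g) x))"
        unfolding eq by (intro order_trans[OF norm_sum] sum_mono order_refl)
      then have "ennreal (norm (?T f0 g0 x)) \<le> ennreal (\<Sum>k\<le>N. \<Sum>l\<le>N. norm (?T (level_part A k f) (level_part B l g) x))" by (rule ennreal_leI)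
      also have "\<dots> = (\<Sum>k\<le>N. \<Sum>l\<le>N. ennreal (norm (?T (level_part A k f) (level_part B l g) x)))"
        by (simp add: sum_nonneg)
      finally show "indicator X x * ennreal (norm (?T f0 g0 x)) \<le> (\<Sum>k\<le>N. \<Sum>l\<le>N. indicator X x * ennreal (norm (?T (level_part A k f) (level_part B l g) x)))"
        unfolding sum_distrib_left[symmetric] by (intro mult_left_mono) auto
    qed
    also have "\<dots> = (\<Sum>k\<le>N. \<integral>\<^sup>+x. (\<Sum>l\<le>N. indicator X x * ennreal (norm (?T (level_part A k f) (level_part B l g) x))) \<partial>lborel)"
      by (rule nn_integral_sum) measurable
    also have "\<dots> = (\<Sum>k\<le>N. \<Sum>l\<le>N. ?I (?T (level_part A k f) (level_part B l g)))"
      by (intro sum.cong refl nn_integral_sum) measurable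
    also have "\<dots> \<le> (\<Sum>k\<le>N. \<Sum>l\<le>N. ennreal ((4 * K\<^sup>2) * (Y\<^sub>1 powr (2 / q - 1) * Y\<^sub>2 powr (2 - 2 / q)) * A * B))"
      by (intro sum_mono pair)
    also have "\<dots> = ennreal ((real N + 1)\<^sup>2 * ((4 * K\<^sup>2) * (Y\<^sub>1 powr (2 / q - 1) * Y\<^sub>2 powr (2 - 2 / q)) * A * B))"
    proof -
      have "(\<Sum>k\<le>N. \<Sum>l\<le>N. ennreal x) = ennreal ((real N + 1)\<^sup>2 * x)" if "0 \<le> x" for x
      proof -
        have "(\<Sum>k\<le>N. \<Sum>l\<le>N. ennreal x) = ennreal (\<Sum>k\<le>N. \<Sum>l\<le>N. x)"
          using that by (simp add: sum_nonneg del: sum_constant)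
        then show ?thesis by (simp add: power2_eq_square mult.assoc add.commute)
      qed
      then show ?thesis using AB Y by simp
    qed
    finally show ?thesis .
  qed
  have r1: "?I (?T f0 (rest B g)) \<le> ennreal (Y\<^sub>2 * (K * A) * (B / 2 ^ N * sqrt V))"
    using AB K D(3) pq by (intro L2le f0 rest_int g rest_L2 supp heat_Lp_L2[OF f0 _ _ AB(1) f0A, folded K_def]) auto
  have r2: "?I (?T (rest A f) g) \<le> ennreal (Y\<^sub>2 * (A / 2 ^ N * sqrt V) * (K * B))"
    using AB K D(3) pq by (intro L2le f rest_int g rest_L2 supp heat_Lp_L2[OF g _ _ AB(2) gB, folded K_def]) auto
  \<comment> \<open>Three terms suffice: the remainder of \<open>f\<close> is paired with all of
    \<open>g\<close>, the remainder of \<open>g\<close> only with \<open>f0\<close>. In each cross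
    term Bernstein's inequality controls the factor that is not small.\<close>
  have "?T f g x = ?T f0 g0 x + ?T f0 (rest B g) x + ?T (rest A f) g x" for x
  proof -
    have "?T f g x = ?T f0 g x + ?T (rest A f) g x"
      by (subst split(1)) (rule br_piece_add[OF \<alpha> f0 rest_int[OF f] g])
    also have "?T f0 g x = ?T g f0 x" by (rule br_piece_commute)
    also have "\<dots> = ?T g0 f0 x + ?T (rest B g) f0 x"
      by (subst split(2)) (rule br_piece_add[OF \<alpha> g0 rest_int[OF g] f0])
    finally show ?thesis by (simp add: br_piece_commute[of _ _ f0])
  qed
  then have "?I (?T f g) \<le> (\<integral>\<^sup>+x. indicator X x * ennreal (norm (?T f0 g0 x)) + indicator X x * ennreal (norm (?T f0 (rest B g) x)) + indicator X x * ennreal (norm (?T (rest A f) g x)) \<partial>lborel)"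
  proof (intro nn_integral_mono)
    fix x
    assume eq: "\<And>x. ?T f g x = ?T f0 g0 x + ?T f0 (rest B g) x + ?T (rest A f) g x"
    have "norm (?T f g x) \<le> norm (?T f0 g0 x) + norm (?T f0 (rest B g) x) + norm (?T (rest A f) g x)"
      unfolding eq by (intro norm_triangle_le add_right_mono norm_triangle_ineq)
    then have "ennreal (norm (?T f g x)) \<le> ennreal (norm (?T f0 g0 x)) + ennreal (norm (?T f0 (rest B g) x)) + ennreal (norm (?T (rest A f) g x))"
      by (simp add: ennreal_plus[symmetric] del: ennreal_plus)
    then show "indicator X x * ennreal (norm (?T f g x)) \<le> indicator X x * ennreal (norm (?T f0 g0 x)) + indicator X x * ennreal (norm (?T f0 (rest B g) x)) + indicator X x * ennreal (norm (?T (rest A f) g x))"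
      unfolding distrib_left[symmetric] by (intro mult_left_mono) auto
  qed
  also have "\<dots> = ?I (?T f0 g0) + ?I (?T f0 (rest B g)) + ?I (?T (rest A f) g)"
  proof -
    have [measurable]: "f0 \<in> borel_measurable borel" "g0 \<in> borel_measurable borel" "rest A f \<in> borel_measurable borel" "rest B g \<in> borel_measurable borel"
      using f0 g0 rest_int[OF f, of A] rest_int[OF g, of B] by auto
    show ?thesis by (simp add: nn_integral_add)
  qed
  also have "\<dots> \<le> ennreal ((real N + 1)\<^sup>2 * ((4 * K\<^sup>2) * (Y\<^sub>1 powr (2 / q - 1) * Y\<^sub>2 powr (2 - 2 / q)) * A * B))
      + ennreal (Y\<^sub>2 * (K * A) * (B / 2 ^ N * sqrt V)) + ennreal (Y\<^sub>2 * (A / 2 ^ N * sqrt V) * (K * B))"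
    by (intro add_mono main r1 r2)
  also have "\<dots> = ennreal ((real N + 1)\<^sup>2 * ((4 * K\<^sup>2) * (Y\<^sub>1 powr (2 / q - 1) * Y\<^sub>2 powr (2 - 2 / q)) * A * B)
      + Y\<^sub>2 * (K * A) * (B / 2 ^ N * sqrt V) + Y\<^sub>2 * (A / 2 ^ N * sqrt V) * (K * B))"
    using Y K AB D(3) by (simp add: ennreal_plus[symmetric] del: ennreal_plus)
  finally show ?thesis by (simp add: algebra_simps)
qed

section \<open>From local to global bounds\<close>

text \<open>A positive majorant for the heat flow on a whole shell, used with
  \<open>s = 1 / (2 * R\<^sup>2)\<close> for the contributions from far away.\<close>

definition gaussian_average :: "real \<Rightarrow> ('a::euclidean_space \<Rightarrow> complex) \<Rightarrow> 'a \<Rightarrow> real"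
  where "gaussian_average s f x = (\<integral>y. norm (f y) * exp (- (s * (norm (x - y))\<^sup>2)) \<partial>lborel)"

lemma gaussian_average_measurable [measurable]:
  assumes [measurable]: "f \<in> borel_measurable borel"
  shows "gaussian_average s f \<in> borel_measurable borel"
  unfolding gaussian_average_def[abs_def] by measurable

lemma gaussian_average_nonneg [simp]: "0 \<le> gaussian_average s f x"
  unfolding gaussian_average_def by (rule Bochner_Integration.integral_nonneg) simp

lemma integrable_gaussian_average:
  fixes f :: "'a::euclidean_space \<Rightarrow> complex"
  assumes f: "integrable lborel f" and s: "0 \<le> s"
  shows "integrable lborel (\<lambda>y. norm (f y) * exp (- (s * (norm (x - y))\<^sup>2)))"
proof -
  have [measurable]: "f \<in> borel_measurable borel" using f by auto
  show ?thesis
    by (rule Bochner_Integration.integrable_bound[OF f]) (use s in \<open>auto intro!: AE_I2 mult_left_le\<close>)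
qed

text \<open>Young's convolution inequality with an L^1 kernel: Hoelder against the Gaussian measure,
  then Fubini.\<close>

lemma gaussian_average_Lp:
  fixes f :: "'a::euclidean_space \<Rightarrow> complex"
  assumes f: "integrable lborel f" and p: "1 \<le> p" and s: "0 < s" and F: "0 \<le> F"
    and fF: "Lp_mass p f \<le> ennreal F"
  shows "(\<integral>\<^sup>+x. ennreal (gaussian_average s f x powr p) \<partial>lborel) \<le> ennreal ((sqrt (pi / s) ^ DIM('a)) powr p * F)"
proof -
  have [measurable]: "f \<in> borel_measurable borel" using f by auto
  define \<kappa> where "\<kappa> = sqrt (pi / s) ^ DIM('a)"
  have \<kappa>: "\<kappa> > 0" using s by (simp add: \<kappa>_def)
  define \<gamma> where "\<gamma> u = exp (- (s * (norm (u::'a))\<^sup>2))" for u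
  have [measurable]: "\<gamma> \<in> borel_measurable borel" unfolding \<gamma>_def by measurable
  have \<gamma>: "0 < \<gamma> u" "\<gamma> u \<le> 1" for u using s by (auto simp: \<gamma>_def)
  have int\<gamma>: "(\<integral>\<^sup>+u. ennreal (\<gamma> u) \<partial>lborel) = ennreal \<kappa>"
    unfolding \<gamma>_def \<kappa>_def by (rule nn_integral_gaussian(1)[OF s])
  have tr: "(\<integral>\<^sup>+y. ennreal (\<gamma> (x - y)) \<partial>lborel) = ennreal \<kappa>" "(\<integral>\<^sup>+x. ennreal (\<gamma> (x - y)) \<partial>lborel) = ennreal \<kappa>" for x y
    using nn_integral_lborel_translate[of "\<lambda>u::'a. ennreal (\<gamma> u)"] int\<gamma> by simp_all
  let ?U = "\<lambda>x. (\<integral>\<^sup>+y. ennreal (norm (f y) powr p * \<gamma> (x - y)) \<partial>lborel)"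
  have UF: "?U x \<le> ennreal F" for x
    using \<gamma> by (intro order_trans[OF nn_integral_mono fF] ennreal_leI mult_left_le) (auto simp: less_imp_le)
  have pt: "ennreal (gaussian_average s f x powr p) \<le> ennreal (\<kappa> powr (p - 1)) * ?U x" for x
  proof -
    define u where "u = enn2real (?U x)"
    have u: "0 \<le> u" "?U x = ennreal u"
      using ennreal_enn2real[OF le_less_trans[OF UF[of x] ennreal_less_top]] by (simp_all add: u_def)
    have "ennreal (gaussian_average s f x) = (\<integral>\<^sup>+y. ennreal (norm (f y) * \<gamma> (x - y)) \<partial>lborel)"
      unfolding gaussian_average_def \<gamma>_def
      by (rule nn_integral_eq_integral[symmetric, OF integrable_gaussian_average[OF f]]) (use s in auto)
    also have "\<dots> = (\<integral>\<^sup>+y. ennreal ((norm (f y) powr p * \<gamma> (x - y)) powr (1 / p) * \<gamma> (x - y) powr (1 - 1 / p)) \<partial>lborel)"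
    proof (intro nn_integral_cong arg_cong[where f = ennreal])
      fix y
      have "(norm (f y) powr p * \<gamma> (x - y)) powr (1 / p) * \<gamma> (x - y) powr (1 - 1 / p)
        = norm (f y) * (\<gamma> (x - y) powr (1 / p) * \<gamma> (x - y) powr (1 - 1 / p))"
        using p \<gamma>[of "x - y"] by (simp add: powr_mult powr_powr)
      also have "\<gamma> (x - y) powr (1 / p) * \<gamma> (x - y) powr (1 - 1 / p) = \<gamma> (x - y)"
        unfolding powr_add[symmetric] using \<gamma>[of "x - y"] by simp
      finally show "norm (f y) * \<gamma> (x - y) = (norm (f y) powr p * \<gamma> (x - y)) powr (1 / p) * \<gamma> (x - y) powr (1 - 1 / p)" ..
    qed
    also have "\<dots> \<le> ennreal (u powr (1 / p) * \<kappa> powr (1 - 1 / p))"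
      using p \<gamma> u \<kappa> tr(1)[of x] by (intro nn_integral_Holder_powr) (auto simp: less_imp_le)
    finally have "gaussian_average s f x \<le> u powr (1 / p) * \<kappa> powr (1 - 1 / p)"
      by (subst (asm) ennreal_le_iff) auto
    then have "gaussian_average s f x powr p \<le> (u powr (1 / p) * \<kappa> powr (1 - 1 / p)) powr p"
      using p by (intro powr_mono2) auto
    also have "\<dots> = \<kappa> powr (p - 1) * u"
      using p u(1) \<kappa> by (simp add: powr_mult powr_powr algebra_simps)
    finally show ?thesis unfolding u(2) using u(1) by (simp add: ennreal_mult[symmetric])
  qed
  have "(\<integral>\<^sup>+x. ennreal (gaussian_average s f x powr p) \<partial>lborel) \<le> (\<integral>\<^sup>+x. ennreal (\<kappa> powr (p - 1)) * ?U x \<partial>lborel)"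
    by (intro nn_integral_mono pt)
  also have "\<dots> = ennreal (\<kappa> powr (p - 1)) * (\<integral>\<^sup>+x. ?U x \<partial>lborel)" by (rule nn_integral_cmult) measurable
  also have "(\<integral>\<^sup>+x. ?U x \<partial>lborel) = (\<integral>\<^sup>+y. \<integral>\<^sup>+x. ennreal (norm (f y) powr p * \<gamma> (x - y)) \<partial>lborel \<partial>lborel)"
    by (rule lborel_pair.Fubini'[symmetric]) measurable
  also have "\<dots> = (\<integral>\<^sup>+y. ennreal (norm (f y) powr p) * ennreal \<kappa> \<partial>lborel)"
    using \<gamma> by (simp add: ennreal_mult nn_integral_cmult tr less_imp_le)
  also have "\<dots> = (\<integral>\<^sup>+y. ennreal (norm (f y) powr p) \<partial>lborel) * ennreal \<kappa>" by (rule nn_integral_multc) measurable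
  also have "ennreal (\<kappa> powr (p - 1)) * ((\<integral>\<^sup>+y. ennreal (norm (f y) powr p) \<partial>lborel) * ennreal \<kappa>) \<le> ennreal (\<kappa> powr (p - 1)) * (ennreal F * ennreal \<kappa>)"
    by (intro mult_left_mono mult_right_mono fF) auto
  also have "\<dots> = ennreal (\<kappa> powr (p - 1) * (F * \<kappa>))" using F \<kappa> by (simp add: ennreal_mult[symmetric])
  also have "\<kappa> powr (p - 1) * (F * \<kappa>) = \<kappa> powr p * F" using \<kappa> by (simp add: powr_diff)
  finally show ?thesis by (simp add: \<kappa>_def)
qed

text \<open>On the shell |z| <= 3 R, and 3 < pi, so the kernel is at most a constant times exp (-
  |u|^2 / R^2). Half of this exponent is spent at distance \<open>L\<close> and gives the small
  factor; the other half remains as the averaging Gaussian. With \<open>L = 0\<close> the estimate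
  holds for every \<open>f\<close>.\<close>

lemma norm_heat_shell_le:
  fixes f :: "'a::euclidean_space \<Rightarrow> complex"
  assumes f: "integrable lborel f" and t: "t \<in> dyadic_shell j" and L: "0 \<le> L"
    and far: "\<And>y. norm (x - y) < L \<Longrightarrow> f y = 0"
  shows "norm (heat (Complex 1 t) f x) \<le> sqrt pi ^ DIM('a) * exp (- (L\<^sup>2 / (2 * (2 ^ j)\<^sup>2))) * gaussian_average (1 / (2 * (2 ^ j)\<^sup>2)) f x"
proof -
  define R :: real where "R = 2 ^ j"
  have R: "R > 0" by (simp add: R_def)
  define N where "N = norm (Complex 1 t)"
  have N: "1 \<le> N" "N \<le> 3 * R" using norm_Complex_1(3)[of t] dyadic_shell_bounds(2)[OF t] by (auto simp: N_def R_def)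
  have ker: "norm (heat_kernel (Complex 1 t) u) \<le> sqrt pi ^ DIM('a) * exp (- ((norm u)\<^sup>2 / R\<^sup>2))" for u :: 'a
  proof -
    have "N\<^sup>2 \<le> (3 * R)\<^sup>2" using N by (intro power_mono) auto
    also have "\<dots> \<le> pi\<^sup>2 * R\<^sup>2" unfolding power_mult_distrib using pi_gt3 by (intro mult_right_mono power_mono) auto
    finally have "1 / R\<^sup>2 \<le> pi\<^sup>2 / N\<^sup>2" using R N by (simp add: field_simps)
    then have "(norm u)\<^sup>2 * (1 / R\<^sup>2) \<le> (norm u)\<^sup>2 * (pi\<^sup>2 / N\<^sup>2)" by (intro mult_left_mono) auto
    then have e: "exp (- (pi\<^sup>2 * (norm u)\<^sup>2 / N\<^sup>2)) \<le> exp (- ((norm u)\<^sup>2 / R\<^sup>2))" by (simp add: mult.commute)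
    have "pi / N \<le> pi" using N by (simp add: field_simps)
    then have "sqrt (pi / N) ^ DIM('a) \<le> sqrt pi ^ DIM('a)" by (intro power_mono) (use N in auto)
    then show ?thesis unfolding norm_heat_kernel N_def[symmetric] using e by (intro mult_mono) auto
  qed
  let ?c = "sqrt pi ^ DIM('a) * exp (- (L\<^sup>2 / (2 * R\<^sup>2)))"
  have "norm (heat (Complex 1 t) f x) \<le> (\<integral>y. ?c * (norm (f y) * exp (- (1 / (2 * R\<^sup>2) * (norm (x - y))\<^sup>2))) \<partial>lborel)"
    unfolding heat_def
  proof (rule Bochner_Integration.integral_norm_bound_integral)
    show "integrable lborel (\<lambda>y. f y * heat_kernel (Complex 1 t) (x - y))" by (rule integrable_mult_heat_kernel[OF f])
    show "integrable lborel (\<lambda>y. ?c * (norm (f y) * exp (- (1 / (2 * R\<^sup>2) * (norm (x - y))\<^sup>2))))"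
      by (intro integrable_mult_right integrable_gaussian_average f) simp
    fix y
    show "norm (f y * heat_kernel (Complex 1 t) (x - y)) \<le> ?c * (norm (f y) * exp (- (1 / (2 * R\<^sup>2) * (norm (x - y))\<^sup>2)))"
    proof (cases "norm (x - y) < L")
      case False
      then have "L\<^sup>2 \<le> (norm (x - y))\<^sup>2" using L by (intro power_mono) auto
      then have "L\<^sup>2 / (2 * R\<^sup>2) \<le> (norm (x - y))\<^sup>2 / (2 * R\<^sup>2)" by (rule divide_right_mono) simp
      then have "exp (- ((norm (x - y))\<^sup>2 / R\<^sup>2)) \<le> exp (- (L\<^sup>2 / (2 * R\<^sup>2)) + - (1 / (2 * R\<^sup>2) * (norm (x - y))\<^sup>2))"
        using R by (simp add: field_simps)
      also have "\<dots> = exp (- (L\<^sup>2 / (2 * R\<^sup>2))) * exp (- (1 / (2 * R\<^sup>2) * (norm (x - y))\<^sup>2))" by (rule exp_add)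
      finally have "norm (f y) * (sqrt pi ^ DIM('a) * exp (- ((norm (x - y))\<^sup>2 / R\<^sup>2))) \<le> norm (f y) * (sqrt pi ^ DIM('a) * (exp (- (L\<^sup>2 / (2 * R\<^sup>2))) * exp (- (1 / (2 * R\<^sup>2) * (norm (x - y))\<^sup>2))))"
        by (intro mult_left_mono) auto
      moreover have "norm (f y * heat_kernel (Complex 1 t) (x - y)) \<le> norm (f y) * (sqrt pi ^ DIM('a) * exp (- ((norm (x - y))\<^sup>2 / R\<^sup>2)))"
        unfolding norm_mult by (intro mult_left_mono ker) auto
      ultimately show ?thesis by (simp only: mult_ac)
    qed (simp add: far)
  qed
  also have "\<dots> = ?c * gaussian_average (1 / (2 * R\<^sup>2)) f x" by (simp only: gaussian_average_def integral_mult_right_zero)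
  finally show ?thesis by (simp only: R_def)
qed

text \<open>A crude bound that discards the decay of the weight. It is applied to far contributions,
  whose exponential factor outweighs any power of R.\<close>

lemma norm_br_piece_le_sup:
  fixes f g :: "'a::euclidean_space \<Rightarrow> complex"
  assumes \<alpha>: "0 < \<alpha>" and f: "integrable lborel f" and g: "integrable lborel g"
    and a: "0 \<le> a" "\<And>t. t \<in> dyadic_shell j \<Longrightarrow> norm (heat (Complex 1 t) f x) \<le> a"
    and b: "0 \<le> b" "\<And>t. t \<in> dyadic_shell j \<Longrightarrow> norm (heat (Complex 1 t) g x) \<le> b"
  shows "norm (br_piece \<alpha> j f g x) \<le> 4 * exp 1 * 2 ^ j * a * b"
proof -
  let ?J = "dyadic_shell j"
  note symb = norm_br_symbol_le[OF \<alpha>]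
  have "norm (br_piece \<alpha> j f g x) \<le> (\<integral>t. indicator ?J t * (exp 1 * a * b) \<partial>lborel)"
    unfolding br_piece_def set_lebesgue_integral_def
  proof (rule Bochner_Integration.integral_norm_bound_integral)
    show "integrable lborel (\<lambda>t. indicator ?J t *\<^sub>R (br_symbol \<alpha> t * heat (Complex 1 t) f x * heat (Complex 1 t) g x))"
      using set_integrable_br_integrand[OF \<alpha> f g] unfolding set_integrable_def .
    show "integrable lborel (\<lambda>t. indicator ?J t * (exp 1 * a * b))" by (rule integrable_shell_const)
    fix t
    show "norm (indicator ?J t *\<^sub>R (br_symbol \<alpha> t * heat (Complex 1 t) f x * heat (Complex 1 t) g x)) \<le> indicator ?J t * (exp 1 * a * b)"
    proof (cases "t \<in> ?J")
      case True
      have "norm (br_symbol \<alpha> t) * norm (heat (Complex 1 t) f x) * norm (heat (Complex 1 t) g x) \<le> exp 1 * a * b"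
        using a b True by (intro mult_mono symb) auto
      then show ?thesis using True by (simp add: norm_mult)
    qed simp
  qed
  also have "\<dots> = measure lborel ?J * (exp 1 * a * b)" by simp
  also have "\<dots> \<le> (4 * 2 ^ j) * (exp 1 * a * b)"
    using emeasure_dyadic_shell[of j] a b
    by (intro mult_right_mono) (auto simp: measure_def intro: enn2real_leI)
  finally show ?thesis by (simp add: mult_ac)
qed

lemma powr_conjugate_cancel:
  fixes p p1 p2 :: real
  assumes "0 < p" "1 \<le> p1" "1 \<le> p2" "1 / p = 1 / p1 + 1 / p2"
  shows "1 - p / p1 = p / p2" "0 < p / p1" "p / p1 \<le> 1"
proof -
  have "1 = p * (1 / p)" using assms(1) by simp
  also have "\<dots> = p / p1 + p / p2" unfolding assms(4) by (simp add: distrib_left)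
  finally have "1 = p / p1 + p / p2" .
  moreover have "0 < p / p1" "0 < p / p2" using assms by auto
  ultimately show "1 - p / p1 = p / p2" "0 < p / p1" "p / p1 \<le> 1" by linarith+
qed

text \<open>On a ball of radius \<open>L\<close> only the restrictions of \<open>f\<close> and
  \<open>g\<close> to the doubled ball matter, up to a pointwise error. The ball bound is taken from
  L^1 to L^p by Hoelder, at the cost of its volume to the power 1 - p, and then integrated over all
  centres. Averaging over centres takes the place of a covering: it reproduces global masses
  exactly, and the doubled radius leaves only the factor 2^n.\<close>

lemma br_piece_Lp_from_local:
  fixes f g :: "'a::euclidean_space \<Rightarrow> complex" and p p\<^sub>1 p\<^sub>2 :: real
  assumes \<alpha>: "0 < \<alpha>" and f: "integrable lborel f" and g: "integrable lborel g"
    and p: "0 < p" "p \<le> 1" "1 \<le> p\<^sub>1" "1 \<le> p\<^sub>2" "1 / p = 1 / p\<^sub>1 + 1 / p\<^sub>2"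
    and L: "0 < L" and M: "0 \<le> M" and FG: "0 \<le> F" "0 \<le> G"
    and fF: "Lp_mass p\<^sub>1 f \<le> ennreal F"
    and gG: "Lp_mass p\<^sub>2 g \<le> ennreal G"
    and near_bound: "\<And>(c::'a) u v A B. integrable lborel u \<Longrightarrow> integrable lborel v \<Longrightarrow>
        (\<And>y. y \<notin> ball c (2 * L) \<Longrightarrow> u y = 0) \<Longrightarrow> (\<And>y. y \<notin> ball c (2 * L) \<Longrightarrow> v y = 0) \<Longrightarrow> 0 < A \<Longrightarrow> 0 < B \<Longrightarrow>
        Lp_mass p\<^sub>1 u \<le> ennreal (A powr p\<^sub>1) \<Longrightarrow>
        Lp_mass p\<^sub>2 v \<le> ennreal (B powr p\<^sub>2) \<Longrightarrow>
        (\<integral>\<^sup>+x. indicator (ball c L) x * ennreal (norm (br_piece \<alpha> j u v x)) \<partial>lborel) \<le> ennreal (M * A * B)"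
  defines "E \<equiv> 8 * exp 1 * 2 ^ j * pi ^ DIM('a) * exp (- (L\<^sup>2 / (2 * (2 ^ j)\<^sup>2))) * (sqrt (2 * pi * (2 ^ j)\<^sup>2) ^ DIM('a))\<^sup>2"
  shows "Lp_mass p (br_piece \<alpha> j f g)
    \<le> ennreal ((2 ^ DIM('a) * (unit_ball_vol DIM('a) * L ^ DIM('a)) powr (1 - p) * M powr p + E powr p) * (F powr (p / p\<^sub>1) * G powr (p / p\<^sub>2)))"
proof -
  have [measurable]: "f \<in> borel_measurable borel" "g \<in> borel_measurable borel" using f g by auto
  note conj = powr_conjugate_cancel[OF p(1,3,4,5)]
  let ?T = "br_piece \<alpha> j"
  define R :: real where "R = 2 ^ j"
  have R: "R > 0" by (simp add: R_def)
  define s where "s = 1 / (2 * R\<^sup>2)"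
  have s: "s > 0" using R by (simp add: s_def)
  define \<kappa> where "\<kappa> = sqrt (2 * pi * R\<^sup>2) ^ DIM('a)"
  have \<kappa>: "\<kappa> > 0" "sqrt (pi / s) ^ DIM('a) = \<kappa>" using R by (auto simp: \<kappa>_def s_def mult_ac)
  define Cw where "Cw = 8 * exp 1 * R * pi ^ DIM('a) * exp (- (L\<^sup>2 / (2 * R\<^sup>2)))"
  have Cw: "Cw > 0" using R by (simp add: Cw_def)
  have EC: "E = Cw * \<kappa>\<^sup>2" by (simp add: E_def Cw_def \<kappa>_def R_def)
  \<comment> \<open>A pointwise majorant, common to all centres, for the two terms in which at least
    one function lives outside the doubled ball; the 8 in \<open>Cw\<close> is 4 + 4.\<close>
  define w where "w x = Cw * gaussian_average s f x * gaussian_average s g x" for x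
  have w0: "0 \<le> w x" for x using Cw by (simp add: w_def)
  have [measurable]: "w \<in> borel_measurable borel" unfolding w_def[abs_def] by measurable
  define vol where "vol r = unit_ball_vol DIM('a) * r ^ DIM('a)" for r :: real
  have vol: "vol L > 0" "vol (2 * L) = 2 ^ DIM('a) * vol L"
    using L by (auto simp: vol_def power_mult_distrib unit_ball_vol_pos)
  have vball: "emeasure lborel (ball c r) = ennreal (vol r)" if "0 \<le> r" for c :: 'a and r
    using that by (simp add: emeasure_ball vol_def)
  have spi: "sqrt pi ^ DIM('a) * sqrt pi ^ DIM('a) = pi ^ DIM('a)" by (simp add: power_mult_distrib[symmetric])

  have w_int: "(\<integral>\<^sup>+x. ennreal (w x powr p) \<partial>lborel) \<le> ennreal (E powr p * (F powr (p / p\<^sub>1) * G powr (p / p\<^sub>2)))"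
  proof -
    have "(\<integral>\<^sup>+x. ennreal (w x powr p) \<partial>lborel) = (\<integral>\<^sup>+x. ennreal (Cw powr p) * ennreal ((gaussian_average s f x powr p\<^sub>1) powr (p / p\<^sub>1) * (gaussian_average s g x powr p\<^sub>2) powr (1 - p / p\<^sub>1)) \<partial>lborel)"
    proof (intro nn_integral_cong)
      fix x
      have "w x powr p = Cw powr p * ((gaussian_average s f x powr p\<^sub>1) powr (p / p\<^sub>1) * (gaussian_average s g x powr p\<^sub>2) powr (1 - p / p\<^sub>1))"
        unfolding conj(1) w_def using Cw p by (simp add: powr_mult powr_powr)
      then show "ennreal (w x powr p) = ennreal (Cw powr p) * ennreal ((gaussian_average s f x powr p\<^sub>1) powr (p / p\<^sub>1) * (gaussian_average s g x powr p\<^sub>2) powr (1 - p / p\<^sub>1))"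
        by (simp add: ennreal_mult[symmetric])
    qed
    also have "\<dots> = ennreal (Cw powr p) * (\<integral>\<^sup>+x. ennreal ((gaussian_average s f x powr p\<^sub>1) powr (p / p\<^sub>1) * (gaussian_average s g x powr p\<^sub>2) powr (1 - p / p\<^sub>1)) \<partial>lborel)"
      by (rule nn_integral_cmult) measurable
    also have "\<dots> \<le> ennreal (Cw powr p) * ennreal ((\<kappa> powr p\<^sub>1 * F) powr (p / p\<^sub>1) * (\<kappa> powr p\<^sub>2 * G) powr (1 - p / p\<^sub>1))"
      using gaussian_average_Lp[OF f p(3) s FG(1) fF] gaussian_average_Lp[OF g p(4) s FG(2) gG] conj FG \<kappa>
      by (intro mult_left_mono nn_integral_Holder_powr) auto
    also have "\<dots> = ennreal (Cw powr p * ((\<kappa> powr p\<^sub>1 * F) powr (p / p\<^sub>1) * (\<kappa> powr p\<^sub>2 * G) powr (1 - p / p\<^sub>1)))"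
      by (simp add: ennreal_mult[symmetric])
    also have "Cw powr p * ((\<kappa> powr p\<^sub>1 * F) powr (p / p\<^sub>1) * (\<kappa> powr p\<^sub>2 * G) powr (1 - p / p\<^sub>1)) = (Cw powr p * \<kappa> powr p * \<kappa> powr p) * (F powr (p / p\<^sub>1) * G powr (p / p\<^sub>2))"
      unfolding conj(1) using FG p \<kappa> by (simp add: powr_mult powr_powr)
    also have "Cw powr p * \<kappa> powr p * \<kappa> powr p = E powr p"
      using Cw \<kappa> by (simp add: EC powr_mult power2_eq_square)
    finally show ?thesis .
  qed

  \<comment> \<open>Masses of \<open>f\<close> and \<open>g\<close> on the doubled ball as functions
    of its centre; they are real-valued so that Hoelder can be applied in the centre.\<close>
  define Fc where "Fc c = enn2real (\<integral>\<^sup>+y. ennreal (norm (f y) powr p\<^sub>1) * (if norm (y - c) < 2 * L then 1 else 0) \<partial>lborel)" for c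
  define Gc where "Gc c = enn2real (\<integral>\<^sup>+y. ennreal (norm (g y) powr p\<^sub>2) * (if norm (y - c) < 2 * L then 1 else 0) \<partial>lborel)" for c
  have [measurable]: "Fc \<in> borel_measurable borel" "Gc \<in> borel_measurable borel"
    unfolding Fc_def[abs_def] Gc_def[abs_def] by measurable
  have finF: "ennreal (Fc c) = (\<integral>\<^sup>+y. ennreal (norm (f y) powr p\<^sub>1) * (if norm (y - c) < 2 * L then 1 else 0) \<partial>lborel)" for c
  proof -
    have "(\<integral>\<^sup>+y. ennreal (norm (f y) powr p\<^sub>1) * (if norm (y - c) < 2 * L then 1 else 0) \<partial>lborel) \<le> ennreal F"
      by (intro order_trans[OF nn_integral_mono fF]) auto
    then show ?thesis unfolding Fc_def by (intro ennreal_enn2real le_less_trans[OF _ ennreal_less_top])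
  qed
  have finG: "ennreal (Gc c) = (\<integral>\<^sup>+y. ennreal (norm (g y) powr p\<^sub>2) * (if norm (y - c) < 2 * L then 1 else 0) \<partial>lborel)" for c
  proof -
    have "(\<integral>\<^sup>+y. ennreal (norm (g y) powr p\<^sub>2) * (if norm (y - c) < 2 * L then 1 else 0) \<partial>lborel) \<le> ennreal G"
      by (intro order_trans[OF nn_integral_mono gG]) auto
    then show ?thesis unfolding Gc_def by (intro ennreal_enn2real le_less_trans[OF _ ennreal_less_top])
  qed
  have Fc0: "0 \<le> Fc c" "0 \<le> Gc c" for c by (simp_all add: Fc_def Gc_def)
  have ind_int: "(\<integral>\<^sup>+c. (if norm (y - c) < r then 1 else 0 :: ennreal) \<partial>lborel) = ennreal (vol r)" if "0 \<le> r" for y :: 'a and r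
  proof -
    have "(\<integral>\<^sup>+c. (if norm (y - c) < r then 1 else 0 :: ennreal) \<partial>lborel) = (\<integral>\<^sup>+c. indicator (ball y r) c \<partial>lborel)"
      by (intro nn_integral_cong) (auto simp: indicator_def dist_norm)
    then show ?thesis using vball[OF that] by simp
  qed
  have avg: "(\<integral>\<^sup>+c. \<integral>\<^sup>+y. ennreal (h y) * (if norm (y - c) < r then 1 else 0) \<partial>lborel \<partial>lborel) = ennreal (vol r) * (\<integral>\<^sup>+y. ennreal (h y) \<partial>lborel)"
    if [measurable]: "h \<in> borel_measurable borel" and r: "0 \<le> r" for h :: "'a \<Rightarrow> real" and r
  proof -
    have "(\<integral>\<^sup>+c. \<integral>\<^sup>+y. ennreal (h y) * (if norm (y - c) < r then 1 else 0) \<partial>lborel \<partial>lborel) = (\<integral>\<^sup>+y. \<integral>\<^sup>+c. ennreal (h y) * (if norm (y - c) < r then 1 else 0) \<partial>lborel \<partial>lborel)"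
      by (rule lborel_pair.Fubini') measurable
    also have "\<dots> = (\<integral>\<^sup>+y. ennreal (h y) * ennreal (vol r) \<partial>lborel)"
      by (simp add: nn_integral_cmult ind_int[OF r])
    also have "\<dots> = (\<integral>\<^sup>+y. ennreal (h y) \<partial>lborel) * ennreal (vol r)" by (rule nn_integral_multc) measurable
    finally show ?thesis by (simp add: mult.commute)
  qed

  have pointc: "(\<integral>\<^sup>+x. ennreal (norm (?T f g x) powr p) * (if norm (x - c) < L then 1 else 0) \<partial>lborel)
    \<le> ennreal (vol L powr (1 - p) * M powr p) * ennreal (Fc c powr (p / p\<^sub>1) * Gc c powr (1 - p / p\<^sub>1))
      + (\<integral>\<^sup>+x. ennreal (w x powr p) * (if norm (x - c) < L then 1 else 0) \<partial>lborel)" for c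
  proof -
    have [measurable]: "ball c L \<in> sets borel" by simp
    define u where "u y = (if norm (y - c) < 2 * L then f y else 0)" for y
    define v where "v y = (if norm (y - c) < 2 * L then g y else 0)" for y
    define u' where "u' y = (if norm (y - c) < 2 * L then 0 else f y)" for y
    define v' where "v' y = (if norm (y - c) < 2 * L then 0 else g y)" for y
    have [measurable]: "u \<in> borel_measurable borel" "v \<in> borel_measurable borel" "u' \<in> borel_measurable borel" "v' \<in> borel_measurable borel"
      unfolding u_def[abs_def] v_def[abs_def] u'_def[abs_def] v'_def[abs_def] by measurable
    have int: "integrable lborel u" "integrable lborel u'" "integrable lborel v" "integrable lborel v'"
      by (rule Bochner_Integration.integrable_bound[OF f] Bochner_Integration.integrable_bound[OF g]; auto simp: u_def v_def u'_def v'_def)+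
    have split: "f = (\<lambda>y. u y + u' y)" "g = (\<lambda>y. v y + v' y)" by (auto simp: u_def v_def u'_def v'_def fun_eq_iff)
    have uF: "Lp_mass p\<^sub>1 u = ennreal (Fc c)"
      unfolding finF by (intro nn_integral_cong) (use p in \<open>auto simp: u_def\<close>)
    have vG: "Lp_mass p\<^sub>2 v = ennreal (Gc c)"
      unfolding finG by (intro nn_integral_cong) (use p in \<open>auto simp: v_def\<close>)
    have near: "(\<integral>\<^sup>+x. indicator (ball c L) x * ennreal (norm (?T u v x)) \<partial>lborel) \<le> ennreal (M * Fc c powr (1 / p\<^sub>1) * Gc c powr (1 / p\<^sub>2))"
    \<comment> \<open>The local hypothesis asks for positive \<open>A\<close> and \<open>B\<close>.
      If a mass vanishes, the function vanishes almost everywhere, hence so do its heat flow and the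
      piece.\<close>
    proof (cases "Fc c = 0 \<or> Gc c = 0")
      case True
      have zero: "heat z h x = 0" if "AE y in lborel. h y = 0" "h \<in> borel_measurable borel" for z h and x :: 'a
        unfolding heat_def using that by (intro integral_eq_zero_AE) auto
      have "?T u v x = 0" for x
      proof (cases "Fc c = 0")
        case True
        then have "Lp_mass p\<^sub>1 u = 0" using uF by simp
        then have "AE y in lborel. ennreal (norm (u y) powr p\<^sub>1) = 0"
          by (subst (asm) nn_integral_0_iff_AE) auto
        then have "AE y in lborel. u y = 0" by eventually_elim (auto simp: ennreal_eq_0_iff)
        then show ?thesis by (simp add: br_piece_def zero)
      next
        case False
        then have "Gc c = 0" using True by simp
        then have "Lp_mass p\<^sub>2 v = 0" using vG by simp
        then have "AE y in lborel. ennreal (norm (v y) powr p\<^sub>2) = 0"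
          by (subst (asm) nn_integral_0_iff_AE) auto
        then have "AE y in lborel. v y = 0" by eventually_elim (auto simp: ennreal_eq_0_iff)
        then show ?thesis by (simp add: br_piece_def zero)
      qed
      then show ?thesis by simp
    next
      case False
      then have pos: "0 < Fc c" "0 < Gc c" using Fc0[of c] by auto
      show ?thesis
        by (rule near_bound) (use int pos uF vG p in \<open>auto simp: u_def v_def powr_powr dist_norm norm_minus_commute\<close>)
    qed
    have "?T f g x = ?T u v x + ?T u v' x + ?T u' g x" for x
    proof -
      have "?T f g x = ?T u g x + ?T u' g x"
        by (subst split(1)) (rule br_piece_add[OF \<alpha> int(1,2) g])
      also have "?T u g x = ?T g u x" by (rule br_piece_commute)
      also have "\<dots> = ?T v u x + ?T v' u x"
        by (subst split(2)) (rule br_piece_add[OF \<alpha> int(3,4,1)])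
      finally show ?thesis by (simp add: br_piece_commute[of _ _ u])
    qed
    moreover have "norm (?T u v' x + ?T u' g x) \<le> w x" if x: "norm (x - c) < L" for x
    proof -
      have far: "u' y = 0" "v' y = 0" if "norm (x - y) < L" for y
      proof -
        have "norm (y - c) \<le> norm (x - y) + norm (x - c)"
          using norm_triangle_ineq[of "y - x" "x - c"] by (simp add: norm_minus_commute)
        then have "norm (y - c) < 2 * L" using x that by simp
        then show "u' y = 0" "v' y = 0" by (simp_all add: u'_def v'_def)
      qed
      let ?e = "exp (- (L\<^sup>2 / (2 * R\<^sup>2)))" and ?\<pi> = "sqrt pi ^ DIM('a)"
      have mono: "gaussian_average s u x \<le> gaussian_average s f x" "gaussian_average s u' x \<le> gaussian_average s f x" "gaussian_average s v' x \<le> gaussian_average s g x"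
        unfolding gaussian_average_def using s
        by (intro Bochner_Integration.integral_mono integrable_gaussian_average int f g; force simp: u_def u'_def v'_def)+
      have full: "norm (heat (Complex 1 t) h x) \<le> ?\<pi> * gaussian_average s h x" if "integrable lborel h" "t \<in> dyadic_shell j" for h t
        using norm_heat_shell_le[OF that, of 0 x] by (simp add: s_def R_def)
      have tail: "norm (heat (Complex 1 t) h x) \<le> ?\<pi> * ?e * gaussian_average s h x"
        if "integrable lborel h" "t \<in> dyadic_shell j" "\<And>y. norm (x - y) < L \<Longrightarrow> h y = 0" for h t
        using norm_heat_shell_le[OF that(1,2) less_imp_le[OF L] that(3)] by (simp add: s_def R_def)
      have "norm (?T u v' x) \<le> 4 * exp 1 * 2 ^ j * (?\<pi> * gaussian_average s f x) * (?\<pi> * ?e * gaussian_average s g x)"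
        using far mono
        by (intro norm_br_piece_le_sup[OF \<alpha> int(1) int(4)] order_trans[OF full[OF int(1)]] order_trans[OF tail[OF int(4)]] mult_left_mono) auto
      moreover have "norm (?T u' g x) \<le> 4 * exp 1 * 2 ^ j * (?\<pi> * ?e * gaussian_average s f x) * (?\<pi> * gaussian_average s g x)"
        using far mono
        by (intro norm_br_piece_le_sup[OF \<alpha> int(2) g] order_trans[OF tail[OF int(2)]] full[OF g] mult_left_mono) auto
      ultimately have "norm (?T u v' x + ?T u' g x) \<le> 4 * exp 1 * 2 ^ j * (?\<pi> * gaussian_average s f x) * (?\<pi> * ?e * gaussian_average s g x) + 4 * exp 1 * 2 ^ j * (?\<pi> * ?e * gaussian_average s f x) * (?\<pi> * gaussian_average s g x)"
        by (intro order_trans[OF norm_triangle_ineq] add_mono)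
      also have "\<dots> = 8 * exp 1 * R * (?\<pi> * ?\<pi>) * ?e * gaussian_average s f x * gaussian_average s g x"
        by (simp add: R_def)
      also have "\<dots> = w x" unfolding spi w_def Cw_def ..
      finally show ?thesis .
    qed
    ultimately have pw: "norm (?T f g x) powr p \<le> norm (?T u v x) powr p + w x powr p" if "norm (x - c) < L" for x
    proof -
      assume eq: "\<And>x. ?T f g x = ?T u v x + ?T u v' x + ?T u' g x" and le: "\<And>x. norm (x - c) < L \<Longrightarrow> norm (?T u v' x + ?T u' g x) \<le> w x"
      have "norm (?T f g x) \<le> norm (?T u v x) + w x"
        unfolding eq using le[OF that] norm_triangle_ineq[of "?T u v x" "?T u v' x + ?T u' g x"] by (simp add: add.assoc)
      then have "norm (?T f g x) powr p \<le> (norm (?T u v x) + w x) powr p" using p by (intro powr_mono2) auto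
      also have "\<dots> \<le> norm (?T u v x) powr p + w x powr p" using w0 p by (intro powr_add_le_add_powr) auto
      finally show ?thesis .
    qed
    have "(\<integral>\<^sup>+x. ennreal (norm (?T f g x) powr p) * (if norm (x - c) < L then 1 else 0) \<partial>lborel)
      \<le> (\<integral>\<^sup>+x. ennreal ((indicator (ball c L) x * norm (?T u v x)) powr p * (indicator (ball c L) x) powr (1 - p)) + ennreal (w x powr p) * (if norm (x - c) < L then 1 else 0) \<partial>lborel)"
    proof (intro nn_integral_mono)
      fix x
      show "ennreal (norm (?T f g x) powr p) * (if norm (x - c) < L then 1 else 0)
        \<le> ennreal ((indicator (ball c L) x * norm (?T u v x)) powr p * (indicator (ball c L) x) powr (1 - p)) + ennreal (w x powr p) * (if norm (x - c) < L then 1 else 0)"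
      proof (cases "norm (x - c) < L")
        case True
        then have "x \<in> ball c L" by (simp add: dist_norm norm_minus_commute)
        then show ?thesis using True pw[OF True]
          by (simp add: ennreal_plus[symmetric] ennreal_leI del: ennreal_plus)
      qed simp
    qed
    also have "\<dots> = (\<integral>\<^sup>+x. ennreal ((indicator (ball c L) x * norm (?T u v x)) powr p * (indicator (ball c L) x) powr (1 - p)) \<partial>lborel) + (\<integral>\<^sup>+x. ennreal (w x powr p) * (if norm (x - c) < L then 1 else 0) \<partial>lborel)"
      by (rule nn_integral_add) measurable
    also have "(\<integral>\<^sup>+x. ennreal ((indicator (ball c L) x * norm (?T u v x)) powr p * (indicator (ball c L) x) powr (1 - p)) \<partial>lborel)
       \<le> ennreal ((M * Fc c powr (1 / p\<^sub>1) * Gc c powr (1 / p\<^sub>2)) powr p * vol L powr (1 - p))"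
    \<comment> \<open>From L^1 to L^p on the ball, with \<theta> = p and the indicator as second
      function.\<close>
    proof (rule nn_integral_Holder_powr)
      show "(\<integral>\<^sup>+x. ennreal (indicator (ball c L) x * norm (?T u v x)) \<partial>lborel) \<le> ennreal (M * Fc c powr (1 / p\<^sub>1) * Gc c powr (1 / p\<^sub>2))"
        using near by (simp add: ennreal_mult ennreal_indicator)
      show "(\<integral>\<^sup>+x. ennreal (indicator (ball c L) x) \<partial>lborel) \<le> ennreal (vol L)"
        using vball[of L c] L by (simp add: ennreal_indicator)
    qed (use p M vol in auto)
    also have "(M * Fc c powr (1 / p\<^sub>1) * Gc c powr (1 / p\<^sub>2)) powr p * vol L powr (1 - p) = (vol L powr (1 - p) * M powr p) * (Fc c powr (p / p\<^sub>1) * Gc c powr (1 - p / p\<^sub>1))"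
      unfolding conj(1) using M Fc0[of c] p by (simp add: powr_mult powr_powr)
    also have "ennreal \<dots> = ennreal (vol L powr (1 - p) * M powr p) * ennreal (Fc c powr (p / p\<^sub>1) * Gc c powr (1 - p / p\<^sub>1))"
      by (simp add: ennreal_mult[symmetric])
    finally show ?thesis by (simp add: add_right_mono)
  qed
  \<comment> \<open>Integrate the ball estimates over all centres. Each point lies in balls whose
    centres fill a set of volume \<open>vol L\<close>. Hoelder in the centre uses p /
    \<open>p\<^sub>1\<close> + p / \<open>p\<^sub>2\<close> = 1, and the masses over doubled balls
    integrate to \<open>vol (2 * L)\<close> times the global ones.\<close>
  have "ennreal (vol L) * Lp_mass p (?T f g)
     = (\<integral>\<^sup>+c. \<integral>\<^sup>+x. ennreal (norm (?T f g x) powr p) * (if norm (x - c) < L then 1 else 0) \<partial>lborel \<partial>lborel)"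
    using L by (intro avg[symmetric]) auto
  also have "\<dots> \<le> (\<integral>\<^sup>+c. ennreal (vol L powr (1 - p) * M powr p) * ennreal (Fc c powr (p / p\<^sub>1) * Gc c powr (1 - p / p\<^sub>1))
      + (\<integral>\<^sup>+x. ennreal (w x powr p) * (if norm (x - c) < L then 1 else 0) \<partial>lborel) \<partial>lborel)"
    by (intro nn_integral_mono pointc)
  also have "\<dots> = ennreal (vol L powr (1 - p) * M powr p) * (\<integral>\<^sup>+c. ennreal (Fc c powr (p / p\<^sub>1) * Gc c powr (1 - p / p\<^sub>1)) \<partial>lborel)
      + (\<integral>\<^sup>+c. \<integral>\<^sup>+x. ennreal (w x powr p) * (if norm (x - c) < L then 1 else 0) \<partial>lborel \<partial>lborel)"
    by (subst nn_integral_add) (measurable, simp add: nn_integral_cmult)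
  also have "(\<integral>\<^sup>+c. \<integral>\<^sup>+x. ennreal (w x powr p) * (if norm (x - c) < L then 1 else 0) \<partial>lborel \<partial>lborel) = ennreal (vol L) * (\<integral>\<^sup>+x. ennreal (w x powr p) \<partial>lborel)"
    using L by (intro avg) auto
  also have "(\<integral>\<^sup>+c. ennreal (Fc c powr (p / p\<^sub>1) * Gc c powr (1 - p / p\<^sub>1)) \<partial>lborel) \<le> ennreal ((vol (2 * L) * F) powr (p / p\<^sub>1) * (vol (2 * L) * G) powr (1 - p / p\<^sub>1))"
  proof (rule nn_integral_Holder_powr)
    have "(\<integral>\<^sup>+c. ennreal (Fc c) \<partial>lborel) = ennreal (vol (2 * L)) * Lp_mass p\<^sub>1 f"
      unfolding finF using L by (intro avg) auto
    also have "\<dots> \<le> ennreal (vol (2 * L)) * ennreal F" by (intro mult_left_mono fF) auto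
    finally show "(\<integral>\<^sup>+c. ennreal (Fc c) \<partial>lborel) \<le> ennreal (vol (2 * L) * F)" using vol FG by (simp add: ennreal_mult)
    have "(\<integral>\<^sup>+c. ennreal (Gc c) \<partial>lborel) = ennreal (vol (2 * L)) * Lp_mass p\<^sub>2 g"
      unfolding finG using L by (intro avg) auto
    also have "\<dots> \<le> ennreal (vol (2 * L)) * ennreal G" by (intro mult_left_mono gG) auto
    finally show "(\<integral>\<^sup>+c. ennreal (Gc c) \<partial>lborel) \<le> ennreal (vol (2 * L) * G)" using vol FG by (simp add: ennreal_mult)
  qed (use conj Fc0 vol FG in auto)
  also have "(vol (2 * L) * F) powr (p / p\<^sub>1) * (vol (2 * L) * G) powr (1 - p / p\<^sub>1) = (vol (2 * L) powr (p / p\<^sub>1) * vol (2 * L) powr (1 - p / p\<^sub>1)) * (F powr (p / p\<^sub>1) * G powr (1 - p / p\<^sub>1))"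
    using vol FG by (simp add: powr_mult)
  also have "vol (2 * L) powr (p / p\<^sub>1) * vol (2 * L) powr (1 - p / p\<^sub>1) = vol (2 * L)"
    unfolding powr_add[symmetric] using vol by simp
  finally have "ennreal (vol L) * Lp_mass p (?T f g)
    \<le> ennreal (vol L powr (1 - p) * M powr p) * ennreal (vol (2 * L) * (F powr (p / p\<^sub>1) * G powr (1 - p / p\<^sub>1))) + ennreal (vol L) * (\<integral>\<^sup>+x. ennreal (w x powr p) \<partial>lborel)"
    by (simp add: add_right_mono mult_left_mono)
  also have "\<dots> \<le> ennreal (vol L powr (1 - p) * M powr p) * ennreal (vol (2 * L) * (F powr (p / p\<^sub>1) * G powr (1 - p / p\<^sub>1))) + ennreal (vol L) * ennreal (E powr p * (F powr (p / p\<^sub>1) * G powr (p / p\<^sub>2)))"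
    by (intro add_left_mono mult_left_mono w_int) auto
  also have "\<dots> = ennreal (vol L) * ennreal ((2 ^ DIM('a) * vol L powr (1 - p) * M powr p + E powr p) * (F powr (p / p\<^sub>1) * G powr (p / p\<^sub>2)))"
    unfolding conj(1) using vol by (simp add: ennreal_mult[symmetric] ennreal_plus[symmetric] algebra_simps del: ennreal_plus)
  finally show ?thesis using vol(1) unfolding vol_def[symmetric]
    by (subst (asm) ennreal_mult_le_mult_iff) auto
qed

section \<open>Summation over the shells\<close>

lemma two_power_powr: "((2::real) ^ j) powr a = (2 powr a) ^ j"
  by (simp add: powr_powr powr_realpow[symmetric] mult.commute)

lemma summable_two_power_powr:
  assumes "a < 0" shows "summable (\<lambda>j. ((2::real) ^ j) powr a)"
proof -
  have "(2::real) powr a < 2 powr 0" using assms by (intro powr_less_mono) auto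
  then show ?thesis unfolding two_power_powr by (intro summable_geometric) simp
qed

lemma bochner_riesz_measurable:
  fixes f g :: "real ^ 'n \<Rightarrow> complex"
  assumes \<alpha>: "0 < \<alpha>" and f: "integrable lborel f" and g: "integrable lborel g"
  shows "bochner_riesz \<alpha> f g \<in> borel_measurable borel"
proof -
  have [measurable]: "f \<in> borel_measurable borel" "g \<in> borel_measurable borel" using f g by auto
  show ?thesis unfolding bochner_riesz_eq[OF \<alpha> f g, abs_def] by measurable
qed

lemma bochner_riesz_commute:
  fixes f g :: "real ^ 'n \<Rightarrow> complex"
  assumes \<alpha>: "0 < \<alpha>" and f: "integrable lborel f" and g: "integrable lborel g"
  shows "bochner_riesz \<alpha> f g = bochner_riesz \<alpha> g f"
  unfolding bochner_riesz_eq[OF \<alpha> f g, abs_def] bochner_riesz_eq[OF \<alpha> g f, abs_def]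
  by (simp add: mult_ac)

lemma bochner_riesz_Lp_le_suminf:
  fixes f g :: "real ^ 'n \<Rightarrow> complex"
  assumes \<alpha>: "0 < \<alpha>" and f: "integrable lborel f" and g: "integrable lborel g"
    and p: "0 < p" "p \<le> 1" and D: "\<And>j. 0 \<le> D j" "summable D" and Z: "0 \<le> Z"
    and pieces: "\<And>j. Lp_mass p (br_piece \<alpha> j f g) \<le> ennreal (D j * Z)"
  shows "Lp_mass p (bochner_riesz \<alpha> f g)
    \<le> ennreal ((Gamma (\<alpha> + 1) / (2 * pi)) powr p * suminf D * Z)"
proof -
  have [measurable]: "f \<in> borel_measurable borel" "g \<in> borel_measurable borel" using f g by auto
  define c where "c = Gamma (\<alpha> + 1) / (2 * pi)"
  have "Gamma (\<alpha> + 1) > 0" by (rule Gamma_real_pos) (use \<alpha> in simp)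
  then have c: "c > 0" by (simp add: c_def)
  have "Lp_mass p (bochner_riesz \<alpha> f g)
    \<le> (\<integral>\<^sup>+x. ennreal (c powr p) * (\<Sum>j. ennreal (norm (br_piece \<alpha> j f g x) powr p)) \<partial>lborel)"
  proof (intro nn_integral_mono)
    fix x
    have "ennreal (norm (bochner_riesz \<alpha> f g x) powr p) = ennreal (c powr p) * ennreal (norm (\<integral>t. br_symbol \<alpha> t * heat (Complex 1 t) f x * heat (Complex 1 t) g x \<partial>lborel) powr p)"
      unfolding bochner_riesz_eq[OF \<alpha> f g] c_def[symmetric] using c by (simp add: norm_mult powr_mult ennreal_mult)
    also have "\<dots> \<le> ennreal (c powr p) * (\<Sum>j. ennreal (norm (br_piece \<alpha> j f g x) powr p))"
      unfolding br_piece_def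
      by (intro mult_left_mono norm_integral_powr_le_suminf_shells integrable_br_integrand \<alpha> f g p) auto
    finally show "ennreal (norm (bochner_riesz \<alpha> f g x) powr p) \<le> ennreal (c powr p) * (\<Sum>j. ennreal (norm (br_piece \<alpha> j f g x) powr p))" .
  qed
  also have "\<dots> = ennreal (c powr p) * (\<integral>\<^sup>+x. (\<Sum>j. ennreal (norm (br_piece \<alpha> j f g x) powr p)) \<partial>lborel)"
    by (rule nn_integral_cmult) measurable
  also have "(\<integral>\<^sup>+x. (\<Sum>j. ennreal (norm (br_piece \<alpha> j f g x) powr p)) \<partial>lborel) = (\<Sum>j. \<integral>\<^sup>+x. ennreal (norm (br_piece \<alpha> j f g x) powr p) \<partial>lborel)"
    by (rule nn_integral_suminf) measurable
  also have "ennreal (c powr p) * \<dots> \<le> ennreal (c powr p) * (\<Sum>j. ennreal (D j * Z))"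
    by (intro mult_left_mono suminf_le pieces) auto
  also have "(\<Sum>j. ennreal (D j * Z)) = ennreal (\<Sum>j. D j * Z)"
    using D Z by (intro suminf_ennreal2) (auto intro: summable_mult2)
  also have "(\<Sum>j. D j * Z) = suminf D * Z" using suminf_mult2[OF D(2), of Z] by simp
  also have "ennreal (c powr p) * ennreal (suminf D * Z) = ennreal (c powr p * suminf D * Z)"
    using D Z by (simp add: ennreal_mult[symmetric] suminf_nonneg mult.assoc)
  finally show ?thesis by (simp add: c_def)
qed

lemma powr_le_exp_half:
  fixes x m :: real
  assumes "0 < x" "0 < m"
  shows "x powr m \<le> (2 * m) powr m * exp (x / 2)"
proof -
  have "x / (2 * m) \<le> exp (x / (2 * m))" using exp_ge_add_one_self[of "x / (2 * m)"] by linarith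
  then have "x \<le> 2 * m * exp (x / (2 * m))" using assms by (simp add: field_simps)
  then have "x powr m \<le> (2 * m * exp (x / (2 * m))) powr m" using assms by (intro powr_mono2) auto
  also have "\<dots> = (2 * m) powr m * exp (x / 2)" using assms by (simp add: powr_mult exp_powr_real)
  finally show ?thesis .
qed

section \<open>Schwartz functions and the passage to quasi-norms\<close>

lemma schwartz_bounded:
  fixes f :: "real ^ 'n \<Rightarrow> complex"
  assumes "schwartz f"
  obtains B where "0 \<le> B" "\<And>x. norm (norm x ^ k *\<^sub>R f x) \<le> B"
proof -
  have "bounded (range (\<lambda>x. norm x ^ k *\<^sub>R iter_partial_deriv [] f x))"
    using assms unfolding schwartz_def by blast
  then obtain B where "\<And>x. norm (norm x ^ k *\<^sub>R f x) \<le> B" unfolding bounded_iff by auto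
  moreover from this[of 0] have "0 \<le> B" using norm_ge_zero order_trans by blast
  ultimately show ?thesis using that by blast
qed

text \<open>The majorant is the product over coordinates of 1 / (1 + t^2), written as
  \<open>norm (Complex 1 t) powr (- 2)\<close> to reuse integrability on the line. The reciprocal of
  the product is at most 2^n (1 + |x|^(2 n)), so the bounds with weights of degree 0 and 2 n
  suffice.\<close>

lemma schwartz_integrable:
  fixes f :: "real ^ 'n \<Rightarrow> complex"
  assumes f: "schwartz f"
  shows "integrable lborel f"
proof -
  let ?n = "DIM(real ^ 'n)"
  define h where "h x = (\<Prod>b\<in>(Basis::(real ^ 'n) set). norm (Complex 1 (x \<bullet> b)) powr (- 2))" for x
  have h: "integrable lborel h"
    unfolding h_def by (intro lborel_integral_prod_Basis(1) integrable_norm_vertical_line_powr) simp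
  obtain B0 where B0: "0 \<le> B0" "\<And>x. norm (norm x ^ 0 *\<^sub>R f x) \<le> B0" by (rule schwartz_bounded[OF f, where k = 0]) blast
  obtain B1 where B1: "0 \<le> B1" "\<And>x. norm (norm x ^ (2 * ?n) *\<^sub>R f x) \<le> B1" by (rule schwartz_bounded[OF f, where k = "2 * ?n"]) blast
  have "f differentiable (at x)" for x
  proof -
    have "iter_partial_deriv [] f differentiable (at x)" using f unfolding schwartz_def by blast
    then show ?thesis by simp
  qed
  then have "continuous_on UNIV f"
    by (intro continuous_at_imp_continuous_on ballI differentiable_imp_continuous_within)
  then have [measurable]: "f \<in> borel_measurable borel" by (rule borel_measurable_continuous_onI)
  show ?thesis
  proof (rule Bochner_Integration.integrable_bound)
    show "integrable lborel (\<lambda>x. (2 ^ ?n * (B0 + B1)) * h x)" using h by (rule integrable_mult_right)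
    show "AE x in lborel. norm (f x) \<le> norm ((2 ^ ?n * (B0 + B1)) * h x)"
    proof (rule AE_I2)
      fix x
      define P where "P = (\<Prod>b\<in>(Basis::(real ^ 'n) set). 1 + (x \<bullet> b)\<^sup>2)"
      have P: "P > 0" unfolding P_def by (intro prod_pos ballI add_pos_nonneg) auto
      have "norm (Complex 1 t) powr (- 2) = 1 / (1 + t\<^sup>2)" for t
        using norm_Complex_1(1)[of t] norm_Complex_1(3)[of t] by (simp add: powr_minus divide_inverse)
      then have hP: "h x = 1 / P" by (simp add: h_def P_def prod_dividef)
      have "P \<le> (\<Prod>b\<in>(Basis::(real ^ 'n) set). 1 + (norm x)\<^sup>2)"
        unfolding P_def
        by (intro prod_mono) (auto simp: abs_le_square_iff[symmetric] Basis_le_norm)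
      also have "\<dots> = (1 + (norm x)\<^sup>2) ^ ?n" by simp
      also have "\<dots> \<le> 2 ^ ?n * (1 + norm x ^ (2 * ?n))"
      proof (cases "norm x \<le> 1")
        case True
        then have "(norm x)\<^sup>2 \<le> 1" by (simp add: power_le_one)
        then have "(1 + (norm x)\<^sup>2) ^ ?n \<le> 2 ^ ?n" by (intro power_mono) auto
        also have "\<dots> \<le> 2 ^ ?n * (1 + norm x ^ (2 * ?n))" by simp
        finally show ?thesis .
      next
        case False
        then have "1 \<le> (norm x)\<^sup>2" by (simp add: one_le_power)
        then have "(1 + (norm x)\<^sup>2) ^ ?n \<le> (2 * (norm x)\<^sup>2) ^ ?n" by (intro power_mono) auto
        also have "\<dots> = 2 ^ ?n * norm x ^ (2 * ?n)" by (simp add: power_mult_distrib power_mult)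
        also have "\<dots> \<le> 2 ^ ?n * (1 + norm x ^ (2 * ?n))" by simp
        finally show ?thesis .
      qed
      finally have "P * norm (f x) \<le> 2 ^ ?n * (1 + norm x ^ (2 * ?n)) * norm (f x)" by (intro mult_right_mono) auto
      also have "\<dots> = 2 ^ ?n * (norm (f x) + norm (norm x ^ (2 * ?n) *\<^sub>R f x))" by (simp add: algebra_simps)
      also have "\<dots> \<le> 2 ^ ?n * (B0 + B1)" using B0(2)[of x] B1(2)[of x] by (intro mult_left_mono add_mono) auto
      finally have "norm (f x) \<le> 2 ^ ?n * (B0 + B1) / P" using P by (simp add: field_simps)
      then show "norm (f x) \<le> norm ((2 ^ ?n * (B0 + B1)) * h x)" unfolding hP using B0(1) B1(1) P by simp
    qed
  qed simp
qed

lemma schwartz_powr_finite: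
  fixes f :: "real ^ 'n \<Rightarrow> complex"
  assumes f: "schwartz f" and r: "1 \<le> r"
  shows "Lp_mass r f < \<infinity>"
proof -
  have int: "integrable lborel f" by (rule schwartz_integrable[OF f])
  then have [measurable]: "f \<in> borel_measurable borel" by auto
  obtain B0 where B0: "0 \<le> B0" "\<And>x. norm (norm x ^ 0 *\<^sub>R f x) \<le> B0" by (rule schwartz_bounded[OF f, where k = 0]) blast
  have "Lp_mass r f \<le> (\<integral>\<^sup>+x. ennreal (B0 powr (r - 1)) * ennreal (norm (f x)) \<partial>lborel)"
  proof (intro nn_integral_mono)
    fix x
    have "norm (f x) powr r \<le> B0 powr (r - 1) * norm (f x)"
    proof (cases "f x = 0")
      case False
      then have "norm (f x) powr r = norm (f x) powr (r - 1) * norm (f x)" by (simp add: powr_diff)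
      also have "\<dots> \<le> B0 powr (r - 1) * norm (f x)" using B0(2)[of x] r by (intro mult_right_mono powr_mono2) auto
      finally show ?thesis .
    qed (use r in simp)
    then show "ennreal (norm (f x) powr r) \<le> ennreal (B0 powr (r - 1)) * ennreal (norm (f x))"
      by (simp add: ennreal_mult[symmetric])
  qed
  also have "\<dots> = ennreal (B0 powr (r - 1)) * (\<integral>\<^sup>+x. ennreal (norm (f x)) \<partial>lborel)" by (rule nn_integral_cmult) measurable
  also have "\<dots> < \<infinity>" using int by (simp add: integrable_iff_bounded ennreal_mult_less_top)
  finally show ?thesis .
qed

lemma Lp_norm_ereal:
  fixes h :: "real ^ 'n \<Rightarrow> complex"
  assumes "h \<in> borel_measurable borel" and "Lp_mass r h = ennreal F" "0 \<le> F"
  shows "Lp_norm (ereal r) h = ennreal (F powr (1 / r))"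
  using assms by (simp add: Lp_norm_def Let_def)

text \<open>Masses of Schwartz functions are finite, so the estimate can be read between real
  numbers and its p-th root taken.\<close>

lemma Lp_bounded_bochner_riesz_ereal:
  fixes p p\<^sub>1 p\<^sub>2 \<alpha> :: real
  assumes \<alpha>: "0 < \<alpha>" and p: "0 < p" "1 \<le> p\<^sub>1" "1 \<le> p\<^sub>2" and C: "0 \<le> C"
    and bd: "\<And>(f :: real ^ 'n::finite \<Rightarrow> complex) g F G. integrable lborel f \<Longrightarrow> integrable lborel g \<Longrightarrow> 0 \<le> F \<Longrightarrow> 0 \<le> G \<Longrightarrow>
      Lp_mass p\<^sub>1 f \<le> ennreal F \<Longrightarrow>
      Lp_mass p\<^sub>2 g \<le> ennreal G \<Longrightarrow>
      Lp_mass p (bochner_riesz \<alpha> f g) \<le> ennreal (C * (F powr (p / p\<^sub>1) * G powr (p / p\<^sub>2)))"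
  shows "Lp_bounded (bochner_riesz \<alpha> :: (real ^ 'n \<Rightarrow> complex) \<Rightarrow> _) (ereal p\<^sub>1) (ereal p\<^sub>2) (ereal p)"
  unfolding Lp_bounded_def
proof (intro exI allI impI)
  fix f g :: "real ^ 'n \<Rightarrow> complex" assume fg: "schwartz f" "schwartz g"
  note int = schwartz_integrable[OF fg(1)] schwartz_integrable[OF fg(2)]
  have [measurable]: "f \<in> borel_measurable borel" "g \<in> borel_measurable borel" using int by auto
  define F where "F = enn2real (Lp_mass p\<^sub>1 f)"
  define G where "G = enn2real (Lp_mass p\<^sub>2 g)"
  have F: "0 \<le> F" "Lp_mass p\<^sub>1 f = ennreal F"
    using schwartz_powr_finite[OF fg(1) p(2)] by (simp_all add: F_def)
  have G: "0 \<le> G" "Lp_mass p\<^sub>2 g = ennreal G"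
    using schwartz_powr_finite[OF fg(2) p(3)] by (simp_all add: G_def)
  define H where "H = enn2real (Lp_mass p (bochner_riesz \<alpha> f g))"
  have le: "Lp_mass p (bochner_riesz \<alpha> f g) \<le> ennreal (C * (F powr (p / p\<^sub>1) * G powr (p / p\<^sub>2)))"
    using bd[OF int F(1) G(1)] F(2) G(2) by simp
  have H: "0 \<le> H" "Lp_mass p (bochner_riesz \<alpha> f g) = ennreal H"
    using ennreal_enn2real[OF le_less_trans[OF le ennreal_less_top]] by (simp_all add: H_def)
  have "H \<le> C * (F powr (p / p\<^sub>1) * G powr (p / p\<^sub>2))"
    using le unfolding H(2) using C by (simp add: ennreal_le_iff)
  then have "H powr (1 / p) \<le> (C * (F powr (p / p\<^sub>1) * G powr (p / p\<^sub>2))) powr (1 / p)"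
    using H p by (intro powr_mono2) auto
  also have "\<dots> = C powr (1 / p) * F powr (1 / p\<^sub>1) * G powr (1 / p\<^sub>2)"
    using C F G p by (simp add: powr_mult powr_powr)
  finally have "ennreal (H powr (1 / p)) \<le> ennreal (C powr (1 / p)) * ennreal (F powr (1 / p\<^sub>1)) * ennreal (G powr (1 / p\<^sub>2))"
    by (simp add: ennreal_mult[symmetric] ennreal_leI)
  then show "Lp_norm (ereal p) (bochner_riesz \<alpha> f g) \<le> ennreal (C powr (1 / p)) * Lp_norm (ereal p\<^sub>1) f * Lp_norm (ereal p\<^sub>2) g"
    using Lp_norm_ereal[OF bochner_riesz_measurable[OF \<alpha> int] H(2,1)] Lp_norm_ereal[OF _ F(2,1)] Lp_norm_ereal[OF _ G(2,1)] by simp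
qed

text \<open>With radius L = R^(1 + \<epsilon>) the far error contains exp (- R^(2 \<epsilon>) / 2),
  while the step from L^1 to L^p costs R^(n (1 + \<epsilon>)(1 - p)) in p-th powers. Assumption
  \<open>exps\<close> says that the local gain R^(- \<kappa> p) beats this cost, so the masses of
  the pieces are dominated by convergent geometric series.\<close>

lemma Lp_bounded_from_local:
  fixes p p\<^sub>1 p\<^sub>2 \<epsilon> \<kappa> C \<alpha> :: real
  assumes \<alpha>: "0 < \<alpha>" and p: "0 < p" "p \<le> 1" "1 \<le> p\<^sub>1" "1 \<le> p\<^sub>2" "1 / p = 1 / p\<^sub>1 + 1 / p\<^sub>2"
    and \<epsilon>: "0 < \<epsilon>" and C: "0 \<le> C"
    and exps: "real CARD('n) * (1 + \<epsilon>) * (1 - p) < \<kappa> * p"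
    and near_bound: "\<And>j (c::real ^ 'n::finite) u v A B. integrable lborel u \<Longrightarrow> integrable lborel v \<Longrightarrow>
        (\<And>y. y \<notin> ball c (2 * (2 ^ j) powr (1 + \<epsilon>)) \<Longrightarrow> u y = 0) \<Longrightarrow> (\<And>y. y \<notin> ball c (2 * (2 ^ j) powr (1 + \<epsilon>)) \<Longrightarrow> v y = 0) \<Longrightarrow> 0 < A \<Longrightarrow> 0 < B \<Longrightarrow>
        Lp_mass p\<^sub>1 u \<le> ennreal (A powr p\<^sub>1) \<Longrightarrow>
        Lp_mass p\<^sub>2 v \<le> ennreal (B powr p\<^sub>2) \<Longrightarrow>
        (\<integral>\<^sup>+x. indicator (ball c ((2 ^ j) powr (1 + \<epsilon>))) x * ennreal (norm (br_piece \<alpha> j u v x)) \<partial>lborel) \<le> ennreal (C * (2 ^ j) powr (- \<kappa>) * A * B)"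
  shows "Lp_bounded (bochner_riesz \<alpha> :: (real ^ 'n \<Rightarrow> complex) \<Rightarrow> _) (ereal p\<^sub>1) (ereal p\<^sub>2) (ereal p)"
proof -
  define n where "n = CARD('n)"
  define L where "L j = ((2::real) ^ j) powr (1 + \<epsilon>)" for j :: nat
  have L: "L j > 0" for j by (simp add: L_def)
  define \<omega> where "\<omega> = unit_ball_vol (real n)"
  have \<omega>: "\<omega> > 0" by (simp add: \<omega>_def unit_ball_vol_pos)
  define E where "E j = 8 * exp 1 * 2 ^ j * pi ^ n * exp (- ((L j)\<^sup>2 / (2 * (2 ^ j)\<^sup>2))) * (sqrt (2 * pi * (2 ^ j)\<^sup>2) ^ n)\<^sup>2" for j :: nat
  define D where "D j = 2 ^ n * (\<omega> * L j ^ n) powr (1 - p) * (C * (2 ^ j) powr (- \<kappa>)) powr p + E j powr p" for j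
  \<comment> \<open>Chosen so that the m-th power of R^(2 \<epsilon>) is R^(2 + 2 n): the far error
    carries R^(1 + 2 n), and one factor 1 / R is left for summation.\<close>
  define m where "m = (1 + real n) / \<epsilon>"
  have m: "m > 0" using \<epsilon> by (simp add: m_def)
  define CE where "CE = 8 * exp 1 * pi ^ n * (2 * pi) ^ n * (2 * m) powr m"
  have CE: "CE > 0" using m by (simp add: CE_def)
  have E: "0 \<le> E j" "E j \<le> CE * (2 ^ j) powr (- 1)" for j
  proof -
    define R :: real where "R = 2 ^ j"
    have R: "R > 0" by (simp add: R_def)
    show "0 \<le> E j" by (simp add: E_def)
    have x: "(L j)\<^sup>2 / (2 * R\<^sup>2) = R powr (2 * \<epsilon>) / 2"
    proof -
      have "(L j)\<^sup>2 = R powr (2 + 2 * \<epsilon>)" unfolding L_def R_def[symmetric] power2_eq_square powr_add[symmetric] by (simp add: algebra_simps)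
      also have "\<dots> = R\<^sup>2 * R powr (2 * \<epsilon>)" using R by (simp add: powr_add)
      finally show ?thesis using R by simp
    qed
    have "(R powr (2 * \<epsilon>)) powr m \<le> (2 * m) powr m * exp (R powr (2 * \<epsilon>) / 2)"
      using R m by (intro powr_le_exp_half) auto
    moreover have "(R powr (2 * \<epsilon>)) powr m = R powr (2 + 2 * real n)"
    proof -
      have "2 * \<epsilon> * m = 2 + 2 * real n" using \<epsilon> by (simp add: m_def)
      then show ?thesis by (simp only: powr_powr)
    qed
    ultimately have bd: "R powr (2 + 2 * real n) * exp (- (R powr (2 * \<epsilon>) / 2)) \<le> (2 * m) powr m"
      by (simp add: exp_minus field_simps)
    have s: "(sqrt (2 * pi * R\<^sup>2) ^ n)\<^sup>2 = (2 * pi) ^ n * R powr (2 * real n)"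
    proof -
      have "(sqrt (2 * pi * R\<^sup>2) ^ n)\<^sup>2 = ((sqrt (2 * pi * R\<^sup>2))\<^sup>2) ^ n" by (simp only: power_mult[symmetric] mult.commute)
      also have "\<dots> = (2 * pi) ^ n * (R\<^sup>2) ^ n" by (simp add: power_mult_distrib)
      also have "(R\<^sup>2) ^ n = R powr (2 * real n)"
        using powr_realpow[OF R, of "2 * n"] by (simp add: power_mult)
      finally show ?thesis .
    qed
    have "E j = 8 * exp 1 * pi ^ n * (2 * pi) ^ n * ((R powr 1 * R powr (2 * real n)) * exp (- (R powr (2 * \<epsilon>) / 2)))"
      unfolding E_def R_def[symmetric] x s using R by simp
    also have "R powr 1 * R powr (2 * real n) = R powr (2 + 2 * real n) * R powr (- 1)"
      unfolding powr_add[symmetric] by simp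
    also have "8 * exp 1 * pi ^ n * (2 * pi) ^ n * (R powr (2 + 2 * real n) * R powr (- 1) * exp (- (R powr (2 * \<epsilon>) / 2)))
      = 8 * exp 1 * pi ^ n * (2 * pi) ^ n * R powr (- 1) * (R powr (2 + 2 * real n) * exp (- (R powr (2 * \<epsilon>) / 2)))"
      by (simp only: mult_ac)
    also have "\<dots> \<le> 8 * exp 1 * pi ^ n * (2 * pi) ^ n * R powr (- 1) * (2 * m) powr m"
      by (intro mult_left_mono bd) auto
    also have "\<dots> = CE * R powr (- 1)" by (simp only: CE_def mult_ac)
    finally show "E j \<le> CE * (2 ^ j) powr (- 1)" by (simp only: R_def)
  qed
  define \<delta> where "\<delta> = real n * (1 + \<epsilon>) * (1 - p) - \<kappa> * p"
  have \<delta>: "\<delta> < 0" using exps by (simp add: \<delta>_def n_def)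
  have D0: "0 \<le> D j" for j by (simp add: D_def)
  have Dsum: "summable D"
  proof (rule summable_comparison_test')
    show "summable (\<lambda>j. 2 ^ n * \<omega> powr (1 - p) * C powr p * (2 ^ j) powr \<delta> + CE powr p * (2 ^ j) powr (- p))"
      using \<delta> p by (intro summable_add summable_mult summable_two_power_powr) auto
    fix j :: nat
    define R :: real where "R = 2 ^ j"
    have R: "R > 0" by (simp add: R_def)
    have "L j ^ n = R powr (real n * (1 + \<epsilon>))"
      using R by (simp add: L_def R_def[symmetric] powr_realpow[symmetric] powr_powr mult.commute)
    then have "(\<omega> * L j ^ n) powr (1 - p) * (C * R powr (- \<kappa>)) powr p = \<omega> powr (1 - p) * C powr p * (R powr (real n * (1 + \<epsilon>) * (1 - p)) * R powr (- \<kappa> * p))"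
      using \<omega> C R by (simp add: powr_mult powr_powr)
    also have "R powr (real n * (1 + \<epsilon>) * (1 - p)) * R powr (- \<kappa> * p) = R powr \<delta>"
      unfolding powr_add[symmetric] \<delta>_def by simp
    finally have 1: "2 ^ n * (\<omega> * L j ^ n) powr (1 - p) * (C * R powr (- \<kappa>)) powr p = 2 ^ n * \<omega> powr (1 - p) * C powr p * R powr \<delta>"
      by simp
    have "E j powr p \<le> (CE * R powr (- 1)) powr p" using E[of j] p by (intro powr_mono2) (auto simp: R_def)
    also have "\<dots> = CE powr p * (R powr (- 1)) powr p" by (rule powr_mult)
    also have "(R powr (- 1)) powr p = R powr (- p)" unfolding powr_powr by simp
    finally have 2: "E j powr p \<le> CE powr p * R powr (- p)" .
    have "norm (D j) = 2 ^ n * \<omega> powr (1 - p) * C powr p * R powr \<delta> + E j powr p"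
      using D0[of j] unfolding D_def R_def[symmetric] 1 by simp
    with 2 show "norm (D j) \<le> 2 ^ n * \<omega> powr (1 - p) * C powr p * (2 ^ j) powr \<delta> + CE powr p * (2 ^ j) powr (- p)"
      unfolding R_def[symmetric] by linarith
  qed
  show ?thesis
  proof (rule Lp_bounded_bochner_riesz_ereal[OF \<alpha> p(1,3,4), of "(Gamma (\<alpha> + 1) / (2 * pi)) powr p * suminf D"])
    show "0 \<le> (Gamma (\<alpha> + 1) / (2 * pi)) powr p * suminf D"
      using D0 Dsum by (simp add: suminf_nonneg)
    fix f g :: "real ^ 'n \<Rightarrow> complex" and F G :: real
    assume fg: "integrable lborel f" "integrable lborel g" "0 \<le> F" "0 \<le> G"
      "Lp_mass p\<^sub>1 f \<le> ennreal F"
      "Lp_mass p\<^sub>2 g \<le> ennreal G"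
    show "Lp_mass p (bochner_riesz \<alpha> f g) \<le> ennreal ((Gamma (\<alpha> + 1) / (2 * pi)) powr p * suminf D * (F powr (p / p\<^sub>1) * G powr (p / p\<^sub>2)))"
    proof (rule bochner_riesz_Lp_le_suminf[OF \<alpha> fg(1,2) p(1,2) D0 Dsum])
      show "Lp_mass p (br_piece \<alpha> j f g) \<le> ennreal (D j * (F powr (p / p\<^sub>1) * G powr (p / p\<^sub>2)))" for j
        using br_piece_Lp_from_local[OF \<alpha> fg(1,2) p L[of j] _ fg(3-6), of "C * (2 ^ j) powr (- \<kappa>)" j] near_bound C
        unfolding D_def E_def \<omega>_def n_def L_def by simp
    qed simp
  qed
qed

section \<open>The two regions\<close>

lemma Lp_bounded_bochner_riesz_commute:
  assumes \<alpha>: "0 < \<alpha>" and b: "Lp_bounded (bochner_riesz \<alpha> :: (real ^ 'n::finite \<Rightarrow> complex) \<Rightarrow> _) p\<^sub>2 p\<^sub>1 p"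
  shows "Lp_bounded (bochner_riesz \<alpha> :: (real ^ 'n \<Rightarrow> complex) \<Rightarrow> _) p\<^sub>1 p\<^sub>2 p"
proof -
  obtain C :: real where C: "\<And>f g :: real ^ 'n \<Rightarrow> complex. schwartz f \<Longrightarrow> schwartz g \<Longrightarrow> Lp_norm p (bochner_riesz \<alpha> f g) \<le> ennreal C * Lp_norm p\<^sub>2 f * Lp_norm p\<^sub>1 g"
    using b unfolding Lp_bounded_def by blast
  show ?thesis unfolding Lp_bounded_def
  proof (intro exI[of _ C] allI impI)
    fix f g :: "real ^ 'n \<Rightarrow> complex" assume fg: "schwartz f" "schwartz g"
    show "Lp_norm p (bochner_riesz \<alpha> f g) \<le> ennreal C * Lp_norm p\<^sub>1 f * Lp_norm p\<^sub>2 g"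
      using C[OF fg(2,1)] bochner_riesz_commute[OF \<alpha> schwartz_integrable[OF fg(1)] schwartz_integrable[OF fg(2)]]
      by (simp add: mult_ac)
  qed
qed

text \<open>Two losses add up to the threshold: n (1/2 - 1/\<open>p\<^sub>2\<close>) for placing the
  second function in L^2 on a ball, and n (1/p - 1) for passing from L^1 to L^p. Their sum is n
  (1/\<open>p\<^sub>1\<close> - 1/2).\<close>

lemma Lp_bounded_region_one:
  fixes p p\<^sub>1 p\<^sub>2 \<alpha> :: real
  assumes p: "0 < p" "p \<le> 1" "1 \<le> p\<^sub>1" "p\<^sub>1 \<le> 2" "2 \<le> p\<^sub>2" "1 / p = 1 / p\<^sub>1 + 1 / p\<^sub>2"
    and \<alpha>: "real CARD('n) * (1 / p\<^sub>1 - 1 / 2) < \<alpha>"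
  shows "Lp_bounded (bochner_riesz \<alpha> :: (real ^ 'n::finite \<Rightarrow> complex) \<Rightarrow> _) (ereal p\<^sub>1) (ereal p\<^sub>2) (ereal p)"
proof -
  define n where "n = CARD('n)"
  define \<delta> where "\<delta> = real n * (1 / p\<^sub>1 - 1 / 2)"
  have \<delta>: "0 \<le> \<delta>" "\<delta> < \<alpha>" using \<alpha> p by (auto simp: \<delta>_def n_def field_simps)
  then have \<alpha>0: "0 < \<alpha>" by simp
  \<comment> \<open>Enlarging the balls turns the requirement \<delta> < \<alpha> into (1 +
    \<epsilon>) \<delta> < \<alpha>; this \<epsilon> uses at most half of the gap, and the + 1
    covers \<delta> = 0.\<close>
  define \<epsilon> where "\<epsilon> = (\<alpha> - \<delta>) / (2 * (\<delta> + 1))"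
  have \<epsilon>: "0 < \<epsilon>" using \<delta> by (simp add: \<epsilon>_def)
  have "\<epsilon> * \<delta> \<le> \<epsilon> * (\<delta> + 1)" using \<epsilon> by simp
  also have "\<dots> = (\<alpha> - \<delta>) / 2" using \<delta> by (simp add: \<epsilon>_def field_simps)
  finally have \<epsilon>\<delta>: "(1 + \<epsilon>) * \<delta> < \<alpha>" using \<delta> by (simp add: algebra_simps)
  define s where "s = 1 / 2 - 1 / p\<^sub>2"
  \<comment> \<open>The exponent left after R^(- \<alpha>) is multiplied by the volume R^(n (1 +
    \<epsilon>)) to the power s.\<close>
  define \<kappa> where "\<kappa> = \<alpha> - (1 + \<epsilon>) * n * s"
  have exps: "real CARD('n) * (1 + \<epsilon>) * (1 - p) < \<kappa> * p"
  proof -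
    have "n * (1 + \<epsilon>) * (1 / p - 1) = (1 + \<epsilon>) * \<delta> - (1 + \<epsilon>) * n * s"
 
    proof -
      have "n * (1 + \<epsilon>) * (a + b - 1) = (1 + \<epsilon>) * (n * (a - 1 / 2)) - (1 + \<epsilon>) * n * (1 / 2 - b)" for a b :: real
        by (simp add: field_simps)
      then show ?thesis unfolding p(6) \<delta>_def s_def .
    qed
    also have "\<dots> < \<kappa>" using \<epsilon>\<delta> by (simp add: \<kappa>_def)
    finally have "n * (1 + \<epsilon>) * (1 / p - 1) * p < \<kappa> * p" using p(1) by (rule mult_strict_right_mono)
    moreover have "n * (1 + \<epsilon>) * (1 / p - 1) * p = n * (1 + \<epsilon>) * (1 - p)" using p(1) by (simp add: field_simps)
    ultimately show ?thesis unfolding n_def[symmetric] by linarith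
  qed
  define \<omega> where "\<omega> = unit_ball_vol (real n)"
  have \<omega>: "\<omega> > 0" by (simp add: \<omega>_def unit_ball_vol_pos)
  define K where "K = bernstein_const TYPE(real ^ 'n)"
  have K: "1 \<le> K" using bernstein_const_ge(1)[where 'a = "real ^ 'n"] by (simp add: K_def)
  define C where "C = 4 * exp 1 * K * (\<omega> * 2 ^ n) powr s"
  have C: "0 \<le> C" using K by (simp add: C_def)
  have p12: "1 \<le> p\<^sub>2" using p by simp
  show ?thesis
  proof (rule Lp_bounded_from_local[OF \<alpha>0 p(1,2,3) p12 p(6) \<epsilon> C exps])
    fix j :: nat and c :: "real ^ 'n" and u v :: "real ^ 'n \<Rightarrow> complex" and A B :: real
    assume uv: "integrable lborel u" "integrable lborel v"
      "\<And>y. y \<notin> ball c (2 * (2 ^ j) powr (1 + \<epsilon>)) \<Longrightarrow> u y = 0" "\<And>y. y \<notin> ball c (2 * (2 ^ j) powr (1 + \<epsilon>)) \<Longrightarrow> v y = 0" "0 < A" "0 < B"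
      "Lp_mass p\<^sub>1 u \<le> ennreal (A powr p\<^sub>1)"
      "Lp_mass p\<^sub>2 v \<le> ennreal (B powr p\<^sub>2)"
    define R :: real where "R = 2 ^ j"
    have R: "R > 0" by (simp add: R_def)
    define V where "V = \<omega> * (2 * R powr (1 + \<epsilon>)) ^ n"
    have V: "V = (\<omega> * 2 ^ n) * R powr (n * (1 + \<epsilon>))"
      using R by (simp add: V_def power_mult_distrib powr_realpow[symmetric] powr_powr mult.commute)
    have eV: "emeasure lborel (ball c (2 * (2 ^ j) powr (1 + \<epsilon>))) \<le> ennreal V"
      by (simp add: emeasure_ball V_def \<omega>_def n_def R_def)
    have "(\<integral>\<^sup>+x. indicator (ball c ((2 ^ j) powr (1 + \<epsilon>))) x * ennreal (norm (br_piece \<alpha> j u v x)) \<partial>lborel) \<le> (\<integral>\<^sup>+x. ennreal (norm (br_piece \<alpha> j u v x)) \<partial>lborel)"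
      by (intro nn_integral_mono) (auto simp: indicator_def)
    also have "\<dots> \<le> ennreal (4 * exp 1 * (2 ^ j) powr (- \<alpha>) * (bernstein_const TYPE(real ^ 'n) * A) * (V powr (1 / 2 - 1 / p\<^sub>2) * B))"
      by (rule br_piece_local_mixed[OF \<alpha>0 uv(1,2) p(3,4,5) uv(5-8) _ eV _ uv(4)]) (use \<omega> in \<open>auto simp: V_def\<close>)
    also have "4 * exp 1 * (2 ^ j) powr (- \<alpha>) * (bernstein_const TYPE(real ^ 'n) * A) * (V powr (1 / 2 - 1 / p\<^sub>2) * B) = C * (R powr (- \<alpha>) * R powr (n * (1 + \<epsilon>) * s)) * A * B"
      unfolding V s_def[symmetric] using \<omega> R by (simp add: C_def K_def R_def powr_mult powr_powr mult_ac)
    also have "R powr (- \<alpha>) * R powr (n * (1 + \<epsilon>) * s) = R powr (- \<kappa>)"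
      unfolding powr_add[symmetric] \<kappa>_def by (simp add: mult_ac)
    finally show "(\<integral>\<^sup>+x. indicator (ball c ((2 ^ j) powr (1 + \<epsilon>))) x * ennreal (norm (br_piece \<alpha> j u v x)) \<partial>lborel) \<le> ennreal (C * (2 ^ j) powr (- \<kappa>) * A * B)"
      by (simp only: R_def)
  qed
qed

text \<open>Up to powers R^\<epsilon> the local bounds are R^(- \<alpha> - 1/2) from L^1 x L^1 and
  R^(- \<alpha>) from L^2 x L^2. Interpolation with \<theta> = 2 / \<open>p\<^sub>2\<close> - 1
  gives R^(- \<alpha> - h) with h = \<theta> / 2, which has to beat the cost n (1/p - 1).\<close>

lemma Lp_bounded_region_two:
  fixes p p\<^sub>1 p\<^sub>2 \<alpha> :: real
  assumes p: "0 < p" "1 \<le> p\<^sub>1" "p\<^sub>1 \<le> p\<^sub>2" "p\<^sub>2 \<le> 2" "1 / p = 1 / p\<^sub>1 + 1 / p\<^sub>2"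
    and \<alpha>: "real CARD('n) * (1 / p - 1) - (1 / p\<^sub>2 - 1 / 2) < \<alpha>"
  shows "Lp_bounded (bochner_riesz \<alpha> :: (real ^ 'n::finite \<Rightarrow> complex) \<Rightarrow> _) (ereal p\<^sub>1) (ereal p\<^sub>2) (ereal p)"
proof -
  define n where "n = CARD('n)"
  have n1: "1 \<le> real n" by (simp add: n_def Suc_leI)
  define h where "h = 1 / p\<^sub>2 - 1 / 2"
  have p12: "1 \<le> p\<^sub>2" using p by simp
  have h: "0 \<le> h" "h \<le> 1 / 2" using p p12 by (auto simp: h_def field_simps)
  have h1: "0 \<le> 1 / p\<^sub>1 - 1 / 2" "1 / p\<^sub>1 - 1 / 2 \<le> 1 / 2" using p by (auto simp: field_simps)
  have inv_p: "1 / p - 1 = (1 / p\<^sub>1 - 1 / 2) + h" by (simp add: p(5) h_def)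
  have ip: "0 \<le> 1 / p - 1" "1 / p - 1 \<le> 1" using h h1 unfolding inv_p by linarith+
  have p1: "p \<le> 1" using ip(1) p(1) by (simp add: field_simps)
  have "h \<le> 1 * (1 / p - 1)" using h1 by (simp add: inv_p)
  also have "\<dots> \<le> n * (1 / p - 1)" using n1 ip by (intro mult_right_mono)
  finally have \<alpha>0: "0 < \<alpha>" using \<alpha> by (simp add: h_def n_def)
  define gap where "gap = \<alpha> - (n * (1 / p - 1) - h)"
  have gap: "0 < gap" using \<alpha> by (simp add: gap_def h_def n_def)
  \<comment> \<open>The small losses are n \<epsilon> from the cost of passing to L^p (as 1/p - 1 <=
    1), n \<epsilon> from the volume in the kernel bound, and \<epsilon> from the number of levels:
    together (2 n + 1) \<epsilon>, at most half of the gap.\<close>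
  define \<epsilon> where "\<epsilon> = min 1 (gap / (2 * (2 * real n + 1)))"
  have \<epsilon>: "0 < \<epsilon>" "\<epsilon> \<le> 1" using gap by (auto simp: \<epsilon>_def)
  have "\<epsilon> * (2 * real n + 1) \<le> gap / (2 * (2 * real n + 1)) * (2 * real n + 1)"
    by (intro mult_right_mono) (auto simp: \<epsilon>_def)
  also have "\<dots> = gap / 2" by (simp add: field_simps)
  finally have \<epsilon>gap: "\<epsilon> * (2 * real n + 1) < gap" using gap by linarith
  define \<kappa> where "\<kappa> = \<alpha> + h - (n + 1) * \<epsilon>"
  have exps: "real CARD('n) * (1 + \<epsilon>) * (1 - p) < \<kappa> * p"
  proof -
    have "\<epsilon> * (n * (1 / p - 1)) \<le> \<epsilon> * (real n * 1)" by (intro mult_left_mono ip(2)) (use \<epsilon> in auto)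
    then have "n * (1 + \<epsilon>) * (1 / p - 1) < \<kappa>" using \<epsilon>gap by (simp add: \<kappa>_def gap_def algebra_simps)
    then have "n * (1 + \<epsilon>) * (1 / p - 1) * p < \<kappa> * p" using p(1) by (rule mult_strict_right_mono)
    moreover have "n * (1 + \<epsilon>) * (1 / p - 1) * p = n * (1 + \<epsilon>) * (1 - p)" using p(1) by (simp add: field_simps)
    ultimately show ?thesis unfolding n_def[symmetric] by linarith
  qed
  define \<theta> where "\<theta> = 2 / p\<^sub>2 - 1"
  have \<theta>: "0 \<le> \<theta>" "\<theta> \<le> 1" "\<theta> / 2 = h" "2 - 2 / p\<^sub>2 = 1 - \<theta>" using h by (auto simp: \<theta>_def h_def)
  define \<omega> where "\<omega> = unit_ball_vol (real n)"
  have \<omega>: "\<omega> > 0" by (simp add: \<omega>_def unit_ball_vol_pos)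
  define K where "K = bernstein_const TYPE(real ^ 'n)"
  have K: "1 \<le> K" using bernstein_const_ge(1)[where 'a = "real ^ 'n"] by (simp add: K_def)
  define kc where "kc = piece_kernel_const \<alpha> n"
  have kc: "0 \<le> kc" using \<alpha>0 by (simp add: kc_def piece_kernel_const_def)
  define c\<^sub>1 where "c\<^sub>1 = (\<omega> * kc) powr \<theta> * (4 * exp 1) powr (1 - \<theta>)"
  define c\<^sub>2 where "c\<^sub>2 = (real n + 2) * (2 / (\<epsilon> * ln 2)) + 1"
  have c\<^sub>2: "0 \<le> c\<^sub>2" using \<epsilon> by (simp add: c\<^sub>2_def)
  define C where "C = c\<^sub>2\<^sup>2 * (4 * K\<^sup>2) * c\<^sub>1 + 8 * exp 1 * K * sqrt (\<omega> * 2 ^ n)"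
  have C: "0 \<le> C" using K \<omega> by (simp add: C_def c\<^sub>1_def)
  show ?thesis
  proof (rule Lp_bounded_from_local[OF \<alpha>0 p(1) p1 p(2) p12 p(5) \<epsilon>(1) C exps])
    fix j :: nat and c :: "real ^ 'n" and u v :: "real ^ 'n \<Rightarrow> complex" and A B :: real
    assume uv: "integrable lborel u" "integrable lborel v"
      "\<And>y. y \<notin> ball c (2 * (2 ^ j) powr (1 + \<epsilon>)) \<Longrightarrow> u y = 0" "\<And>y. y \<notin> ball c (2 * (2 ^ j) powr (1 + \<epsilon>)) \<Longrightarrow> v y = 0" "0 < A" "0 < B"
      "Lp_mass p\<^sub>1 u \<le> ennreal (A powr p\<^sub>1)"
      "Lp_mass p\<^sub>2 v \<le> ennreal (B powr p\<^sub>2)"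
    define R :: real where "R = 2 ^ j"
    have R: "R > 0" "1 \<le> R" by (auto simp: R_def)
    \<comment> \<open>Then 2^N = R^(n + 2) outweighs sqrt V, which is at most a constant times R^n
      because \<epsilon> <= 1. The remainders are therefore smaller than the main term, while N
      stays proportional to log R.\<close>
    define N where "N = (n + 2) * j"
    have RN: "2 ^ N = R powr (real n + 2)"
      using R by (simp add: N_def R_def powr_realpow[symmetric] powr_powr algebra_simps)
    \<comment> \<open>The levels enter squared, so each factor N + 1 may cost R^(\<epsilon> /
      2).\<close>
    have poly: "real N + 1 \<le> c\<^sub>2 * R powr (\<epsilon> / 2)"
    proof -
      have "j * (\<epsilon> * ln 2 / 2) \<le> exp (j * (\<epsilon> * ln 2 / 2))"
        using exp_ge_add_one_self[of "j * (\<epsilon> * ln 2 / 2)"] by linarith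
      also have "\<dots> = R powr (\<epsilon> / 2)" by (simp add: R_def powr_def ln_realpow mult_ac)
      finally have "j \<le> 2 / (\<epsilon> * ln 2) * R powr (\<epsilon> / 2)" using \<epsilon> by (simp add: field_simps)
      then have "(real n + 2) * j \<le> (real n + 2) * (2 / (\<epsilon> * ln 2) * R powr (\<epsilon> / 2))" by (intro mult_left_mono) auto
      moreover have "1 \<le> R powr (\<epsilon> / 2)" using R \<epsilon> by (intro ge_one_powr_ge_zero) auto
      ultimately have "(real n + 2) * j + 1 \<le> (real n + 2) * (2 / (\<epsilon> * ln 2) * R powr (\<epsilon> / 2)) + R powr (\<epsilon> / 2)" by linarith
      then show ?thesis by (simp add: N_def c\<^sub>2_def algebra_simps)
    qed
    define V where "V = \<omega> * (2 * R powr (1 + \<epsilon>)) ^ n"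
    have V: "V = (\<omega> * 2 ^ n) * R powr (n * (1 + \<epsilon>))"
      using R by (simp add: V_def power_mult_distrib powr_realpow[symmetric] powr_powr mult.commute)
    have eV: "emeasure lborel (ball c (2 * (2 ^ j) powr (1 + \<epsilon>))) \<le> ennreal V"
      by (simp add: emeasure_ball V_def \<omega>_def n_def R_def)
    define W where "W = \<omega> * (R powr (1 + \<epsilon>)) ^ n"
    have W: "W = \<omega> * R powr (n * (1 + \<epsilon>))"
      using R by (simp add: W_def powr_realpow[symmetric] powr_powr mult.commute)
    have eW: "emeasure lborel (ball c ((2 ^ j) powr (1 + \<epsilon>))) \<le> ennreal W"
      by (simp add: emeasure_ball W_def \<omega>_def n_def R_def)
    define Y\<^sub>1 where "Y\<^sub>1 = W * (kc * R powr (- \<alpha> - 1 / 2 - n))"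
    define Y\<^sub>2 where "Y\<^sub>2 = 4 * exp 1 * R powr (- \<alpha>)"
    have Y1: "Y\<^sub>1 = (\<omega> * kc) * R powr (- \<alpha> - 1 / 2 + n * \<epsilon>)"
    proof -
      have "Y\<^sub>1 = (\<omega> * kc) * (R powr (n * (1 + \<epsilon>)) * R powr (- \<alpha> - 1 / 2 - n))" by (simp add: Y\<^sub>1_def W mult_ac)
      also have "R powr (n * (1 + \<epsilon>)) * R powr (- \<alpha> - 1 / 2 - n) = R powr (- \<alpha> - 1 / 2 + n * \<epsilon>)"
        unfolding powr_add[symmetric] by (simp add: algebra_simps)
      finally show ?thesis .
    qed
    have "(\<integral>\<^sup>+x. indicator (ball c ((2 ^ j) powr (1 + \<epsilon>))) x * ennreal (norm (br_piece \<alpha> j u v x)) \<partial>lborel)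
      \<le> ennreal (((real N + 1)\<^sup>2 * (4 * K\<^sup>2) * (Y\<^sub>1 powr (2 / p\<^sub>2 - 1) * Y\<^sub>2 powr (2 - 2 / p\<^sub>2)) + 2 * Y\<^sub>2 * K * sqrt V / 2 ^ N) * A * B)"
      using br_piece_local_diagonal[OF \<alpha>0 uv(1,2) p(2,3,4) uv(5-8) _ eV _ uv(3,4) _ eW, of j N] \<omega>
      by (simp add: Y\<^sub>1_def Y\<^sub>2_def kc_def K_def R_def n_def V_def W_def)
    also have "\<dots> \<le> ennreal (C * (2 ^ j) powr (- \<kappa>) * A * B)"
    proof (intro ennreal_leI mult_right_mono)
      have "Y\<^sub>1 powr (2 / p\<^sub>2 - 1) * Y\<^sub>2 powr (2 - 2 / p\<^sub>2) = c\<^sub>1 * (R powr ((- \<alpha> - 1 / 2 + n * \<epsilon>) * \<theta>) * R powr (- \<alpha> * (1 - \<theta>)))"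
        unfolding \<theta>(4) \<theta>_def[symmetric] Y1 Y\<^sub>2_def c\<^sub>1_def using \<omega> kc R by (simp add: powr_mult powr_powr)
      also have "\<dots> = c\<^sub>1 * R powr (- \<alpha> - h + n * \<epsilon> * \<theta>)"
        unfolding powr_add[symmetric] \<theta>(3)[symmetric] by (simp add: algebra_simps)
      also have "\<dots> \<le> c\<^sub>1 * R powr (- \<alpha> - h + n * \<epsilon>)"
        using R \<epsilon> \<theta> by (intro mult_left_mono powr_mono) (auto simp: c\<^sub>1_def mult_left_le)
      finally have Y: "Y\<^sub>1 powr (2 / p\<^sub>2 - 1) * Y\<^sub>2 powr (2 - 2 / p\<^sub>2) \<le> c\<^sub>1 * R powr (- \<alpha> - h + n * \<epsilon>)" .
      have "(real N + 1)\<^sup>2 \<le> (c\<^sub>2 * R powr (\<epsilon> / 2))\<^sup>2" using poly by (intro power_mono) auto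
      also have "\<dots> = c\<^sub>2\<^sup>2 * (R powr (\<epsilon> / 2) * R powr (\<epsilon> / 2))" by (simp add: power2_eq_square mult_ac)
      also have "R powr (\<epsilon> / 2) * R powr (\<epsilon> / 2) = R powr \<epsilon>" unfolding powr_add[symmetric] by simp
      finally have N2: "(real N + 1)\<^sup>2 \<le> c\<^sub>2\<^sup>2 * R powr \<epsilon>" .
      have "(real N + 1)\<^sup>2 * (4 * K\<^sup>2) * (Y\<^sub>1 powr (2 / p\<^sub>2 - 1) * Y\<^sub>2 powr (2 - 2 / p\<^sub>2)) \<le> (c\<^sub>2\<^sup>2 * R powr \<epsilon>) * (4 * K\<^sup>2) * (c\<^sub>1 * R powr (- \<alpha> - h + n * \<epsilon>))"
        by (intro mult_mono N2 Y) auto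
      also have "\<dots> = c\<^sub>2\<^sup>2 * (4 * K\<^sup>2) * c\<^sub>1 * (R powr \<epsilon> * R powr (- \<alpha> - h + n * \<epsilon>))" by (simp only: mult_ac)
      also have "R powr \<epsilon> * R powr (- \<alpha> - h + n * \<epsilon>) = R powr (- \<kappa>)"
        unfolding powr_add[symmetric] \<kappa>_def by (simp add: algebra_simps)
      finally have main: "(real N + 1)\<^sup>2 * (4 * K\<^sup>2) * (Y\<^sub>1 powr (2 / p\<^sub>2 - 1) * Y\<^sub>2 powr (2 - 2 / p\<^sub>2)) \<le> c\<^sub>2\<^sup>2 * (4 * K\<^sup>2) * c\<^sub>1 * R powr (- \<kappa>)" .
      have sV: "sqrt V = sqrt (\<omega> * 2 ^ n) * R powr (real n * (1 + \<epsilon>) / 2)"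
      proof -
        have "sqrt (R powr (real n * (1 + \<epsilon>))) = R powr (real n * (1 + \<epsilon>) / 2)"
          by (rule powr_half_sqrt_powr[symmetric, OF less_imp_le[OF R(1)]])
        then show ?thesis unfolding V real_sqrt_mult by (simp only:)
      qed
      have "2 * Y\<^sub>2 * K * sqrt V / 2 ^ N = 8 * exp 1 * K * sqrt (\<omega> * 2 ^ n) * (R powr (- \<alpha>) * R powr (real n * (1 + \<epsilon>) / 2) * R powr (- (real n + 2)))"
      proof -
        have "x / R powr (real n + 2) = x * R powr (- (real n + 2))" for x by (simp only: powr_minus divide_inverse)
        moreover have "2 * (4 * e * a) * k * (s * b) * d = 8 * e * k * s * (a * b * d)" for e a k s b d :: real by simp
        ultimately show ?thesis unfolding RN sV Y\<^sub>2_def by (simp only:)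
      qed
      also have "R powr (- \<alpha>) * R powr (real n * (1 + \<epsilon>) / 2) * R powr (- (real n + 2)) = R powr (- \<alpha> + real n * (1 + \<epsilon>) / 2 - (real n + 2))"
        unfolding powr_add[symmetric] by (simp only: diff_conv_add_uminus)
      also have "8 * exp 1 * K * sqrt (\<omega> * 2 ^ n) * R powr (- \<alpha> + real n * (1 + \<epsilon>) / 2 - (real n + 2)) \<le> 8 * exp 1 * K * sqrt (\<omega> * 2 ^ n) * R powr (- \<kappa>)"
      proof (intro mult_left_mono powr_mono)
        have "real n * \<epsilon> \<le> real n * 1" using \<epsilon> by (intro mult_left_mono) auto
        moreover have "0 \<le> real n * \<epsilon>" using \<epsilon> by simp
        moreover have "\<kappa> = \<alpha> + h - real n * \<epsilon> - \<epsilon>" by (simp add: \<kappa>_def algebra_simps)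
        moreover have "real n * (1 + \<epsilon>) / 2 = real n / 2 + real n * \<epsilon> / 2" by (simp add: distrib_left add_divide_distrib)
        ultimately show "- \<alpha> + real n * (1 + \<epsilon>) / 2 - (real n + 2) \<le> - \<kappa>"
          using h \<epsilon> by linarith
      qed (use R K \<omega> in auto)
      finally have rest: "2 * Y\<^sub>2 * K * sqrt V / 2 ^ N \<le> 8 * exp 1 * K * sqrt (\<omega> * 2 ^ n) * R powr (- \<kappa>)" .
      show "(real N + 1)\<^sup>2 * (4 * K\<^sup>2) * (Y\<^sub>1 powr (2 / p\<^sub>2 - 1) * Y\<^sub>2 powr (2 - 2 / p\<^sub>2)) + 2 * Y\<^sub>2 * K * sqrt V / 2 ^ N \<le> C * (2 ^ j) powr (- \<kappa>)"
        using add_mono[OF main rest] unfolding R_def[symmetric] C_def by (simp only: distrib_right)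
    qed (use uv in auto)
    finally show "(\<integral>\<^sup>+x. indicator (ball c ((2 ^ j) powr (1 + \<epsilon>))) x * ennreal (norm (br_piece \<alpha> j u v x)) \<partial>lborel) \<le> ennreal (C * (2 ^ j) powr (- \<kappa>) * A * B)" .
  qed
qed

text \<open>The only exponent that could be infinite is \<open>p\<^sub>2\<close> in Region I, but
  then p = \<open>p\<^sub>1\<close> >= 1, contrary to p < 1. Everything therefore reduces to real
  exponents.\<close>

lemma ereal_conjugate_exponents:
  fixes p\<^sub>1 p\<^sub>2 p :: ereal
  assumes "1 \<le> p\<^sub>1" "1 \<le> p\<^sub>2" "0 < p" "1 / p = 1 / p\<^sub>1 + 1 / p\<^sub>2" and fin: "p\<^sub>1 \<le> 2" "p \<noteq> \<infinity>" "p\<^sub>2 \<le> 2 \<or> p < 1"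
  obtains r r\<^sub>1 r\<^sub>2 :: real where "p = ereal r" "p\<^sub>1 = ereal r\<^sub>1" "p\<^sub>2 = ereal r\<^sub>2" "0 < r" "1 \<le> r\<^sub>1" "1 \<le> r\<^sub>2" "1 / r = 1 / r\<^sub>1 + 1 / r\<^sub>2"
proof -
  obtain r where r: "p = ereal r" "0 < r" using assms(3) fin(2) by (cases p) auto
  obtain r\<^sub>1 where r1: "p\<^sub>1 = ereal r\<^sub>1" "1 \<le> r\<^sub>1" using assms(1) fin(1) by (cases p\<^sub>1) (auto simp: one_ereal_def)
  have "p\<^sub>2 \<noteq> \<infinity>"
  proof
    assume inf: "p\<^sub>2 = \<infinity>"
    then have "p < 1" using fin(3) by auto
    then have "r < 1" by (simp add: r one_ereal_def)
    moreover have "ereal (1 / r) = ereal (1 / r\<^sub>1)" using assms(4) inf r r1 by (simp add: one_ereal_def)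
    then have "r = r\<^sub>1" using r r1 by (simp add: field_simps)
    ultimately show False using r1 by simp
  qed
  then obtain r\<^sub>2 where r2: "p\<^sub>2 = ereal r\<^sub>2" "1 \<le> r\<^sub>2" using assms(2) by (cases p\<^sub>2) (auto simp: one_ereal_def)
  have "ereal (1 / r) = ereal (1 / r\<^sub>1 + 1 / r\<^sub>2)" using assms(4) r r1 r2 by (simp add: one_ereal_def)
  then show ?thesis using that r r1 r2 by simp
qed

theorem theorem1:
  fixes p\<^sub>1 p\<^sub>2 p :: ereal and \<alpha> :: real
  defines "n \<equiv> ereal (real CARD('n::finite))"
  assumes "CARD('n) \<ge> 2"
    and "1 \<le> p\<^sub>1" and "1 \<le> p\<^sub>2"
    and "0 < p" and "1 / p = 1 / p\<^sub>1 + 1 / p\<^sub>2"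
  shows
    "(p\<^sub>1 \<le> 2 \<and> 2 \<le> p\<^sub>2 \<and> p < 1 \<and> ereal \<alpha> > n * (1 / p\<^sub>1 - 1 / 2) \<longrightarrow>
        Lp_bounded (bochner_riesz \<alpha> :: (real ^ 'n \<Rightarrow> complex) \<Rightarrow> _) p\<^sub>1 p\<^sub>2 p) \<and>
     (p\<^sub>2 \<le> 2 \<and> 2 \<le> p\<^sub>1 \<and> p < 1 \<and> ereal \<alpha> > n * (1 / p\<^sub>2 - 1 / 2) \<longrightarrow>
        Lp_bounded (bochner_riesz \<alpha> :: (real ^ 'n \<Rightarrow> complex) \<Rightarrow> _) p\<^sub>1 p\<^sub>2 p) \<and>
     (p\<^sub>1 \<le> p\<^sub>2 \<and> p\<^sub>2 \<le> 2 \<and> ereal \<alpha> > n * (1 / p - 1) - (1 / p\<^sub>2 - 1 / 2) \<longrightarrow>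
        Lp_bounded (bochner_riesz \<alpha> :: (real ^ 'n \<Rightarrow> complex) \<Rightarrow> _) p\<^sub>1 p\<^sub>2 p) \<and>
     (p\<^sub>2 \<le> p\<^sub>1 \<and> p\<^sub>1 \<le> 2 \<and> ereal \<alpha> > n * (1 / p - 1) - (1 / p\<^sub>1 - 1 / 2) \<longrightarrow>
        Lp_bounded (bochner_riesz \<alpha> :: (real ^ 'n \<Rightarrow> complex) \<Rightarrow> _) p\<^sub>1 p\<^sub>2 p)"
proof -
  have num: "(2::ereal) = ereal 2" by simp
  \<comment> \<open>General exponents \<open>q\<^sub>1\<close>, \<open>q\<^sub>2\<close> let the
    mirrored case follow by exchanging the functions. Positivity of \<alpha> is recorded because the
    symmetry of the operator is derived from its heat representation, which assumes it.\<close>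
  have one: "0 < \<alpha> \<and> Lp_bounded (bochner_riesz \<alpha> :: (real ^ 'n \<Rightarrow> complex) \<Rightarrow> _) q\<^sub>1 q\<^sub>2 p"
    if q: "1 \<le> q\<^sub>1" "1 \<le> q\<^sub>2" "1 / p = 1 / q\<^sub>1 + 1 / q\<^sub>2" "q\<^sub>1 \<le> 2" "2 \<le> q\<^sub>2" "p < 1" "n * (1 / q\<^sub>1 - 1 / 2) < ereal \<alpha>" for q\<^sub>1 q\<^sub>2
  proof -
    have "p \<noteq> \<infinity>" using q(6) by auto
    from ereal_conjugate_exponents[OF q(1,2) \<open>0 < p\<close> q(3,4) this disjI2[OF q(6)]]
    obtain r r\<^sub>1 r\<^sub>2 where r: "p = ereal r" "q\<^sub>1 = ereal r\<^sub>1" "q\<^sub>2 = ereal r\<^sub>2" "0 < r" "1 \<le> r\<^sub>1" "1 \<le> r\<^sub>2" "1 / r = 1 / r\<^sub>1 + 1 / r\<^sub>2"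
      by blast
    have *: "r\<^sub>1 \<le> 2" "2 \<le> r\<^sub>2" "r \<le> 1" using q(4,5,6) unfolding r num one_ereal_def by simp_all
    have \<alpha>: "real CARD('n) * (1 / r\<^sub>1 - 1 / 2) < \<alpha>"
      using q(7) r(5) unfolding r n_def num one_ereal_def by simp
    have "0 \<le> real CARD('n) * (1 / r\<^sub>1 - 1 / 2)" using * r by (simp add: field_simps)
    then show ?thesis unfolding r using Lp_bounded_region_one[OF r(4) *(3) r(5) *(1,2) r(7) \<alpha>] \<alpha> by auto
  qed
  have two: "0 < \<alpha> \<and> Lp_bounded (bochner_riesz \<alpha> :: (real ^ 'n \<Rightarrow> complex) \<Rightarrow> _) q\<^sub>1 q\<^sub>2 p"
    if q: "1 \<le> q\<^sub>1" "1 \<le> q\<^sub>2" "1 / p = 1 / q\<^sub>1 + 1 / q\<^sub>2" "q\<^sub>1 \<le> q\<^sub>2" "q\<^sub>2 \<le> 2" "n * (1 / p - 1) - (1 / q\<^sub>2 - 1 / 2) < ereal \<alpha>" for q\<^sub>1 q\<^sub>2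
  proof -
    \<comment> \<open>Region II does not assume p < 1: an infinite p would give 1 / p = 0, whereas
      both exponents on the right are finite.\<close>
    have "p \<noteq> \<infinity>"
    proof
      assume "p = \<infinity>"
      moreover obtain r\<^sub>1 r\<^sub>2 where "q\<^sub>1 = ereal r\<^sub>1" "q\<^sub>2 = ereal r\<^sub>2" "1 \<le> r\<^sub>1" "1 \<le> r\<^sub>2"
        using q(1,2,4,5) by (cases q\<^sub>1; cases q\<^sub>2) (auto simp: one_ereal_def)
      moreover from this have "0 < 1 / r\<^sub>1 + 1 / r\<^sub>2" by (intro add_pos_pos) auto
      ultimately show False using q(3) by (auto simp: one_ereal_def zero_ereal_def)
    qed
    from ereal_conjugate_exponents[OF q(1,2) \<open>0 < p\<close> q(3) order_trans[OF q(4,5)] this disjI1[OF q(5)]]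
    obtain r r\<^sub>1 r\<^sub>2 where r: "p = ereal r" "q\<^sub>1 = ereal r\<^sub>1" "q\<^sub>2 = ereal r\<^sub>2" "0 < r" "1 \<le> r\<^sub>1" "1 \<le> r\<^sub>2" "1 / r = 1 / r\<^sub>1 + 1 / r\<^sub>2"
      by blast
    have *: "r\<^sub>1 \<le> r\<^sub>2" "r\<^sub>2 \<le> 2" using q(4,5) unfolding r num by simp_all
    have \<alpha>: "real CARD('n) * (1 / r - 1) - (1 / r\<^sub>2 - 1 / 2) < \<alpha>"
      using q(6) r(4-6) unfolding r(1-3) n_def num one_ereal_def by simp
    have "0 \<le> real CARD('n) * (1 / r - 1) - (1 / r\<^sub>2 - 1 / 2)"
    proof -
      have a: "0 \<le> 1 / r\<^sub>1 - 1 / 2" "0 \<le> 1 / r\<^sub>2 - 1 / 2" using * r by (auto simp: field_simps)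
      have "1 / r\<^sub>2 - 1 / 2 \<le> 1 * (1 / r - 1)" using a unfolding r(7) by simp
      also have "\<dots> \<le> real CARD('n) * (1 / r - 1)"
        using a by (intro mult_right_mono) (auto simp: r(7) Suc_leI)
      finally show ?thesis by simp
    qed
    then show ?thesis unfolding r(1-3) using Lp_bounded_region_two[OF r(4,5) * r(7) \<alpha>] \<alpha> by auto
  qed
  have comm: "1 / p = 1 / p\<^sub>2 + 1 / p\<^sub>1" using assms by (simp add: add.commute)
  show ?thesis
    using one[of p\<^sub>1 p\<^sub>2] one[of p\<^sub>2 p\<^sub>1] two[of p\<^sub>1 p\<^sub>2] two[of p\<^sub>2 p\<^sub>1] comm assms Lp_bounded_bochner_riesz_commute[of \<alpha> p\<^sub>2 p\<^sub>1 p]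
    by blast
qed

end
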